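(* Let $\lambda$ be an $(m|n)$-hook partition of $r$. Then for all $i,j\in I(m|n,r)$ the modified symmetrizer $T^{\lambda}\{i:j\}$ (an element of $A(m|n,r)$ over $\mathbb Q$) is a $\mathbb{Z}$-linear combination of modified symmetrizers $T^{\lambda}\{u:v\}$ with $T_u$ and $T_v$ semistandard.
   Context: Symbols and multiindices. Fix $m,n,r$. The symbols $1,\dots,m$ are even and $m+1,\dots,m+n$ are odd; $|a|\in\{0,1\}$ denotes the parity of $a$. $I(m|n,r)$ is the set of multiindices $i=(i_1,\dots,i_r)$ with entries in $\{1,\dots,m+n\}$. The symmetric group $\Sigma_r$ acts on the right on multiindices by $(j\pi)_a=j_{\pi(a)}$. The signed action is $j*\pi=(-1)^{s(j,\pi)}\,j\pi$, where $s(j,\pi)$ is the number of pairs $a<b$ with $\pi(a)>\pi(b)$ and $j_{\pi(a)},j_{\pi(b)}>m$; expressions in signed multiindices are extended linearly, e.g. $\chi_{i,-j}=-\chi_{i,j}$ and $\chi_{-i,j}=-\chi_{i,j}$. The space $A(m|n,r)$ over $\mathbb Q$. $A(m|n)$ is the free supercommutative $\mathbb Q$-superalgebra on generators $c_{ab}$, $1\le a,b\le m+n$, of parity $|a|+|b|$, and $A(m|n,r)$ is its degree $r$ part. It is spanned by the elements $$\chi_{i,j}=(-1)^{\sum_{t=1}^r |i_t|(|i_{t+1}|+|j_{t+1}|+\dots+|i_r|+|j_r|)}c_{i_1j_1}c_{i_2j_2}\cdots c_{i_rj_r},$$ which satisfy $\chi_{i*\pi,j*\pi}=\chi_{i,j}$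 for $\pi\in\Sigma_r$. Tableaux. $\lambda$ is an $(m|n)$-hook partition of $r$ if it is a partition of $r$ with $\lambda_{m+1}\le n$. Fix a basic tableau $T$, i.e. a bijection from the diagram $[\lambda]$ to $\{1,\dots,r\}$; $C(T)$ and $R(T)$ are the subgroups of $\Sigma_r$ preserving each column, respectively each row, of $T$. For $i\in I(m|n,r)$, $T_i$ is the tableau of shape $\lambda$ with entry $i_{T(b)}$ in box $b$. $T_i$ is semistandard if its entries weakly increase down columns and from left to right along rows, no even symbol is repeated in a column, and no odd symbol is repeated in a row. Symmetrizers. $T^\lambda[i:j]=\sum_{\rho\in R(T)}\sum_{\kappa\in C(T)}\mathrm{sgn}(\kappa)\,\chi_{i*\rho,\,j*\kappa}$. Modified symmetrizers. For a tableau $T_j$ let $m_{aq}(j)$ be the number of occurrences of the symbol $a$ ($1\le a\le m$) in the $q$-th row of $T_j$ and $n_{ad}(j)$ the number of occurrences of the symbol $a$ ($m+1\le a\le m+n$) in the $d$-th column of $T_j$. Put $r(T_j)=\prod_{a=1}^m\prod_q m_{aq}(j)!$ and $c(T_j)=\prod_{a=m+1}^{m+n}\prod_d n_{ad}(j)!$, and $$T^\lambda\{i:j\}=\frac{1}{r(T_i)\,c(T_j)}\,T^\lambda[i:j].$$ *)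

theory Defs
  imports
    Complex_Main
    "HOL-Algebra.QuotRing"
    "HOL-Algebra.Module"
    "HOL-Library.FuncSet"
    "HOL-Combinatorics.Permutations"
begin

section \<open>The free associative algebra\<close>

text \<open>
  Noncommutative polynomials over the rationals in the letters \<open>X\<close>: a polynomial is its coefficient
  function on words, and multiplication is convolution along the decompositions of a word as a
  concatenation of two words.
\<close>

definition wmult :: "('g list \<Rightarrow> rat) \<Rightarrow> ('g list \<Rightarrow> rat) \<Rightarrow> 'g list \<Rightarrow> rat" where
  "wmult f g = (\<lambda>w. \<Sum>k\<le>length w. f (take k w) * g (drop k w))"

definition wmonom :: "'g list \<Rightarrow> 'g list \<Rightarrow> rat" where
  "wmonom u = (\<lambda>w. if w = u then 1 else 0)"

definition free_alg :: "'g set \<Rightarrow> (rat, 'g list \<Rightarrow> rat) module" where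
  "free_alg X =
    \<lparr>carrier = {f. finite {w. f w \<noteq> 0} \<and> {w. f w \<noteq> 0} \<subseteq> lists X},
     monoid.mult = wmult,
     one = wmonom [],
     zero = (\<lambda>w. 0),
     add = (\<lambda>f g w. f w + g w),
     smult = (\<lambda>q f w. q * f w)\<rparr>"

lemma free_alg_simps [simp]:
  "f \<in> carrier (free_alg X) \<longleftrightarrow> finite {w. f w \<noteq> 0} \<and> {w. f w \<noteq> 0} \<subseteq> lists X"
  "monoid.mult (free_alg X) = wmult"
  "one (free_alg X) = wmonom []"
  "zero (free_alg X) = (\<lambda>w. 0)"
  "add (free_alg X) = (\<lambda>f g w. f w + g w)"
  "smult (free_alg X) = (\<lambda>q f w. q * f w)"
  by (simp_all add: free_alg_def)

lemma wmult_assoc: "wmult (wmult f g) h = wmult f (wmult g h)"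
proof
  fix w :: "'a list"
  define n where "n = length w"
  define A where "A l k = f (take l w) * g (drop l (take k w)) * h (drop k w)" for l k
  have "wmult (wmult f g) h w = (\<Sum>k\<le>n. \<Sum>l\<le>k. A l k)"
    unfolding wmult_def n_def A_def sum_distrib_right
    by (intro sum.cong refl) (auto simp: min_def)
  also have "\<dots> = (\<Sum>(k, l)\<in>Sigma {..n} (\<lambda>k. {..k}). A l k)"
    by (simp add: sum.Sigma)
  also have "\<dots> = (\<Sum>(l, k)\<in>Sigma {..n} (\<lambda>l. {..n - l}). A l (l + k))"
    by (rule sum.reindex_bij_witness[where i = "\<lambda>(l, k). (l + k, l)" and j = "\<lambda>(k, l). (l, k - l)"])
      auto
  also have "\<dots> = (\<Sum>l\<le>n. \<Sum>k\<le>n - l. A l (l + k))"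
    by (simp add: sum.Sigma)
  also have "\<dots> = wmult f (wmult g h) w"
    unfolding wmult_def n_def A_def sum_distrib_left
    by (intro sum.cong refl) (auto simp: drop_take add.commute mult.assoc)
  finally show "wmult (wmult f g) h w = wmult f (wmult g h) w" .
qed

lemma wmult_one_left: "wmult (wmonom []) f = f"
proof
  fix w :: "'a list"
  have "wmult (wmonom []) f w = (\<Sum>k\<in>{..length w} \<inter> {0}. f (drop k w))"
    unfolding wmult_def wmonom_def
    by (rule sum.mono_neutral_cong_right) auto
  then show "wmult (wmonom []) f w = f w" by simp
qed

lemma wmult_one_right: "wmult f (wmonom []) = f"
proof
  fix w :: "'a list"
  have "wmult f (wmonom []) w = (\<Sum>k\<in>{..length w} \<inter> {length w}. f (take k w))"
    unfolding wmult_def wmonom_def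
    by (rule sum.mono_neutral_cong_right) auto
  then show "wmult f (wmonom []) w = f w" by simp
qed

lemma wmult_support:
  "{w. wmult f g w \<noteq> 0} \<subseteq> (\<lambda>(u, v). u @ v) ` ({w. f w \<noteq> 0} \<times> {w. g w \<noteq> 0})"
proof
  fix w assume "w \<in> {w. wmult f g w \<noteq> 0}"
  then obtain k where "f (take k w) * g (drop k w) \<noteq> 0"
    unfolding wmult_def by (metis (mono_tags, lifting) mem_Collect_eq sum.neutral)
  then show "w \<in> (\<lambda>(u, v). u @ v) ` ({w. f w \<noteq> 0} \<times> {w. g w \<noteq> 0})"
    by (intro image_eqI[where x = "(take k w, drop k w)"]) auto
qed

lemma ring_free_alg: "ring (free_alg X)"
proof (rule ringI)
  show "abelian_group (free_alg X)"
  proof (rule abelian_groupI)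
    fix f g assume "f \<in> carrier (free_alg X)" "g \<in> carrier (free_alg X)"
    moreover have "{w. f w + g w \<noteq> 0} \<subseteq> {w. f w \<noteq> 0} \<union> {w. g w \<noteq> 0}" by auto
    ultimately show "f \<oplus>\<^bsub>free_alg X\<^esub> g \<in> carrier (free_alg X)"
      by (auto intro: finite_subset)
  next
    fix f assume "f \<in> carrier (free_alg X)"
    then show "\<exists>g\<in>carrier (free_alg X). g \<oplus>\<^bsub>free_alg X\<^esub> f = \<zero>\<^bsub>free_alg X\<^esub>"
      by (intro bexI[where x = "\<lambda>w. - f w"]) auto
  qed (auto simp: algebra_simps)
  show "Group.monoid (free_alg X)"
  proof (rule monoidI)
    fix f g assume fg: "f \<in> carrier (free_alg X)" "g \<in> carrier (free_alg X)"
    then have "finite {w. wmult f g w \<noteq> 0}"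
      by (intro finite_subset[OF wmult_support]) auto
    moreover have "{w. wmult f g w \<noteq> 0} \<subseteq> lists X"
      using fg by (intro subset_trans[OF wmult_support]) fastforce
    ultimately show "f \<otimes>\<^bsub>free_alg X\<^esub> g \<in> carrier (free_alg X)" by simp
  next
    show "\<one>\<^bsub>free_alg X\<^esub> \<in> carrier (free_alg X)" by (auto simp: wmonom_def)
  qed (simp_all add: wmult_assoc wmult_one_left wmult_one_right)
qed (simp_all add: wmult_def distrib_left distrib_right sum.distrib)

section \<open>The free supercommutative superalgebra\<close>

text \<open>Parity of a symbol: \<open>1, \<dots>, m\<close> are even, the larger ones odd.\<close>

definition par :: "nat \<Rightarrow> nat \<Rightarrow> nat" where
  "par m a = (if m < a then 1 else 0)"

text \<open>The letter \<open>(a, b)\<close> stands for the generator \<open>c\<^sub>a\<^sub>b\<close>.\<close>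

definition gens :: "nat \<Rightarrow> nat \<Rightarrow> (nat \<times> nat) set" where
  "gens m n = {1..m + n} \<times> {1..m + n}"

definition gpar :: "nat \<Rightarrow> nat \<times> nat \<Rightarrow> nat" where
  "gpar m x = par m (fst x) + par m (snd x)"

text \<open>
  The relations \<open>x y = (-1)\<^bsup>|x||y|\<^esup> y x\<close> for generators \<open>x\<close>, \<open>y\<close>; they imply supercommutativity
  for all homogeneous elements. For odd \<open>x = y\<close> the relator is \<open>2 x\<^sup>2\<close>, so odd generators square to \<open>0\<close>.
\<close>

definition supercomm_rels :: "nat \<Rightarrow> nat \<Rightarrow> ((nat \<times> nat) list \<Rightarrow> rat) set" where
  "supercomm_rels m n =
    {(\<lambda>w. wmonom [x, y] w - (- 1) ^ (gpar m x * gpar m y) * wmonom [y, x] w) | x y.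
      x \<in> gens m n \<and> y \<in> gens m n}"

definition supercomm_ideal :: "nat \<Rightarrow> nat \<Rightarrow> ((nat \<times> nat) list \<Rightarrow> rat) set" where
  "supercomm_ideal m n = Idl\<^bsub>free_alg (gens m n)\<^esub> (supercomm_rels m n)"

text \<open>\<open>A(m|n)\<close>: the library's quotient ring, equipped with the induced scalar multiplication.\<close>

definition salg :: "nat \<Rightarrow> nat \<Rightarrow> (rat, ((nat \<times> nat) list \<Rightarrow> rat) set) module" where
  "salg m n =
    ring.extend (free_alg (gens m n) Quot supercomm_ideal m n)
      (module.fields
        (\<lambda>q Y. \<Union>f\<in>Y. supercomm_ideal m n +>\<^bsub>free_alg (gens m n)\<^esub> (q \<odot>\<^bsub>free_alg (gens m n)\<^esub> f)))"

text \<open>\<open>A(m|n,r)\<close>: the classes of homogeneous noncommutative polynomials of degree \<open>r\<close>.\<close>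

definition salg_deg :: "nat \<Rightarrow> nat \<Rightarrow> nat \<Rightarrow> ((nat \<times> nat) list \<Rightarrow> rat) set set" where
  "salg_deg m n r =
    {supercomm_ideal m n +>\<^bsub>free_alg (gens m n)\<^esub> f | f.
      f \<in> carrier (free_alg (gens m n)) \<and> (\<forall>w. f w \<noteq> 0 \<longrightarrow> length w = r)}"

definition cgen :: "nat \<Rightarrow> nat \<Rightarrow> nat \<Rightarrow> nat \<Rightarrow> ((nat \<times> nat) list \<Rightarrow> rat) set" where
  "cgen m n a b = supercomm_ideal m n +>\<^bsub>free_alg (gens m n)\<^esub> wmonom [(a, b)]"

lemma supercomm_rels_carrier: "supercomm_rels m n \<subseteq> carrier (free_alg (gens m n))"
proof
  fix f assume "f \<in> supercomm_rels m n"
  then obtain x y where xy: "x \<in> gens m n" "y \<in> gens m n"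
    and f: "f = (\<lambda>w. wmonom [x, y] w - (- 1) ^ (gpar m x * gpar m y) * wmonom [y, x] w)"
    by (auto simp: supercomm_rels_def)
  have "f w = 0" if "w \<notin> {[x, y], [y, x]}" for w
    using that unfolding f wmonom_def by simp
  then have supp: "{w. f w \<noteq> 0} \<subseteq> {[x, y], [y, x]}" by blast
  then have "finite {w. f w \<noteq> 0}" by (rule finite_subset) simp
  moreover have "{[x, y], [y, x]} \<subseteq> lists (gens m n)" using xy by simp
  ultimately show "f \<in> carrier (free_alg (gens m n))"
    unfolding free_alg_simps using supp by (intro conjI) (assumption, rule subset_trans)
qed

lemma ideal_supercomm: "ideal (supercomm_ideal m n) (free_alg (gens m n))"
  unfolding supercomm_ideal_def
  by (rule ring.genideal_ideal[OF ring_free_alg supercomm_rels_carrier])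

lemma salg_eq_Quot:
  "carrier (salg m n) = carrier (free_alg (gens m n) Quot supercomm_ideal m n)"
  "monoid.mult (salg m n) = monoid.mult (free_alg (gens m n) Quot supercomm_ideal m n)"
  "one (salg m n) = one (free_alg (gens m n) Quot supercomm_ideal m n)"
  "zero (salg m n) = zero (free_alg (gens m n) Quot supercomm_ideal m n)"
  "add (salg m n) = add (free_alg (gens m n) Quot supercomm_ideal m n)"
  by (simp_all add: salg_def ring.defs module.defs)

lemma ring_salg: "ring (salg m n)"
proof -
  interpret Q: ring "free_alg (gens m n) Quot supercomm_ideal m n"
    by (rule ideal.quotient_is_ring[OF ideal_supercomm])
  show ?thesis
    by (intro ringI abelian_groupI monoidI; unfold salg_eq_Quot)
      (simp_all add: Q.m_assoc Q.a_ac Q.l_distr Q.r_distr Q.add.l_inv_ex)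
qed

lemma smult_salg_coset:
  assumes f: "f \<in> carrier (free_alg (gens m n))"
  shows "q \<odot>\<^bsub>salg m n\<^esub> (supercomm_ideal m n +>\<^bsub>free_alg (gens m n)\<^esub> f) =
    supercomm_ideal m n +>\<^bsub>free_alg (gens m n)\<^esub> (q \<odot>\<^bsub>free_alg (gens m n)\<^esub> f)"
proof -
  define F where "F = free_alg (gens m n)"
  define J where "J = supercomm_ideal m n"
  interpret J: ideal J F unfolding F_def J_def by (rule ideal_supercomm)
  have smult: "q \<odot>\<^bsub>F\<^esub> g = wmult (\<lambda>w. q * wmonom [] w) g" for g :: "(nat \<times> nat) list \<Rightarrow> rat"
  proof -
    have "wmult (\<lambda>w. q * wmonom [] w) g = (\<lambda>w. q * wmult (wmonom []) g w)"
      by (simp add: wmult_def sum_distrib_left mult.assoc)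
    then show ?thesis by (simp add: F_def wmult_one_left)
  qed
  have const: "(\<lambda>w. q * wmonom [] w) \<in> carrier F"
    by (auto simp: F_def wmonom_def)
  have J_smult: "q \<odot>\<^bsub>F\<^esub> h \<in> J" if "h \<in> J" for h
    using J.I_l_closed[OF that const] by (simp add: smult) (simp add: F_def)
  have F_smult: "q \<odot>\<^bsub>F\<^esub> h \<in> carrier F" if "h \<in> carrier F" for h
    using J.m_closed[OF const that] by (simp add: smult) (simp add: F_def)
  have f: "f \<in> carrier F" using f by (simp only: F_def)
  have eq: "J +>\<^bsub>F\<^esub> (q \<odot>\<^bsub>F\<^esub> g) = J +>\<^bsub>F\<^esub> (q \<odot>\<^bsub>F\<^esub> f)" if g: "g \<in> J +>\<^bsub>F\<^esub> f" for g
  proof -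
    from g obtain h where h: "h \<in> J" "g = h \<oplus>\<^bsub>F\<^esub> f"
      by (auto simp: a_r_coset_def r_coset_def)
    have "q \<odot>\<^bsub>F\<^esub> g = (q \<odot>\<^bsub>F\<^esub> h) \<oplus>\<^bsub>F\<^esub> (q \<odot>\<^bsub>F\<^esub> f)"
      by (simp add: h F_def algebra_simps)
    then have "q \<odot>\<^bsub>F\<^esub> g \<in> J +>\<^bsub>F\<^esub> (q \<odot>\<^bsub>F\<^esub> f)"
      using J_smult[OF h(1)] by (auto simp: a_r_coset_def r_coset_def)
    then show ?thesis using J.a_repr_independence' F_smult[OF f] by metis
  qed
  have "f \<in> J +>\<^bsub>F\<^esub> f" by (rule J.a_rcos_self[OF f])
  then have "(\<Union>g\<in>J +>\<^bsub>F\<^esub> f. J +>\<^bsub>F\<^esub> (q \<odot>\<^bsub>F\<^esub> g)) = J +>\<^bsub>F\<^esub> (q \<odot>\<^bsub>F\<^esub> f)"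
    using eq by blast
  then show ?thesis
    unfolding F_def J_def by (simp add: salg_def ring.defs module.defs)
qed

section \<open>Multiindices and the signed action\<close>

definition multiindices :: "nat \<Rightarrow> nat \<Rightarrow> nat \<Rightarrow> (nat \<Rightarrow> nat) set" where
  "multiindices m n r = {1..r} \<rightarrow>\<^sub>E {1..m + n}"

definition inv_count :: "nat \<Rightarrow> nat \<Rightarrow> (nat \<Rightarrow> nat) \<Rightarrow> (nat \<Rightarrow> nat) \<Rightarrow> nat" where
  "inv_count m r j \<pi> =
    card {(a, b). 1 \<le> a \<and> a < b \<and> b \<le> r \<and> \<pi> a > \<pi> b \<and> j (\<pi> a) > m \<and> j (\<pi> b) > m}"

text \<open>A signed multiindex is a pair of a sign and a multiindex.\<close>

definition signed_act :: "nat \<Rightarrow> nat \<Rightarrow> (nat \<Rightarrow> nat) \<Rightarrow> (nat \<Rightarrow> nat) \<Rightarrow> rat \<times> (nat \<Rightarrow> nat)" where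
  "signed_act m r j \<pi> = ((- 1) ^ inv_count m r j \<pi>, j \<circ> \<pi>)"

definition chi :: "nat \<Rightarrow> nat \<Rightarrow> nat \<Rightarrow> (nat \<Rightarrow> nat) \<Rightarrow> (nat \<Rightarrow> nat) \<Rightarrow> ((nat \<times> nat) list \<Rightarrow> rat) set" where
  "chi m n r i j =
    (- 1) ^ (\<Sum>t = 1..r. par m (i t) * (\<Sum>u = t + 1..r. par m (i u) + par m (j u)))
      \<odot>\<^bsub>salg m n\<^esub>
    foldr (monoid.mult (salg m n)) (map (\<lambda>t. cgen m n (i t) (j t)) [1..<r + 1]) \<one>\<^bsub>salg m n\<^esub>"

definition signed_chi ::
  "nat \<Rightarrow> nat \<Rightarrow> nat \<Rightarrow> rat \<times> (nat \<Rightarrow> nat) \<Rightarrow> rat \<times> (nat \<Rightarrow> nat) \<Rightarrow> ((nat \<times> nat) list \<Rightarrow> rat) set"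
where
  "signed_chi m n r i j = (fst i * fst j) \<odot>\<^bsub>salg m n\<^esub> chi m n r (snd i) (snd j)"

section \<open>Partitions and tableaux\<close>

text \<open>Partitions are weakly decreasing lists of positive integers; parts are numbered from \<open>1\<close>.\<close>

definition is_partition :: "nat list \<Rightarrow> nat \<Rightarrow> bool" where
  "is_partition lam r \<longleftrightarrow> sorted_wrt (\<ge>) lam \<and> (\<forall>x\<in>set lam. x > 0) \<and> sum_list lam = r"

definition part :: "nat list \<Rightarrow> nat \<Rightarrow> nat" where
  "part lam p = (if 1 \<le> p \<and> p \<le> length lam then lam ! (p - 1) else 0)"

definition hook_partition :: "nat \<Rightarrow> nat \<Rightarrow> nat \<Rightarrow> nat list \<Rightarrow> bool" where
  "hook_partition m n r lam \<longleftrightarrow> is_partition lam r \<and> part lam (m + 1) \<le> n"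

text \<open>Boxes are pairs (row, column).\<close>

definition diagram :: "nat list \<Rightarrow> (nat \<times> nat) set" where
  "diagram lam = {(p, q). 1 \<le> p \<and> 1 \<le> q \<and> q \<le> part lam p}"

definition basic_tableau :: "nat list \<Rightarrow> nat \<Rightarrow> (nat \<times> nat \<Rightarrow> nat) \<Rightarrow> bool" where
  "basic_tableau lam r T \<longleftrightarrow> bij_betw T (diagram lam) {1..r}"

definition row_set :: "nat list \<Rightarrow> (nat \<times> nat \<Rightarrow> nat) \<Rightarrow> nat \<Rightarrow> nat set" where
  "row_set lam T p = T ` {b \<in> diagram lam. fst b = p}"

definition col_set :: "nat list \<Rightarrow> (nat \<times> nat \<Rightarrow> nat) \<Rightarrow> nat \<Rightarrow> nat set" where
  "col_set lam T q = T ` {b \<in> diagram lam. snd b = q}"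

definition row_group :: "nat list \<Rightarrow> nat \<Rightarrow> (nat \<times> nat \<Rightarrow> nat) \<Rightarrow> (nat \<Rightarrow> nat) set" where
  "row_group lam r T = {\<pi>. \<pi> permutes {1..r} \<and> (\<forall>p. \<pi> ` row_set lam T p = row_set lam T p)}"

definition col_group :: "nat list \<Rightarrow> nat \<Rightarrow> (nat \<times> nat \<Rightarrow> nat) \<Rightarrow> (nat \<Rightarrow> nat) set" where
  "col_group lam r T = {\<pi>. \<pi> permutes {1..r} \<and> (\<forall>q. \<pi> ` col_set lam T q = col_set lam T q)}"

definition tab :: "(nat \<times> nat \<Rightarrow> nat) \<Rightarrow> (nat \<Rightarrow> nat) \<Rightarrow> nat \<times> nat \<Rightarrow> nat" where
  "tab T i b = i (T b)"

definition semistandard :: "nat \<Rightarrow> nat list \<Rightarrow> (nat \<times> nat \<Rightarrow> nat) \<Rightarrow> bool" where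
  "semistandard m lam S \<longleftrightarrow>
    (\<forall>p q q'. (p, q) \<in> diagram lam \<and> (p, q') \<in> diagram lam \<and> q < q' \<longrightarrow>
      S (p, q) \<le> S (p, q') \<and> (S (p, q) > m \<longrightarrow> S (p, q) \<noteq> S (p, q'))) \<and>
    (\<forall>p p' q. (p, q) \<in> diagram lam \<and> (p', q) \<in> diagram lam \<and> p < p' \<longrightarrow>
      S (p, q) \<le> S (p', q) \<and> (S (p, q) \<le> m \<longrightarrow> S (p, q) \<noteq> S (p', q)))"

section \<open>Symmetrizers\<close>

definition symmetrizer ::
  "nat \<Rightarrow> nat \<Rightarrow> nat \<Rightarrow> nat list \<Rightarrow> (nat \<times> nat \<Rightarrow> nat) \<Rightarrow> (nat \<Rightarrow> nat) \<Rightarrow> (nat \<Rightarrow> nat) \<Rightarrow>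
    ((nat \<times> nat) list \<Rightarrow> rat) set"
where
  "symmetrizer m n r lam T i j =
    (\<Oplus>\<^bsub>salg m n\<^esub>\<rho>\<in>row_group lam r T. \<Oplus>\<^bsub>salg m n\<^esub>\<kappa>\<in>col_group lam r T.
      rat_of_int (sign \<kappa>) \<odot>\<^bsub>salg m n\<^esub> signed_chi m n r (signed_act m r i \<rho>) (signed_act m r j \<kappa>))"

definition row_mult :: "nat list \<Rightarrow> (nat \<times> nat \<Rightarrow> nat) \<Rightarrow> nat \<Rightarrow> nat \<Rightarrow> nat" where
  "row_mult lam S a q = card {b \<in> diagram lam. fst b = q \<and> S b = a}"

definition col_mult :: "nat list \<Rightarrow> (nat \<times> nat \<Rightarrow> nat) \<Rightarrow> nat \<Rightarrow> nat \<Rightarrow> nat" where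
  "col_mult lam S a d = card {b \<in> diagram lam. snd b = d \<and> S b = a}"

definition row_factor :: "nat \<Rightarrow> nat list \<Rightarrow> (nat \<times> nat \<Rightarrow> nat) \<Rightarrow> nat" where
  "row_factor m lam S = (\<Prod>a = 1..m. \<Prod>q = 1..length lam. fact (row_mult lam S a q))"

definition col_factor :: "nat \<Rightarrow> nat \<Rightarrow> nat list \<Rightarrow> (nat \<times> nat \<Rightarrow> nat) \<Rightarrow> nat" where
  "col_factor m n lam S = (\<Prod>a = m + 1..m + n. \<Prod>d = 1..part lam 1. fact (col_mult lam S a d))"

definition modified_symmetrizer ::
  "nat \<Rightarrow> nat \<Rightarrow> nat \<Rightarrow> nat list \<Rightarrow> (nat \<times> nat \<Rightarrow> nat) \<Rightarrow> (nat \<Rightarrow> nat) \<Rightarrow> (nat \<Rightarrow> nat) \<Rightarrow>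
    ((nat \<times> nat) list \<Rightarrow> rat) set"
where
  "modified_symmetrizer m n r lam T i j =
    (1 / (rat_of_nat (row_factor m lam (tab T i)) * rat_of_nat (col_factor m n lam (tab T j))))
      \<odot>\<^bsub>salg m n\<^esub> symmetrizer m n r lam T i j"

definition semistandard_indices ::
  "nat \<Rightarrow> nat \<Rightarrow> nat \<Rightarrow> nat list \<Rightarrow> (nat \<times> nat \<Rightarrow> nat) \<Rightarrow> (nat \<Rightarrow> nat) set"
where
  "semistandard_indices m n r lam T = {u \<in> multiindices m n r. semistandard m lam (tab T u)}"

end

theory Submission imports Defs begin

text \<open>
  Since \<open>\<chi>\<close> is invariant under the diagonal action, \<open>T[i:j]\<close> is bilinear and depends on \<open>i\<close> only through
  the element \<open>e\<^sub>i\<close> obtained from \<open>i\<close> by row symmetrization followed by column antisymmetrization in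
  the rational span of all multiindices; dually for \<open>j\<close>, with rows and columns interchanged. So the two
  arguments are straightened independently. Twisting the signed action by \<open>sign\<close> exchanges even and odd
  symbols, so both cases are instances of a single statement about a filled Young diagram with a
  sign cocycle.

  Over the rationals the Garnir relations reduce every \<open>e\<^sub>i\<close> to semistandard ones. Integrality needs no
  divided power Garnir relations: the coefficient of \<open>w\<close> in \<open>e\<^sub>i\<close> is divisible by \<open>r(T\<^sub>i) c(T\<^sub>w)\<close>,
  because a group of that order acts freely on its summands, and after division by these numbers the
  matrix of coefficients between semistandard multiindices is unitriangular.
\<close>

section \<open>Permutations preserving a function\<close>

text \<open>Two integer weights replace the dominance order, one for each half of the argument.
  Spanning uses the sum of row index times entry: once the rows are sorted, each term of a Garnir
  relation has larger weight or differs from the original only by row permutations and exchanges of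
  equal even entries. Triangularity uses the sum of column index times entry, which column
  permutations keep and row permutations of a row-sorted filling cannot raise. Denominators arise
  because a Garnir relation reproduces the original word several times and is divided by that
  multiplicity. The later division is asymmetric: the left stabilizer belongs to the source word and
  is the normalizing factor in T{i:j}, while the right one belongs to the word whose coefficient is
  read off and makes the diagonal equal to 1. The defining relations of the algebra enter only
  through the invariance of \<chi>; the straightening itself happens between coefficient
  functions.\<close>

definition fiber_perms :: "'a set \<Rightarrow> ('a \<Rightarrow> 'b) \<Rightarrow> ('a \<Rightarrow> 'a) set" where
  "fiber_perms S f = {\<pi>. \<pi> permutes S \<and> (\<forall>x\<in>S. f (\<pi> x) = f x)}"

lemma fiber_permsD:
  assumes "\<pi> \<in> fiber_perms S f"
  shows "\<pi> permutes S" and "f (\<pi> x) = f x"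
  using assms by (auto simp: fiber_perms_def) (metis permutes_not_in)

lemma id_fiber_perms: "id \<in> fiber_perms S f"
  by (simp add: fiber_perms_def permutes_id)

lemma comp_fiber_perms:
  assumes "\<pi> \<in> fiber_perms S f" "\<sigma> \<in> fiber_perms S f"
  shows "\<pi> \<circ> \<sigma> \<in> fiber_perms S f"
  using permutes_compose[OF fiber_permsD(1)[OF assms(2)] fiber_permsD(1)[OF assms(1)]]
    fiber_permsD(2)[OF assms(1)] fiber_permsD(2)[OF assms(2)]
  by (simp add: fiber_perms_def)

lemma inv_fiber_perms:
  assumes "\<pi> \<in> fiber_perms S f"
  shows "inv_into UNIV \<pi> \<in> fiber_perms S f"
proof -
  have "f (inv_into UNIV \<pi> x) = f x" for x
    using fiber_permsD[OF assms] by (metis permutes_inverses(1))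
  then show ?thesis
    using fiber_permsD(1)[OF assms] by (simp add: fiber_perms_def permutes_inv)
qed

lemma transpose_fiber_perms:
  assumes "x \<in> S" "y \<in> S" "f x = f y"
  shows "transpose x y \<in> fiber_perms S f"
  using assms by (simp add: fiber_perms_def permutes_swap_id transpose_def)

lemma finite_fiber_perms: "finite S \<Longrightarrow> finite (fiber_perms S f)"
  by (rule finite_subset[of _ "{\<pi>. \<pi> permutes S}"]) (auto simp: fiber_perms_def finite_permutations)

lemma fiber_perms_mono:
  assumes "S \<subseteq> S'"
  shows "fiber_perms S f \<subseteq> fiber_perms S' f"
proof
  fix \<pi> assume "\<pi> \<in> fiber_perms S f"
  note D = fiber_permsD[OF this]
  show "\<pi> \<in> fiber_perms S' f"
    using permutes_subset[OF D(1) assms] D(2) by (simp add: fiber_perms_def)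
qed

text \<open>An injection of a finite fiber into itself is onto, so preserving \<open>f\<close>
  pointwise amounts to preserving each fiber as a set, the form in which R(T) and C(T) are
  defined.\<close>

lemma fiber_perms_altdef:
  assumes "finite S"
  shows "fiber_perms S f = {\<pi>. \<pi> permutes S \<and> (\<forall>v. \<pi> ` {x \<in> S. f x = v} = {x \<in> S. f x = v})}"
proof -
  have "(\<forall>v. \<pi> ` {x \<in> S. f x = v} = {x \<in> S. f x = v}) \<longleftrightarrow> (\<forall>x\<in>S. f (\<pi> x) = f x)"
    if \<pi>: "\<pi> permutes S" for \<pi>
  proof
    assume L: "\<forall>v. \<pi> ` {x \<in> S. f x = v} = {x \<in> S. f x = v}"
    show "\<forall>x\<in>S. f (\<pi> x) = f x"
    proof
      fix x assume "x \<in> S"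
      then have "\<pi> x \<in> \<pi> ` {y \<in> S. f y = f x}" by blast
      then show "f (\<pi> x) = f x" using L by auto
    qed
  next
    assume R: "\<forall>x\<in>S. f (\<pi> x) = f x"
    show "\<forall>v. \<pi> ` {x \<in> S. f x = v} = {x \<in> S. f x = v}"
    proof
      fix v
      have "\<pi> ` {x \<in> S. f x = v} \<subseteq> {x \<in> S. f x = v}"
        using R permutes_in_image[OF \<pi>] by auto
      then show "\<pi> ` {x \<in> S. f x = v} = {x \<in> S. f x = v}"
        using assms by (intro endo_inj_surj permutes_inj_on[OF \<pi>]) simp_all
    qed
  qed
  then show ?thesis unfolding fiber_perms_def by blast
qed

text \<open>Composing with the transposition of \<open>a\<close> and its image makes
  \<open>a\<close> fixed, so the group splits into cosets indexed by the possible images of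
  \<open>a\<close>. This yields both generation by transpositions and the group order.\<close>

lemma fiber_perms_insert:
  assumes "a \<notin> F"
  shows "fiber_perms (insert a F) f =
    (\<lambda>(b, \<pi>). transpose a b \<circ> \<pi>) ` ({b \<in> insert a F. f b = f a} \<times> fiber_perms F f)"
proof (intro equalityI subsetI)
  fix \<pi> assume \<pi>: "\<pi> \<in> fiber_perms (insert a F) f"
  note D = fiber_permsD[OF \<pi>]
  define \<sigma> where "\<sigma> = transpose a (\<pi> a) \<circ> \<pi>"
  have a: "\<pi> a \<in> insert a F" using permutes_in_image[OF D(1), of a] by simp
  have "\<sigma> permutes F" unfolding \<sigma>_def by (rule permutes_insert_lemma[OF D(1)])
  moreover have "\<sigma> \<in> fiber_perms (insert a F) f"
    unfolding \<sigma>_def using a D(2) by (intro comp_fiber_perms[OF transpose_fiber_perms \<pi>]) auto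
  ultimately have "\<sigma> \<in> fiber_perms F f" by (auto simp: fiber_perms_def)
  moreover have "\<pi> = transpose a (\<pi> a) \<circ> \<sigma>" unfolding \<sigma>_def by (simp add: fun_eq_iff)
  ultimately show "\<pi> \<in> (\<lambda>(b, \<pi>). transpose a b \<circ> \<pi>) `
      ({b \<in> insert a F. f b = f a} \<times> fiber_perms F f)"
    using a D(2) by (intro image_eqI[where x = "(\<pi> a, \<sigma>)"]) auto
next
  fix \<pi> assume "\<pi> \<in> (\<lambda>(b, \<pi>). transpose a b \<circ> \<pi>) `
      ({b \<in> insert a F. f b = f a} \<times> fiber_perms F f)"
  then obtain b \<sigma> where "b \<in> insert a F" "f b = f a" "\<sigma> \<in> fiber_perms F f"
    "\<pi> = transpose a b \<circ> \<sigma>" by auto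
  then show "\<pi> \<in> fiber_perms (insert a F) f"
    using subsetD[OF fiber_perms_mono[of F "insert a F" f]]
    by (intro ssubst[of \<pi>, where P = "\<lambda>\<pi>. \<pi> \<in> _"]) (auto intro!: comp_fiber_perms transpose_fiber_perms)
qed

text \<open>A Young subgroup is generated by transpositions inside the fibers. They are multiplied
  on the left, so that a cocycle known on transpositions fixing a word can be evaluated on a whole
  stabilizer.\<close>

lemma fiber_perms_induct [consumes 2, case_names id swap]:
  assumes "finite S" "\<pi> \<in> fiber_perms S f"
    and "P id"
    and "\<And>x y \<sigma>. x \<in> S \<Longrightarrow> y \<in> S \<Longrightarrow> x \<noteq> y \<Longrightarrow> f x = f y \<Longrightarrow> \<sigma> \<in> fiber_perms S f \<Longrightarrow> P \<sigma> \<Longrightarrow>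
      P (transpose x y \<circ> \<sigma>)"
  shows "P \<pi>"
  using assms
proof (induction S arbitrary: \<pi> rule: finite_induct)
  case empty
  then show ?case by (simp add: fiber_perms_def)
next
  case (insert a F)
  from insert.prems(1) obtain b \<sigma> where b: "b \<in> insert a F" "f b = f a"
    and \<sigma>: "\<sigma> \<in> fiber_perms F f" and \<pi>: "\<pi> = transpose a b \<circ> \<sigma>"
    unfolding fiber_perms_insert[OF insert.hyps(2)] by auto
  have mono: "fiber_perms F f \<subseteq> fiber_perms (insert a F) f"
    by (rule fiber_perms_mono) auto
  have "P \<sigma>"
    by (rule insert.IH[OF \<sigma> insert.prems(2)], rule insert.prems(3)) (use mono in auto)
  show ?case
  proof (cases "b = a")
    case True
    then show ?thesis using \<open>P \<sigma>\<close> by (simp add: \<pi>)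
  next
    case False
    then show ?thesis unfolding \<pi>
      using b \<sigma> mono \<open>P \<sigma>\<close> by (intro insert.prems(3)) auto
  qed
qed

text \<open>The order of a Young subgroup; this turns the products of factorials r(T_i) and c(T_j)
  into orders of groups.\<close>

lemma card_fiber_perms:
  assumes "finite S" "finite V" "f ` S \<subseteq> V"
  shows "card (fiber_perms S f) = (\<Prod>v\<in>V. fact (card {x \<in> S. f x = v}))"
  using assms(1,3)
proof (induction S rule: finite_induct)
  case empty
  then show ?case by (simp add: fiber_perms_def)
next
  case (insert a F)
  define N where "N = {x \<in> F. f x = f a}"
  have inj: "inj_on (\<lambda>(b, \<pi>). transpose a b \<circ> \<pi>) ({b \<in> insert a F. f b = f a} \<times> fiber_perms F f)"
  proof (rule inj_onI, clarify)
    fix b \<pi> b' \<pi>'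
    assume \<pi>: "\<pi> \<in> fiber_perms F f" "\<pi>' \<in> fiber_perms F f"
      and eq: "transpose a b \<circ> \<pi> = transpose a b' \<circ> \<pi>'"
    have "\<pi> a = a" "\<pi>' a = a"
      using fiber_permsD(1)[OF \<pi>(1)] fiber_permsD(1)[OF \<pi>(2)] insert.hyps(2)
      by (auto simp: permutes_def)
    then have "b = b'" using fun_cong[OF eq, of a] by simp
    moreover have "\<pi> = \<pi>'"
    proof
      fix x
      have "transpose a b (\<pi> x) = transpose a b (\<pi>' x)"
        using fun_cong[OF eq, of x] \<open>b = b'\<close> by simp
      then show "\<pi> x = \<pi>' x" by (rule injD[OF inj_transpose])
    qed
    ultimately show "b = b' \<and> \<pi> = \<pi>'" by simp
  qed
  have "{b \<in> insert a F. f b = f a} = insert a N" by (auto simp: N_def)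
  moreover have "finite N" "a \<notin> N" using insert.hyps by (auto simp: N_def)
  \<comment> \<open>\<open>N\<close> is the part of the fiber of \<open>a\<close> already present,
    so \<open>a\<close> has \<open>Suc (card N)\<close> possible images, exactly the factor by which
    the factorial of its fiber grows.\<close>
  ultimately have "card (fiber_perms (insert a F) f) = Suc (card N) * card (fiber_perms F f)"
    unfolding fiber_perms_insert[OF insert.hyps(2)]
    unfolding card_image[OF inj] by (simp add: card_cartesian_product)
  also have "\<dots> = Suc (card N) * (\<Prod>v\<in>V. fact (card {x \<in> F. f x = v}))"
    using insert.IH insert.prems by simp
  also have "\<dots> = Suc (card N) * (fact (card N) * (\<Prod>v\<in>V - {f a}. fact (card {x \<in> F. f x = v})))"
    using insert.prems by (subst prod.remove[OF assms(2), of "f a"]) (auto simp: N_def)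
  also have "\<dots> = fact (card (insert a N)) * (\<Prod>v\<in>V - {f a}. fact (card {x \<in> insert a F. f x = v}))"
  proof -
    have "{x \<in> insert a F. f x = v} = {x \<in> F. f x = v}" if "v \<in> V - {f a}" for v using that by auto
    then show ?thesis using \<open>finite N\<close> \<open>a \<notin> N\<close> by (simp add: algebra_simps)
  qed
  also have "insert a N = {x \<in> insert a F. f x = f a}" by (auto simp: N_def)
  also have "fact (card {x \<in> insert a F. f x = f a}) *
      (\<Prod>v\<in>V - {f a}. fact (card {x \<in> insert a F. f x = v})) =
      (\<Prod>v\<in>V. fact (card {x \<in> insert a F. f x = v}))"
    using insert.prems by (subst prod.remove[OF assms(2), of "f a"]) auto
  finally show ?case .
qed

text \<open>The sum splits into blocks of \<open>n\<close> equal summands. In the application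
  \<open>q\<close> sends an index to its orbit under a free group action.\<close>

lemma sum_fiber_dvd:
  fixes F :: "'a \<Rightarrow> int"
  assumes "finite A"
    and "\<And>a. a \<in> A \<Longrightarrow> card {b \<in> A. q b = q a} = n"
    and "\<And>a b. a \<in> A \<Longrightarrow> b \<in> A \<Longrightarrow> q a = q b \<Longrightarrow> F a = F b"
  shows "int n dvd sum F A"
proof -
  have gen: "sum F A = (\<Sum>y\<in>q ` A. sum F {x \<in> A. q x = y})"
    by (rule sum.image_gen[OF assms(1)])
  have "int n dvd sum F {x \<in> A. q x = q a}" if a: "a \<in> A" for a
  proof -
    have "F x = F a" if "x \<in> {x \<in> A. q x = q a}" for x
      by (rule assms(3)) (use that a in auto)
    then have "sum F {x \<in> A. q x = q a} = (\<Sum>x\<in>{x \<in> A. q x = q a}. F a)"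
      by (rule sum.cong[OF refl])
    then show ?thesis by (simp add: assms(2)[OF a])
  qed
  then show ?thesis unfolding gen by (intro dvd_sum[of "q ` A"]) auto
qed

lemma sum_comp_fiber_perms:
  assumes "\<rho> \<in> fiber_perms Z f"
  shows "(\<Sum>\<pi>\<in>fiber_perms Z f. g (\<rho> \<circ> \<pi>)) = (\<Sum>\<pi>\<in>fiber_perms Z f. g \<pi>)"
    and "(\<Sum>\<pi>\<in>fiber_perms Z f. g (\<pi> \<circ> \<rho>)) = (\<Sum>\<pi>\<in>fiber_perms Z f. g \<pi>)"
proof -
  note inv = permutes_inv_o[OF fiber_permsD(1)[OF assms]]
  show "(\<Sum>\<pi>\<in>fiber_perms Z f. g (\<rho> \<circ> \<pi>)) = (\<Sum>\<pi>\<in>fiber_perms Z f. g \<pi>)"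
    by (rule sum.reindex_bij_witness[where j = "\<lambda>\<pi>. \<rho> \<circ> \<pi>" and i = "\<lambda>\<pi>. inv_into UNIV \<rho> \<circ> \<pi>"])
      (auto simp: comp_assoc[symmetric] inv intro!: comp_fiber_perms inv_fiber_perms assms)
  show "(\<Sum>\<pi>\<in>fiber_perms Z f. g (\<pi> \<circ> \<rho>)) = (\<Sum>\<pi>\<in>fiber_perms Z f. g \<pi>)"
    by (rule sum.reindex_bij_witness[where j = "\<lambda>\<pi>. \<pi> \<circ> \<rho>" and i = "\<lambda>\<pi>. \<pi> \<circ> inv_into UNIV \<rho>"])
      (auto simp: comp_assoc inv intro!: comp_fiber_perms inv_fiber_perms assms)
qed

lemma sum_fiber_perms_inv:
  "(\<Sum>\<pi>\<in>fiber_perms S f. g (inv_into UNIV \<pi>)) = (\<Sum>\<pi>\<in>fiber_perms S f. g \<pi>)"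
proof -
  have "inv_into UNIV (inv_into UNIV \<pi>) = \<pi>" if "\<pi> \<in> fiber_perms S f" for \<pi>
    by (rule permutes_inv_inv[OF fiber_permsD(1)[OF that]])
  then show ?thesis
    by (intro sum.reindex_bij_witness[where i = "inv_into UNIV" and j = "inv_into UNIV"])
      (simp_all add: inv_fiber_perms)
qed

lemma PiE_comp_permutes: "w \<in> X \<rightarrow>\<^sub>E S \<Longrightarrow> \<pi> permutes X \<Longrightarrow> w \<circ> \<pi> \<in> X \<rightarrow>\<^sub>E S"
  by (auto simp: PiE_def extensional_def permutes_in_image permutes_not_in)

section \<open>Sorted fillings and weights\<close>

text \<open>A numerical substitute for the dominance order: with \<open>h\<close> the row or column
  index, it grows as large entries move to boxes of large index.\<close>

definition weight :: "'a set \<Rightarrow> ('a \<Rightarrow> nat) \<Rightarrow> ('a \<Rightarrow> nat) \<Rightarrow> int" where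
  "weight X h w = (\<Sum>x\<in>X. int (h x) * int (w x))"

definition sorted_along :: "'a set \<Rightarrow> ('a \<Rightarrow> nat) \<Rightarrow> ('a \<Rightarrow> nat) \<Rightarrow> ('a \<Rightarrow> nat) \<Rightarrow> bool" where
  "sorted_along X g h w \<longleftrightarrow> (\<forall>x\<in>X. \<forall>y\<in>X. g x = g y \<and> h x < h y \<longrightarrow> w x \<le> w y)"

text \<open>For each threshold \<open>a\<close>, the positions of one fiber of \<open>g\<close> with
  entry below \<open>a\<close> form an initial segment for both arrangements. The segments have
  equal size, hence coincide, and they determine the entries.\<close>

lemma sorted_along_unique:
  assumes "finite X" and inj: "\<And>x y. x \<in> X \<Longrightarrow> y \<in> X \<Longrightarrow> g x = g y \<Longrightarrow> h x = h y \<Longrightarrow> x = y"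
    and \<pi>: "\<pi> \<in> fiber_perms X g"
    and sorted: "sorted_along X g h w" "sorted_along X g h (w \<circ> \<pi>)"
    and "x \<in> X"
  shows "w (\<pi> x) = w x"
proof -
  note \<pi>D = fiber_permsD[OF \<pi>]
  have below: "w x < a \<longleftrightarrow> w (\<pi> x) < a" for a
  proof -
    define A where "A = {y \<in> X. g y = g x \<and> w y < a}"
    define B where "B = {y \<in> X. g y = g x \<and> w (\<pi> y) < a}"
    have "A = \<pi> ` B"
    proof (intro equalityI subsetI)
      fix y assume "y \<in> A"
      define z where "z = inv_into UNIV \<pi> y"
      have "\<pi> z = y" unfolding z_def by (rule permutes_inverses(1)[OF \<pi>D(1)])
      then have "z \<in> B"
        using \<open>y \<in> A\<close> \<pi>D(2)[of z] permutes_in_image[OF \<pi>D(1), of z] by (auto simp: A_def B_def)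
      then show "y \<in> \<pi> ` B" using \<open>\<pi> z = y\<close> by blast
    qed (auto simp: A_def B_def \<pi>D(2) permutes_in_image[OF \<pi>D(1)])
    then have card: "card A = card B"
      using permutes_inj_on[OF \<pi>D(1)] by (simp add: card_image)
    have "A \<subseteq> B \<or> B \<subseteq> A"
    proof (rule ccontr)
      assume "\<not> (A \<subseteq> B \<or> B \<subseteq> A)"
      then obtain y z where "y \<in> A" "y \<notin> B" "z \<in> B" "z \<notin> A" by auto
      then have yz: "y \<in> X" "z \<in> X" "g y = g z" "w y < a" "\<not> w z < a" "\<not> w (\<pi> y) < a" "w (\<pi> z) < a"
        by (auto simp: A_def B_def)
      then consider "h y < h z" | "h z < h y" using inj by (metis linorder_neqE_nat)
      then show False
      proof cases
        case 1
        then have "w (\<pi> y) \<le> w (\<pi> z)" using sorted(2) yz by (simp add: sorted_along_def)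
        then show ?thesis using yz by simp
      next
        case 2
        then have "w z \<le> w y" using sorted(1) yz by (simp add: sorted_along_def)
        then show ?thesis using yz by simp
      qed
    qed
    moreover have "finite A" "finite B" using assms(1) by (auto simp: A_def B_def)
    ultimately have "A = B" using card by (metis card_subset_eq)
    then have "x \<in> A \<longleftrightarrow> x \<in> B" by simp
    then show ?thesis using \<open>x \<in> X\<close> by (simp add: A_def B_def)
  qed
  show ?thesis using below[of "w x"] below[of "w (\<pi> x)"] by linarith
qed

text \<open>A pair in the wrong order could be exchanged, which changes the weight by
  \<open>(h y - h x) * (w x - w y) > 0\<close>.\<close>

lemma sorted_along_max:
  assumes "finite X" and max: "\<And>\<pi>. \<pi> \<in> fiber_perms X g \<Longrightarrow> weight X h (w \<circ> \<pi>) \<le> weight X h w"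
  shows "sorted_along X g h w"
  unfolding sorted_along_def
proof (intro ballI impI)
  fix x y assume xy: "x \<in> X" "y \<in> X" "g x = g y \<and> h x < h y"
  show "w x \<le> w y"
  proof (rule ccontr)
    assume "\<not> w x \<le> w y"
    define t where "t = transpose x y"
    have "weight X h (w \<circ> t) - weight X h w = (\<Sum>z\<in>X. int (h z) * (int (w (t z)) - int (w z)))"
      unfolding weight_def by (simp only: sum_subtractf right_diff_distrib comp_apply)
    also have "\<dots> = (\<Sum>z\<in>{x, y}. int (h z) * (int (w (t z)) - int (w z)))"
      using xy assms(1) by (intro sum.mono_neutral_right) (auto simp: t_def transpose_def)
    also have "\<dots> = (int (h y) - int (h x)) * (int (w x) - int (w y))"
    proof -
      have "x \<noteq> y" using xy by auto
      then show ?thesis by (simp add: t_def algebra_simps)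
    qed
    also have "\<dots> > 0" using xy \<open>\<not> w x \<le> w y\<close> by simp
    finally show False
      using max[of t] xy transpose_fiber_perms[of x X y g] by (simp add: t_def)
  qed
qed

lemma sorted_along_ex:
  assumes "finite X"
  obtains \<rho> where "\<rho> \<in> fiber_perms X g" "sorted_along X g h (w \<circ> \<rho>)"
    "\<And>\<pi>. \<pi> \<in> fiber_perms X g \<Longrightarrow> weight X h (w \<circ> \<pi>) \<le> weight X h (w \<circ> \<rho>)"
proof -
  let ?P = "fiber_perms X g" and ?f = "\<lambda>\<pi>. weight X h (w \<circ> \<pi>)"
  have "finite ?P" "?P \<noteq> {}" using finite_fiber_perms[OF assms] id_fiber_perms by auto
  then obtain \<rho> where \<rho>: "\<rho> \<in> ?P" "?f \<rho> = Max (?f ` ?P)"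
    using Max_in[of "?f ` ?P"] by (metis (no_types, lifting) finite_imageI image_iff image_is_empty)
  have max: "?f \<pi> \<le> ?f \<rho>" if "\<pi> \<in> ?P" for \<pi>
    unfolding \<rho>(2) using that \<open>finite ?P\<close> by (intro Max_ge) auto
  have "sorted_along X g h (w \<circ> \<rho>)"
    by (rule sorted_along_max[OF assms]) (simp add: comp_assoc max comp_fiber_perms[OF \<rho>(1)])
  then show ?thesis using that \<rho>(1) max by blast
qed

lemma weight_cong: "(\<And>x. x \<in> X \<Longrightarrow> w x = w' x) \<Longrightarrow> weight X h w = weight X h w'"
  by (simp add: weight_def)

lemma weight_comp_self: "\<pi> \<in> fiber_perms X h \<Longrightarrow> weight X h (w \<circ> \<pi>) = weight X h w"
  unfolding weight_def using sum.permute[OF fiber_permsD(1), of \<pi> X h "\<lambda>x. int (h x) * int (w x)"]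
  by (simp add: fiber_permsD(2) comp_def)

text \<open>Rearrangement inequality with its equality case. A maximal rearrangement is sorted and
  the sorted one is unique, so \<open>w\<close> is maximal; if \<open>w \<circ> \<pi>\<close> has
  the same weight, it is maximal too, hence sorted and equal to \<open>w\<close> on
  \<open>X\<close>.\<close>

lemma weight_sorted:
  assumes "finite X" and inj: "\<And>x y. x \<in> X \<Longrightarrow> y \<in> X \<Longrightarrow> g x = g y \<Longrightarrow> h x = h y \<Longrightarrow> x = y"
    and sorted: "sorted_along X g h w" and \<pi>: "\<pi> \<in> fiber_perms X g"
  shows "weight X h (w \<circ> \<pi>) \<le> weight X h w"
    and "weight X h (w \<circ> \<pi>) = weight X h w \<Longrightarrow> x \<in> X \<Longrightarrow> w (\<pi> x) = w x"
proof -
  obtain \<rho> where \<rho>: "\<rho> \<in> fiber_perms X g" "sorted_along X g h (w \<circ> \<rho>)"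
    and max: "\<And>\<pi>. \<pi> \<in> fiber_perms X g \<Longrightarrow> weight X h (w \<circ> \<pi>) \<le> weight X h (w \<circ> \<rho>)"
    using sorted_along_ex[OF assms(1), of g h w] by blast
  have eq: "weight X h (w \<circ> \<rho>) = weight X h w"
    by (rule weight_cong) (simp add: sorted_along_unique[OF assms(1) inj \<rho>(1) sorted \<rho>(2)])
  show "weight X h (w \<circ> \<pi>) \<le> weight X h w" using max[OF \<pi>] eq by simp
  assume "weight X h (w \<circ> \<pi>) = weight X h w" and x: "x \<in> X"
  then have "weight X h (w \<circ> \<pi> \<circ> \<sigma>) \<le> weight X h (w \<circ> \<pi>)" if "\<sigma> \<in> fiber_perms X g" for \<sigma>
    using max[OF comp_fiber_perms[OF \<pi> that]] eq by (simp add: comp_assoc)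
  then have sorted': "sorted_along X g h (w \<circ> \<pi>)" by (rule sorted_along_max[OF assms(1)])
  show "w (\<pi> x) = w x" by (rule sorted_along_unique[OF assms(1) inj \<pi> sorted sorted' x])
qed

section \<open>Straightening in the span of words\<close>

text \<open>The corner conditions say that the boxes form a Young diagram, and exchanging
  \<open>row\<close> and \<open>col\<close> exchanges the two. Parity is an arbitrary predicate,
  unrelated to the order of the symbols, so that the sign-twisted action fits as well. Besides the
  cocycle laws, \<open>c\<close> is prescribed only on transpositions of equal entries.\<close>

locale young_words =
  fixes X :: "'a set" and row col :: "'a \<Rightarrow> nat" and S :: "nat set"
    and odd_symb :: "nat \<Rightarrow> bool" and c :: "('a \<Rightarrow> nat) \<Rightarrow> ('a \<Rightarrow> 'a) \<Rightarrow> int"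
  assumes finite_X: "finite X" and finite_S: "finite S"
    and box_inj: "x \<in> X \<Longrightarrow> y \<in> X \<Longrightarrow> row x = row y \<Longrightarrow> col x = col y \<Longrightarrow> x = y"
    and box_corner: "x \<in> X \<Longrightarrow> y \<in> X \<Longrightarrow> row x \<le> row y \<Longrightarrow> \<exists>z\<in>X. row z = row x \<and> col z = col y"
    and box_corner': "x \<in> X \<Longrightarrow> y \<in> X \<Longrightarrow> col x \<le> col y \<Longrightarrow> \<exists>z\<in>X. row z = row y \<and> col z = col x"
    and c_id: "w \<in> X \<rightarrow>\<^sub>E S \<Longrightarrow> c w id = 1"
    and c_comp: "w \<in> X \<rightarrow>\<^sub>E S \<Longrightarrow> \<pi> permutes X \<Longrightarrow> \<sigma> permutes X \<Longrightarrow>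
      c w (\<pi> \<circ> \<sigma>) = c w \<pi> * c (w \<circ> \<pi>) \<sigma>"
    and c_swap: "w \<in> X \<rightarrow>\<^sub>E S \<Longrightarrow> x \<in> X \<Longrightarrow> y \<in> X \<Longrightarrow> x \<noteq> y \<Longrightarrow> w x = w y \<Longrightarrow>
      c w (transpose x y) = (if odd_symb (w x) then - 1 else 1)"
begin

abbreviation "words \<equiv> X \<rightarrow>\<^sub>E S"
abbreviation "row_perms \<equiv> fiber_perms X row"
abbreviation "col_perms \<equiv> fiber_perms X col"

text \<open>For the untwisted sign its order is r(T_w), and that of \<open>odd_col_stab\<close> is
  c(T_w). The restriction by parity makes \<open>c\<close>, respectively its product with
  \<open>sign\<close>, trivial on the subgroup.\<close>

definition even_row_stab :: "('a \<Rightarrow> nat) \<Rightarrow> ('a \<Rightarrow> 'a) set" where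
  "even_row_stab w = fiber_perms {x \<in> X. \<not> odd_symb (w x)} (\<lambda>x. (row x, w x))"

definition odd_col_stab :: "('a \<Rightarrow> nat) \<Rightarrow> ('a \<Rightarrow> 'a) set" where
  "odd_col_stab w = fiber_perms {x \<in> X. odd_symb (w x)} (\<lambda>x. (col x, w x))"

definition semistd :: "('a \<Rightarrow> nat) \<Rightarrow> bool" where
  "semistd w \<longleftrightarrow>
    (\<forall>x\<in>X. \<forall>y\<in>X. row x = row y \<and> col x < col y \<longrightarrow> w x \<le> w y \<and> (odd_symb (w x) \<longrightarrow> w x \<noteq> w y)) \<and>
    (\<forall>x\<in>X. \<forall>y\<in>X. col x = col y \<and> row x < row y \<longrightarrow> w x \<le> w y \<and> (\<not> odd_symb (w x) \<longrightarrow> w x \<noteq> w y))"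

abbreviation "semistd_words \<equiv> {w \<in> words. semistd w}"

text \<open>The argument is a function on permutations instead of words, so that relations in the
  group algebra can be proved without the cocycle and then applied to
  \<open>term_coeff u w\<close>.\<close>

definition young_sum :: "(('a \<Rightarrow> 'a) \<Rightarrow> int) \<Rightarrow> int" where
  "young_sum G = (\<Sum>\<rho>\<in>row_perms. \<Sum>\<kappa>\<in>col_perms. sign \<kappa> * G (\<rho> \<circ> \<kappa>))"

definition term_coeff :: "('a \<Rightarrow> nat) \<Rightarrow> ('a \<Rightarrow> nat) \<Rightarrow> ('a \<Rightarrow> 'a) \<Rightarrow> int" where
  "term_coeff u w \<pi> = c u \<pi> * of_bool (u \<circ> \<pi> = w)"

text \<open>The coefficient of \<open>w\<close> in \<open>u\<close> acted upon by the row symmetrizer and then by the column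
  antisymmetrizer.\<close>

definition young_coeff :: "('a \<Rightarrow> nat) \<Rightarrow> ('a \<Rightarrow> nat) \<Rightarrow> int" where
  "young_coeff u w = young_sum (term_coeff u w)"

section \<open>Row symmetry of the coefficients and Garnir relations\<close>

lemma comp_words: "w \<in> words \<Longrightarrow> \<pi> permutes X \<Longrightarrow> w \<circ> \<pi> \<in> words"
  by (rule PiE_comp_permutes)

lemma finite_words: "finite words"
  by (rule finite_PiE[OF finite_X]) (rule finite_S)

text \<open>On permutations fixing \<open>w\<close> the cocycle is multiplicative, so its value 1 on
  transpositions of equal even entries decides.\<close>

lemma c_stab_even:
  assumes w: "w \<in> words" and \<pi>: "\<pi> \<in> fiber_perms Z w" and Z: "Z \<subseteq> {x \<in> X. \<not> odd_symb (w x)}"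
  shows "c w \<pi> = 1"
proof -
  have "finite Z" using Z finite_X by (auto intro: finite_subset)
  then show ?thesis using \<pi>
  proof (induction rule: fiber_perms_induct)
    case id
    then show ?case using w by (rule c_id)
  next
    case (swap x y \<sigma>)
    have xy: "x \<in> X" "y \<in> X" "\<not> odd_symb (w x)" using swap Z by auto
    have "\<sigma> permutes X"
      using fiber_permsD(1)[OF swap(5)] Z by (auto intro: permutes_subset)
    moreover have "w \<circ> transpose x y = w" using swap(4) by (auto simp: transpose_def)
    ultimately have "c w (transpose x y \<circ> \<sigma>) = c w (transpose x y) * c w \<sigma>"
      using c_comp[OF w permutes_swap_id[OF xy(1,2)]] by simp
    also have "\<dots> = 1"
      using c_swap[OF w xy(1,2) swap(3,4)] xy(3) swap(6) by simp
    finally show ?case .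
  qed
qed

lemma young_sum_cong:
  assumes "\<And>\<pi>. \<pi> permutes X \<Longrightarrow> G \<pi> = G' \<pi>"
  shows "young_sum G = young_sum G'"
  unfolding young_sum_def
  by (intro sum.cong refl) (use assms in \<open>simp add: permutes_compose fiber_permsD(1)\<close>)

lemma young_sum_cmult: "young_sum (\<lambda>\<pi>. a * G \<pi>) = a * young_sum G"
  by (simp add: young_sum_def sum_distrib_left algebra_simps)

lemma young_sum_row: "\<rho> \<in> row_perms \<Longrightarrow> young_sum (\<lambda>\<pi>. G (\<rho> \<circ> \<pi>)) = young_sum G"
  unfolding young_sum_def comp_assoc[symmetric] by (rule sum_comp_fiber_perms(1))

text \<open>By the cocycle law, acting on \<open>u\<close> by \<open>\<pi>\<close> is left
  multiplication by \<open>\<pi>\<close> in the group algebra. This translates relations among group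
  elements into relations between the coefficients of different words.\<close>

lemma young_coeff_shift:
  assumes "u \<in> words" "\<pi> permutes X"
  shows "c u \<pi> * young_coeff (u \<circ> \<pi>) w = young_sum (\<lambda>\<sigma>. term_coeff u w (\<pi> \<circ> \<sigma>))"
  unfolding young_coeff_def young_sum_cmult[symmetric]
  by (rule young_sum_cong) (simp add: term_coeff_def c_comp[OF assms] comp_assoc)

text \<open>The row symmetrizer is applied first, so it absorbs row permutations of
  \<open>u\<close>.\<close>

lemma young_coeff_row:
  assumes "u \<in> words" "\<rho> \<in> row_perms"
  shows "c u \<rho> * young_coeff (u \<circ> \<rho>) w = young_coeff u w"
  using young_coeff_shift[OF assms(1) fiber_permsD(1)[OF assms(2)]] young_sum_row[OF assms(2)]
  by (simp add: young_coeff_def)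

text \<open>The exchange of \<open>x\<close> and \<open>y\<close> is a row permutation fixing
  \<open>u\<close> with cocycle value -1, so the coefficient equals its own negative.\<close>

lemma young_coeff_zero:
  assumes "u \<in> words" "x \<in> X" "y \<in> X" "row x = row y" "x \<noteq> y" "u x = u y" "odd_symb (u x)"
  shows "young_coeff u w = 0"
proof -
  have "transpose x y \<in> row_perms" using assms by (intro transpose_fiber_perms) auto
  moreover have "u \<circ> transpose x y = u" using assms by (auto simp: transpose_def)
  moreover have "c u (transpose x y) = - 1" using assms c_swap by simp
  ultimately show ?thesis using young_coeff_row[OF assms(1)] by force
qed

text \<open>The summand of each \<open>\<rho>\<close> vanishes by itself. Two boxes of one column
  that \<open>\<rho>\<close> carries into \<open>Z\<close> give a transposition \<open>t'\<close> of
  \<open>Z\<close> and a column transposition \<open>t\<close> with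
  \<open>t' \<circ> \<rho> = \<rho> \<circ> t\<close>; the sum over permutations of \<open>Z\<close>
  absorbs \<open>t'\<close>, while the antisymmetrizer turns \<open>t\<close> into -1.\<close>

lemma garnir_relation:
  assumes "Z \<subseteq> X"
    and collide: "\<And>\<rho>. \<rho> \<in> row_perms \<Longrightarrow> \<exists>x\<in>X. \<exists>y\<in>X. \<rho> x \<in> Z \<and> \<rho> y \<in> Z \<and> x \<noteq> y \<and> col x = col y"
  shows "(\<Sum>\<sigma> | \<sigma> permutes Z. young_sum (\<lambda>\<pi>. G (\<sigma> \<circ> \<pi>))) = 0"
proof -
  let ?P = "fiber_perms Z (\<lambda>_. ())"
  have P: "{\<sigma>. \<sigma> permutes Z} = ?P" by (auto simp: fiber_perms_def)
  have "(\<Sum>\<sigma>\<in>?P. \<Sum>\<kappa>\<in>col_perms. sign \<kappa> * G (\<sigma> \<circ> (\<rho> \<circ> \<kappa>))) = 0" (is "?L = 0")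
    if \<rho>: "\<rho> \<in> row_perms" for \<rho>
  proof -
    obtain x y where xy: "x \<in> X" "y \<in> X" "\<rho> x \<in> Z" "\<rho> y \<in> Z" "x \<noteq> y" "col x = col y"
      using collide[OF \<rho>] by blast
    define t where "t = transpose x y"
    define t' where "t' = transpose (\<rho> x) (\<rho> y)"
    have t: "t \<in> col_perms" and t': "t' \<in> ?P"
      unfolding t_def t'_def using xy by (auto intro: transpose_fiber_perms)
    have inj: "inj \<rho>" using permutes_inj[OF fiber_permsD(1)[OF \<rho>]] .
    have eq: "t' \<circ> (\<rho> \<circ> (t \<circ> \<kappa>)) = \<rho> \<circ> \<kappa>" for \<kappa>
      using xy(5) inj by (auto simp: t_def t'_def transpose_def fun_eq_iff inj_eq)
    have sgn: "sign (t \<circ> \<kappa>) = - sign \<kappa>" if "\<kappa> \<in> col_perms" for \<kappa>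
      using sign_compose[of t \<kappa>] permutes_imp_permutation[OF finite_X fiber_permsD(1)[OF that]] xy(5)
      by (simp add: t_def permutation_swap_id sign_swap_id)
    have "?L = (\<Sum>\<sigma>\<in>?P. \<Sum>\<kappa>\<in>col_perms. sign \<kappa> * G ((\<sigma> \<circ> t') \<circ> (\<rho> \<circ> \<kappa>)))"
      by (rule sum_comp_fiber_perms(2)[OF t', symmetric])
    also have "\<dots> = (\<Sum>\<sigma>\<in>?P. \<Sum>\<kappa>\<in>col_perms. sign (t \<circ> \<kappa>) * G ((\<sigma> \<circ> t') \<circ> (\<rho> \<circ> (t \<circ> \<kappa>))))"
      by (intro sum.cong refl sum_comp_fiber_perms(1)[OF t, symmetric])
    also have "\<dots> = (\<Sum>\<sigma>\<in>?P. \<Sum>\<kappa>\<in>col_perms. - (sign \<kappa> * G (\<sigma> \<circ> (\<rho> \<circ> \<kappa>))))"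
      by (intro sum.cong refl) (simp add: sgn comp_assoc eq)
    also have "\<dots> = - ?L" by (simp add: sum_negf)
    finally show ?thesis by simp
  qed
  then have "(\<Sum>\<rho>\<in>row_perms. \<Sum>\<sigma>\<in>?P. \<Sum>\<kappa>\<in>col_perms. sign \<kappa> * G (\<sigma> \<circ> (\<rho> \<circ> \<kappa>))) = 0"
    by (intro sum.neutral) blast
  then show ?thesis unfolding P young_sum_def by (subst sum.swap)
qed

text \<open>Pigeonhole: the upper row from \<open>x\<close> on and the lower row up to
  \<open>y\<close> together have more boxes than the upper row. All boxes that \<open>\<rho>\<close>
  carries into \<open>A \<union> B\<close> lie in columns met by the upper row, so two of them share
  a column.\<close>

lemma garnir_collision:
  assumes xy: "x \<in> X" "y \<in> X" "col x = col y" "row x < row y"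
    and A: "A = {z \<in> X. row z = row x \<and> col x \<le> col z}"
    and B: "B = {z \<in> X. row z = row y \<and> col z \<le> col y}"
    and \<rho>: "\<rho> \<in> row_perms"
  shows "\<exists>a\<in>X. \<exists>b\<in>X. \<rho> a \<in> A \<union> B \<and> \<rho> b \<in> A \<union> B \<and> a \<noteq> b \<and> col a = col b"
proof (rule ccontr)
  assume no: "\<not> ?thesis"
  note \<rho>D = fiber_permsD[OF \<rho>]
  define Z where "Z = {z \<in> X. \<rho> z \<in> A \<union> B}"
  define R where "R = {z \<in> X. row z = row x}"
  define L where "L = {z \<in> X. row z = row x \<and> col z < col x}"
  have fin: "finite A" "finite B" "finite Z" "finite R" "finite L"
    using finite_X by (auto simp: A B Z_def R_def L_def)
  have "A \<union> B = \<rho> ` Z"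
  proof (intro equalityI subsetI)
    fix a assume "a \<in> A \<union> B"
    define z where "z = inv_into UNIV \<rho> a"
    have "\<rho> z = a" unfolding z_def by (rule permutes_inverses(1)[OF \<rho>D(1)])
    moreover have "a \<in> X" using \<open>a \<in> A \<union> B\<close> by (auto simp: A B)
    ultimately have "z \<in> Z"
      using \<open>a \<in> A \<union> B\<close> permutes_in_image[OF \<rho>D(1), of z] by (simp add: Z_def)
    then show "a \<in> \<rho> ` Z" using \<open>\<rho> z = a\<close> by blast
  qed (auto simp: Z_def)
  then have "card (A \<union> B) = card Z"
    using permutes_inj_on[OF \<rho>D(1)] by (simp add: card_image)
  also have "inj_on col Z" using no by (auto simp: Z_def inj_on_def)
  then have "card Z = card (col ` Z)" by (simp add: card_image)
  also have "col ` Z \<subseteq> col ` R"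
  proof
    fix k assume "k \<in> col ` Z"
    then obtain z where z: "z \<in> X" "\<rho> z \<in> A \<union> B" "k = col z" by (auto simp: Z_def)
    then have "row x \<le> row z" using \<rho>D(2)[of z] xy(4) by (auto simp: A B)
    then obtain z' where "z' \<in> X" "row z' = row x" "col z' = col z"
      using box_corner[OF xy(1) z(1)] by blast
    then show "k \<in> col ` R" using z(3) by (intro image_eqI[of _ _ z']) (auto simp: R_def)
  qed
  then have "card (col ` Z) \<le> card R"
    using card_mono[of "col ` R" "col ` Z"] card_image_le[of R col] fin by simp
  also have "R = A \<union> L" by (auto simp: R_def A L_def)
  then have "card R = card A + card L"
    using fin by (simp only:) (rule card_Un_disjoint, auto simp: A L_def)
  \<comment> \<open>The surplus for the pigeonhole: the lower row has a box in each column met by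
    \<open>L\<close>, and \<open>B\<close> contains \<open>y\<close> in addition.\<close>
  also have "card L < card B"
  proof -
    have "inj_on col L" by (auto simp: inj_on_def L_def intro: box_inj)
    then have "card L = card (col ` L)" by (simp add: card_image)
    also have "col ` L \<subseteq> col ` (B - {y})"
    proof
      fix k assume "k \<in> col ` L"
      then obtain z where z: "z \<in> X" "col z < col x" "k = col z" by (auto simp: L_def)
      then obtain z' where "z' \<in> X" "row z' = row y" "col z' = col z"
        using box_corner'[OF z(1) xy(2)] xy(3) by auto
      then show "k \<in> col ` (B - {y})"
        using z xy(3) by (intro image_eqI[of _ _ z']) (auto simp: B)
    qed
    then have "card (col ` L) \<le> card (B - {y})"
      using card_mono[of "col ` (B - {y})" "col ` L"] card_image_le[of "B - {y}" col] fin by simp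
    also have "\<dots> < card B" using fin xy by (intro card_Diff1_less) (auto simp: B)
    finally show ?thesis .
  qed
  also have "card A + card B = card (A \<union> B)"
    using fin xy by (intro card_Un_disjoint[symmetric]) (auto simp: A B)
  finally show False by simp
qed

text \<open>A permutation that keeps the weight only exchanges equal even symbols between the two rows,
    hence it
  contributes the original term with coefficient \<open>1\<close>, and such contributions cannot cancel.\<close>

lemma garnir_weight:
  assumes u: "u \<in> words" "sorted_along X row col u"
    and xy: "x \<in> X" "y \<in> X" "row x < row y"
    and violation: "u y < u x \<or> u x = u y \<and> \<not> odd_symb (u x)"
    and A: "A = {z \<in> X. row z = row x \<and> col x \<le> col z}"
    and B: "B = {z \<in> X. row z = row y \<and> col z \<le> col y}"
    and \<sigma>: "\<sigma> permutes A \<union> B"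
  shows "weight X row u \<le> weight X row (u \<circ> \<sigma>)"
    and "weight X row u = weight X row (u \<circ> \<sigma>) \<Longrightarrow> c u \<sigma> * young_coeff (u \<circ> \<sigma>) w = young_coeff u w"
proof -
  have sub: "A \<union> B \<subseteq> X" "A \<inter> B = {}" using xy by (auto simp: A B)
  have fin: "finite A" "finite B" using finite_X by (auto simp: A B)
  have sorted: "u a \<le> u b" if "a \<in> X" "b \<in> X" "row a = row b" "col a \<le> col b" for a b
  proof (cases "col a = col b")
    case True
    then show ?thesis using box_inj[OF that(1-3)] by simp
  next
    case False
    then show ?thesis using u(2) that unfolding sorted_along_def by (metis order_le_less)
  qed
  have uA: "u x \<le> u z" if "z \<in> A" for z using that sorted[of x z] xy(1) by (simp add: A)
  have uB: "u z \<le> u y" if "z \<in> B" for z using that sorted[of z y] xy(2) by (simp add: B)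
  have le: "u y \<le> u x" using violation by auto
  \<comment> \<open>In \<open>u \<circ> \<sigma>\<close> the boxes of \<open>B\<close> carry the
    entries of \<open>u\<close> on the image of \<open>B\<close>: those on \<open>E\<close> enter
    the lower row and those on \<open>D\<close> leave it.\<close>
  define D where "D = B - \<sigma> ` B"
  define E where "E = \<sigma> ` B - B"
  have "\<sigma> ` B \<subseteq> A \<union> B" using permutes_image[OF \<sigma>] by auto
  then have DE: "D \<subseteq> B" "E \<subseteq> A" by (auto simp: D_def E_def)
  have finDE: "finite D" "finite E" using fin DE finite_subset by blast+
  have "card (\<sigma> ` B) = card B" using permutes_inj_on[OF \<sigma>] by (simp add: card_image)
  then have cardDE: "card E = card D"
    unfolding D_def E_def using fin
    by (simp add: card_Diff_subset_Int Int_commute)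
  define P where "P z = int (u (\<sigma> z)) - int (u z)" for z
  have "weight X row (u \<circ> \<sigma>) - weight X row u = (\<Sum>z\<in>X. int (row z) * P z)"
    unfolding weight_def P_def by (simp only: sum_subtractf right_diff_distrib comp_apply)
  also have "\<dots> = (\<Sum>z\<in>A \<union> B. int (row z) * P z)"
    using finite_X sub(1) permutes_not_in[OF \<sigma>] by (intro sum.mono_neutral_right) (auto simp: P_def)
  also have "\<dots> = (\<Sum>z\<in>A. int (row x) * P z) + (\<Sum>z\<in>B. int (row y) * P z)"
    using fin sub(2) by (subst sum.union_disjoint) (auto simp: A B)
  also have "\<dots> = (int (row y) - int (row x)) * sum P B + int (row x) * sum P (A \<union> B)"
    unfolding sum.union_disjoint[OF fin sub(2)] sum_distrib_left[symmetric] by (simp add: algebra_simps)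
  \<comment> \<open>The total of all entries is unchanged, so the weight changes only by the net
    gain of the lower row.\<close>
  also have "sum P (A \<union> B) = 0"
    using sum.permute[OF \<sigma>, of "\<lambda>z. int (u z)"] by (simp add: P_def sum_subtractf comp_def)
  finally have diff: "weight X row (u \<circ> \<sigma>) - weight X row u = (int (row y) - int (row x)) * sum P B"
    by (simp only: mult_zero_right add_0_right)
  have "(\<Sum>z\<in>B. int (u (\<sigma> z))) = (\<Sum>z\<in>\<sigma> ` B. int (u z))"
    using permutes_inj_on[OF \<sigma>] by (simp add: sum.reindex)
  also have "\<dots> = (\<Sum>z\<in>\<sigma> ` B \<inter> B. int (u z)) + (\<Sum>z\<in>E. int (u z))"
    unfolding E_def using fin by (intro sum.Int_Diff) simp
  finally have "sum P B = (\<Sum>z\<in>\<sigma> ` B \<inter> B. int (u z)) + (\<Sum>z\<in>E. int (u z)) - (\<Sum>z\<in>B. int (u z))"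
    by (simp add: P_def sum_subtractf)
  also have "(\<Sum>z\<in>B. int (u z)) = (\<Sum>z\<in>B \<inter> \<sigma> ` B. int (u z)) + (\<Sum>z\<in>D. int (u z))"
    unfolding D_def using fin by (intro sum.Int_Diff)
  finally have "sum P B = (\<Sum>z\<in>E. int (u z)) - (\<Sum>z\<in>D. int (u z))"
    by (simp add: Int_commute)
  \<comment> \<open>Three nonnegative terms: an entering entry is at least \<open>u x\<close>, a
    leaving one at most \<open>u y\<close>, and the violation gives \<open>u y \<le> u x\<close>.
    Equal weights force all three to vanish.\<close>
  also have "\<dots> = (\<Sum>z\<in>E. int (u z) - int (u x)) + (\<Sum>z\<in>D. int (u y) - int (u z))
      + int (card D) * (int (u x) - int (u y))"
    by (simp add: sum_subtractf cardDE algebra_simps)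
  finally have PB: "sum P B = \<dots>" .
  have E0: "(\<Sum>z\<in>E. int (u z) - int (u x)) \<ge> 0" using uA DE by (intro sum_nonneg) auto
  have D0: "(\<Sum>z\<in>D. int (u y) - int (u z)) \<ge> 0" using uB DE by (intro sum_nonneg) auto
  have C0: "int (card D) * (int (u x) - int (u y)) \<ge> 0" using le by simp
  show "weight X row u \<le> weight X row (u \<circ> \<sigma>)"
  proof -
    have "(int (row y) - int (row x)) * sum P B \<ge> 0" using PB E0 D0 C0 xy by simp
    then show ?thesis using diff by simp
  qed
  assume "weight X row u = weight X row (u \<circ> \<sigma>)"
  then have "sum P B = 0" using diff xy by simp
  then have "(\<Sum>z\<in>E. int (u z) - int (u x)) = 0" "(\<Sum>z\<in>D. int (u y) - int (u z)) = 0"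
    and card0: "int (card D) * (int (u x) - int (u y)) = 0" using PB E0 D0 C0 by linarith+
  then have uE: "u z = u x" if "z \<in> E" for z
    using that sum_nonneg_eq_0_iff[of E "\<lambda>z. int (u z) - int (u x)"] uA DE finDE by fastforce
  have uD: "u z = u y" if "z \<in> D" for z
    using that sum_nonneg_eq_0_iff[of D "\<lambda>z. int (u y) - int (u z)"] uB DE finDE
      \<open>(\<Sum>z\<in>D. int (u y) - int (u z)) = 0\<close> by fastforce
  \<comment> \<open>If anything is exchanged at all, then \<open>u x = u y\<close>, and a violation
    with equal entries is one of even entries. For empty \<open>D\<close> and \<open>E\<close> the
    claim is vacuous.\<close>
  have uxy: "u x = u y" "\<not> odd_symb (u x)" if "z \<in> D \<union> E" for z
  proof -
    have "card D > 0" using that cardDE finDE by (auto simp: card_gt_0_iff)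
    then show "u x = u y" using card0 by simp
    then show "\<not> odd_symb (u x)" using violation by auto
  qed
  obtain f where f: "bij_betw f E D" using finite_same_card_bij[OF finDE(2,1) cardDE] by blast
  \<comment> \<open>An involution exchanging \<open>D\<close> and \<open>E\<close>: it undoes the
    traffic between the two rows, so \<open>\<tau> \<circ> \<sigma>\<close> keeps both, and it fixes
    \<open>u\<close> because all entries on \<open>D \<union> E\<close> agree.\<close>
  define \<tau> where "\<tau> z = (if z \<in> E then f z else if z \<in> D then inv_into E f z else z)" for z
  have disj: "D \<inter> E = {}" using DE sub(2) by auto
  have fE: "f z \<in> D" "inv_into E f (f z) = z" if "z \<in> E" for z
    using f that by (auto simp: bij_betw_def)
  have fD: "inv_into E f z \<in> E" "f (inv_into E f z) = z" if "z \<in> D" for z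
    using f that by (auto simp: bij_betw_def inv_into_into f_inv_into_f)
  have \<tau>\<tau>: "\<tau> (\<tau> z) = z" for z
    using disj fE fD by (auto simp: \<tau>_def)
  have "\<tau> permutes D \<union> E"
    unfolding permutes_def using \<tau>\<tau> by (metis UnCI \<tau>_def)
  moreover have "u (\<tau> z) = u z" for z
  proof (cases "z \<in> D \<union> E")
    case True
    then have eq: "u x = u y" by (rule uxy)
    have "u v = u y" if "v \<in> D \<union> E" for v using that uE uD eq by auto
    moreover have "\<tau> z \<in> D \<union> E" using True fE fD by (auto simp: \<tau>_def)
    ultimately show ?thesis using True by simp
  qed (simp add: \<tau>_def)
  ultimately have \<tau>: "\<tau> \<in> fiber_perms (D \<union> E) u" and u\<tau>: "u \<circ> \<tau> = u"
    by (auto simp: fiber_perms_def)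
  have cu\<tau>: "c u \<tau> = 1"
  proof (rule c_stab_even[OF u(1) \<tau>])
    have "\<not> odd_symb (u z)" if "z \<in> D \<union> E" for z
      using uxy[OF that] uE[of z] uD[of z] that by auto
    then show "D \<union> E \<subseteq> {z \<in> X. \<not> odd_symb (u z)}" using DE sub by auto
  qed
  have \<tau>X: "\<tau> permutes X" and \<tau>AB: "\<tau> permutes A \<union> B"
    using fiber_permsD(1)[OF \<tau>] permutes_subset DE sub by blast+
  define \<rho> where "\<rho> = \<tau> \<circ> \<sigma>"
  have \<rho>AB: "\<rho> permutes A \<union> B" unfolding \<rho>_def by (rule permutes_compose[OF \<sigma> \<tau>AB])
  have \<rho>B: "\<rho> z \<in> B" if "z \<in> B" for z
    using that DE fE by (auto simp: \<rho>_def \<tau>_def D_def E_def)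
  then have "\<rho> ` B = B"
    using fin permutes_inj_on[OF \<rho>AB] by (intro endo_inj_surj) auto
  then have \<rho>A: "\<rho> z \<in> A" if "z \<in> A" for z
    using that permutes_inj[OF \<rho>AB] permutes_in_image[OF \<rho>AB, of z] sub(2)
    by (metis (no_types, opaque_lifting) UnCI UnE disjoint_iff image_iff injD)
  have "row (\<rho> z) = row z" for z
  proof (cases "z \<in> A \<union> B")
    case True
    then show ?thesis using \<rho>A[of z] \<rho>B[of z] by (auto simp: A B)
  qed (simp add: permutes_not_in[OF \<rho>AB])
  then have \<rho>: "\<rho> \<in> row_perms"
    using permutes_subset[OF \<rho>AB sub(1)] by (simp add: fiber_perms_def)
  have "\<sigma> = \<tau> \<circ> \<rho>" by (simp add: fun_eq_iff \<rho>_def \<tau>\<tau>)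
  then have "u \<circ> \<sigma> = u \<circ> \<rho>" "c u \<sigma> = c u \<rho>"
    using c_comp[OF u(1) \<tau>X fiber_permsD(1)[OF \<rho>]] cu\<tau> u\<tau> by (simp_all add: comp_assoc[symmetric])
  then show "c u \<sigma> * young_coeff (u \<circ> \<sigma>) w = young_coeff u w"
    using young_coeff_row[OF u(1) \<rho>] by simp
qed

section \<open>Spanning by semistandard words over the rationals\<close>

definition spanned :: "(('a \<Rightarrow> nat) \<Rightarrow> rat) \<Rightarrow> bool" where
  "spanned f \<longleftrightarrow> (\<exists>k. \<forall>w. f w = (\<Sum>u\<in>semistd_words. k u * of_int (young_coeff u w)))"

lemma spanned_cmult: "spanned f \<Longrightarrow> spanned (\<lambda>w. a * f w)"
  unfolding spanned_def
proof (elim exE)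
  fix k assume "\<forall>w. f w = (\<Sum>u\<in>semistd_words. k u * of_int (young_coeff u w))"
  then show "\<exists>k. \<forall>w. a * f w = (\<Sum>u\<in>semistd_words. k u * of_int (young_coeff u w))"
    by (intro exI[of _ "\<lambda>u. a * k u"]) (simp add: sum_distrib_left mult.assoc)
qed

lemma spanned_add: "spanned f \<Longrightarrow> spanned g \<Longrightarrow> spanned (\<lambda>w. f w + g w)"
  unfolding spanned_def
proof (elim exE)
  fix k l assume "\<forall>w. f w = (\<Sum>u\<in>semistd_words. k u * of_int (young_coeff u w))"
    "\<forall>w. g w = (\<Sum>u\<in>semistd_words. l u * of_int (young_coeff u w))"
  then show "\<exists>k. \<forall>w. f w + g w = (\<Sum>u\<in>semistd_words. k u * of_int (young_coeff u w))"
    by (intro exI[of _ "\<lambda>u. k u + l u"]) (simp add: sum.distrib distrib_right)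
qed

lemma spanned_zero: "spanned (\<lambda>w. 0)"
  unfolding spanned_def by (rule exI[of _ "\<lambda>_. 0"]) simp

lemma spanned_sum: "(\<And>a. a \<in> A \<Longrightarrow> spanned (f a)) \<Longrightarrow> spanned (\<lambda>w. \<Sum>a\<in>A. f a w)"
  by (induction A rule: infinite_finite_induct) (simp_all add: spanned_zero spanned_add)

lemma spanned_young_coeff_semistd:
  assumes "u \<in> semistd_words"
  shows "spanned (\<lambda>w. of_int (young_coeff u w))"
proof -
  have fin: "finite semistd_words" using finite_words by simp
  have "of_int (young_coeff u w) =
      (\<Sum>v\<in>semistd_words. (if v = u then 1 else 0) * (of_int (young_coeff v w) :: rat))" for w
    using assms by (subst sum.remove[OF fin assms]) simp
  then show ?thesis unfolding spanned_def by (intro exI[of _ "\<lambda>v. if v = u then 1 else 0"] allI)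
qed

text \<open>A row-sorted word that is not semistandard either repeats an odd symbol in a row, and
  then its coefficients vanish, or has a column violation, and then a Garnir relation applies. The
  terms of equal weight all reproduce \<open>u\<close> without a sign, so the relation can be solved
  for \<open>u\<close> in terms of words of larger weight.\<close>

lemma spanned_young_coeff_sorted:
  assumes u: "u \<in> words" "sorted_along X row col u"
    and IH: "\<And>v. v \<in> words \<Longrightarrow> weight X row u < weight X row v \<Longrightarrow> spanned (\<lambda>w. of_int (young_coeff v w))"
  shows "spanned (\<lambda>w. of_int (young_coeff u w))"
proof (cases "semistd u")
  case True
  then show ?thesis using u by (intro spanned_young_coeff_semistd) simp
next
  case nonstd: False
  show ?thesis
  proof (cases "\<exists>x\<in>X. \<exists>y\<in>X. row x = row y \<and> x \<noteq> y \<and> u x = u y \<and> odd_symb (u x)")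
    case True
    then show ?thesis using young_coeff_zero[OF u(1)] spanned_zero by auto
  next
    case False
    have "\<exists>x\<in>X. \<exists>y\<in>X. col x = col y \<and> row x < row y \<and> (u y < u x \<or> u x = u y \<and> \<not> odd_symb (u x))"
    proof (rule ccontr)
      assume "\<not> ?thesis"
      then have "semistd u"
        using False u(2) unfolding semistd_def sorted_along_def
        by (metis linorder_not_less less_irrefl)
      then show False using nonstd by simp
    qed
    then obtain x y where xy: "x \<in> X" "y \<in> X" "col x = col y" "row x < row y"
      and violation: "u y < u x \<or> u x = u y \<and> \<not> odd_symb (u x)" by blast
    define A where "A = {z \<in> X. row z = row x \<and> col x \<le> col z}"
    define B where "B = {z \<in> X. row z = row y \<and> col z \<le> col y}"
    have sub: "A \<union> B \<subseteq> X" by (auto simp: A_def B_def)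
    then have PX: "\<sigma> permutes X" if "\<sigma> permutes A \<union> B" for \<sigma> using permutes_subset that by blast
    have finP: "finite {\<sigma>. \<sigma> permutes A \<union> B}"
      using finite_subset[OF sub finite_X] by (rule finite_permutations)
    note W = garnir_weight[OF u xy(1,2,4) violation A_def B_def]
    define M where "M = {\<sigma>. \<sigma> permutes A \<union> B \<and> weight X row u = weight X row (u \<circ> \<sigma>)}"
    define N where "N = {\<sigma>. \<sigma> permutes A \<union> B \<and> weight X row u < weight X row (u \<circ> \<sigma>)}"
    have MN: "{\<sigma>. \<sigma> permutes A \<union> B} = M \<union> N" "M \<inter> N = {}"
      using W(1) by (auto simp: M_def N_def order_le_less)
    have fin: "finite M" "finite N" using finP MN(1) by (metis finite_Un)+
    \<comment> \<open>This makes the multiplicity of \<open>u\<close> in the relation positive, so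
      that it can be divided by; it is the source of the denominators.\<close>
    have "id \<in> M" by (simp add: M_def)
    then have "card M > 0" using fin by (auto simp: card_gt_0_iff)
    have rel: "int (card M) * young_coeff u w + (\<Sum>\<sigma>\<in>N. c u \<sigma> * young_coeff (u \<circ> \<sigma>) w) = 0" for w
    proof -
      have "0 = (\<Sum>\<sigma> | \<sigma> permutes A \<union> B. young_sum (\<lambda>\<pi>. term_coeff u w (\<sigma> \<circ> \<pi>)))"
        using garnir_collision[OF xy A_def B_def] by (intro garnir_relation[symmetric] sub)
      also have "\<dots> = (\<Sum>\<sigma> | \<sigma> permutes A \<union> B. c u \<sigma> * young_coeff (u \<circ> \<sigma>) w)"
        by (intro sum.cong refl young_coeff_shift[symmetric] u PX) simp
      also have "\<dots> = (\<Sum>\<sigma>\<in>M. c u \<sigma> * young_coeff (u \<circ> \<sigma>) w) + (\<Sum>\<sigma>\<in>N. c u \<sigma> * young_coeff (u \<circ> \<sigma>) w)"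
        unfolding MN(1) by (rule sum.union_disjoint[OF fin MN(2)])
      also have "(\<Sum>\<sigma>\<in>M. c u \<sigma> * young_coeff (u \<circ> \<sigma>) w) = (\<Sum>\<sigma>\<in>M. young_coeff u w)"
        by (intro sum.cong refl W(2)) (simp_all add: M_def)
      finally show ?thesis by (simp only: sum_constant)
    qed
    have "of_int (young_coeff u w) =
        - (1 / of_nat (card M)) * (\<Sum>\<sigma>\<in>N. of_int (c u \<sigma>) *
            (of_int (young_coeff (u \<circ> \<sigma>) w) :: rat))" for w
    proof -
      have "of_int (int (card M) * young_coeff u w + (\<Sum>\<sigma>\<in>N. c u \<sigma> * young_coeff (u \<circ> \<sigma>) w)) =
          (0 :: rat)"
        by (simp only: rel of_int_0)
      then show ?thesis using \<open>card M > 0\<close> by (simp add: field_simps)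
    qed
    moreover have "spanned (\<lambda>w. - (1 / of_nat (card M)) *
        (\<Sum>\<sigma>\<in>N. of_int (c u \<sigma>) * of_int (young_coeff (u \<circ> \<sigma>) w)))"
      by (intro spanned_cmult spanned_sum IH comp_words u PX) (auto simp: N_def)
    ultimately show ?thesis by presburger
  qed
qed

text \<open>Induction on the number of words of larger row weight. Sorting the rows first costs only
  the factor \<open>c u \<rho>\<close> and keeps the row weight.\<close>

lemma spanned_young_coeff: "u \<in> words \<Longrightarrow> spanned (\<lambda>w. of_int (young_coeff u w))"
proof (induction u rule: measure_induct_rule[where f =
    "\<lambda>u. card {v \<in> words. weight X row u < weight X row v}"])
  case (less u)
  obtain \<rho> where \<rho>: "\<rho> \<in> row_perms" "sorted_along X row col (u \<circ> \<rho>)"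
    using sorted_along_ex[OF finite_X, of row col u] by blast
  have eq: "weight X row (u \<circ> \<rho>) = weight X row u" by (rule weight_comp_self[OF \<rho>(1)])
  have u\<rho>: "u \<circ> \<rho> \<in> words" by (rule comp_words[OF less.prems fiber_permsD(1)[OF \<rho>(1)]])
  have "spanned (\<lambda>w. of_int (young_coeff (u \<circ> \<rho>) w))"
  proof (rule spanned_young_coeff_sorted[OF u\<rho> \<rho>(2)])
    fix v assume v: "v \<in> words" "weight X row (u \<circ> \<rho>) < weight X row v"
    have "card {v' \<in> words. weight X row v < weight X row v'} < card {v' \<in> words. weight X row u <
        weight X row v'}"
      using v eq by (intro psubset_card_mono) (auto simp: finite_words)
    then show "spanned (\<lambda>w. of_int (young_coeff v w))" using less.IH v by blast
  qed
  then have "spanned (\<lambda>w. of_int (c u \<rho>) * of_int (young_coeff (u \<circ> \<rho>) w))" by (rule spanned_cmult)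
  moreover have "of_int (c u \<rho>) * of_int (young_coeff (u \<circ> \<rho>) w) =
      (of_int (young_coeff u w) :: rat)" for w
    using young_coeff_row[OF less.prems \<rho>(1), of w] by (metis of_int_mult)
  ultimately show ?case by (simp only:)
qed

section \<open>Stabilizers and divisibility of the coefficients\<close>

lemma sign_c_stab_odd:
  assumes w: "w \<in> words" and \<pi>: "\<pi> \<in> fiber_perms Z w" and Z: "Z \<subseteq> {x \<in> X. odd_symb (w x)}"
  shows "sign \<pi> * c w \<pi> = 1"
proof -
  have "finite Z" using Z finite_X by (auto intro: finite_subset)
  then show ?thesis using \<pi>
  proof (induction rule: fiber_perms_induct)
    case id
    show ?case by (simp only: c_id[OF w] sign_id mult_1)
  next
    case (swap x y \<sigma>)
    have xy: "x \<in> X" "y \<in> X" "odd_symb (w x)" using swap Z by auto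
    have \<sigma>: "\<sigma> permutes X"
      using fiber_permsD(1)[OF swap(5)] Z by (auto intro: permutes_subset)
    moreover have "w \<circ> transpose x y = w" using swap(4) by (auto simp: transpose_def)
    \<comment> \<open>An exchange of equal odd entries contributes -1 to the cocycle and -1 to
      \<open>sign\<close>, which cancel in the product.\<close>
    ultimately have "c w (transpose x y \<circ> \<sigma>) = - c w \<sigma>"
      using c_comp[OF w permutes_swap_id[OF xy(1,2)]] c_swap[OF w xy(1,2) swap(3,4)] xy(3) by simp
    moreover have "sign (transpose x y \<circ> \<sigma>) = - sign \<sigma>"
      using sign_compose[OF permutation_swap_id permutes_imp_permutation[OF finite_X \<sigma>]] swap(3)
      by (simp add: sign_swap_id)
    ultimately show ?case
      using swap(6) by (simp only: minus_mult_minus)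
  qed
qed

lemma even_row_stabD:
  assumes w: "w \<in> words" and \<pi>: "\<pi> \<in> even_row_stab w"
  shows "\<pi> \<in> row_perms" "w \<circ> \<pi> = w" "c w \<pi> = 1"
proof -
  note D = fiber_permsD[OF \<pi>[unfolded even_row_stab_def]]
  have eq: "row (\<pi> x) = row x" "w (\<pi> x) = w x" for x using D(2)[of x] by auto
  have "\<pi> permutes X" by (rule permutes_subset[OF D(1)]) auto
  then show "\<pi> \<in> row_perms" using eq by (simp add: fiber_perms_def)
  show "w \<circ> \<pi> = w" using eq by (simp add: fun_eq_iff)
  show "c w \<pi> = 1"
    by (rule c_stab_even[OF w, of _ "{x \<in> X. \<not> odd_symb (w x)}"]) (use D(1) eq in \<open>auto simp:
        fiber_perms_def\<close>)
qed

lemma odd_col_stabD: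
  assumes w: "w \<in> words" and \<pi>: "\<pi> \<in> odd_col_stab w"
  shows "\<pi> \<in> col_perms" "w \<circ> \<pi> = w" "sign \<pi> * c w \<pi> = 1"
proof -
  note D = fiber_permsD[OF \<pi>[unfolded odd_col_stab_def]]
  have eq: "col (\<pi> x) = col x" "w (\<pi> x) = w x" for x using D(2)[of x] by auto
  have "\<pi> permutes X" by (rule permutes_subset[OF D(1)]) auto
  then show "\<pi> \<in> col_perms" using eq by (simp add: fiber_perms_def)
  show "w \<circ> \<pi> = w" using eq by (simp add: fun_eq_iff)
  show "sign \<pi> * c w \<pi> = 1"
    by (rule sign_c_stab_odd[OF w, of _ "{x \<in> X. odd_symb (w x)}"]) (use D(1) eq in \<open>auto simp:
        fiber_perms_def\<close>)
qed

lemma finite_stabs: "finite (even_row_stab w)" "finite (odd_col_stab w)"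
  unfolding even_row_stab_def odd_col_stab_def using finite_X by (auto intro: finite_fiber_perms)

lemma card_stabs_pos: "card (even_row_stab w) > 0" "card (odd_col_stab w) > 0"
  using finite_stabs[of w] id_fiber_perms unfolding even_row_stab_def odd_col_stab_def
  by (auto simp: card_gt_0_iff)

lemma young_coeff_eq_sum:
  "young_coeff u w = (\<Sum>(\<rho>, \<kappa>)\<in>row_perms \<times> col_perms. sign \<kappa> * term_coeff u w (\<rho> \<circ> \<kappa>))"
  unfolding young_coeff_def young_sum_def by (rule sum.cartesian_product)

text \<open>Pairs \<open>(h, k)\<close> act freely on the summation indices by
  \<open>(h \<circ> \<rho>, \<kappa> \<circ> k)\<close>, and the summand is constant on orbits. The
  left factor has to stabilize the source \<open>u\<close>, the right one the target
  \<open>w\<close>.\<close>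

lemma card_stabs_dvd_young_coeff:
  assumes u: "u \<in> words" and w: "w \<in> words"
  shows "int (card (even_row_stab u) * card (odd_col_stab w)) dvd young_coeff u w"
proof -
  define H where "H = even_row_stab u"
  define K where "K = odd_col_stab w"
  \<comment> \<open>The orbit of \<open>a\<close>; the orbit itself, as a set, labels its block of
    the sum.\<close>
  define q where "q a = (\<lambda>(h, k). (h \<circ> fst a, snd a \<circ> k)) ` (H \<times> K)" for a :: "('a \<Rightarrow> 'a) \<times> ('a \<Rightarrow> 'a)"
  note H = even_row_stabD[OF u, folded H_def] and K = odd_col_stabD[OF w, folded K_def]
  have idHK: "id \<in> H" "id \<in> K"
    unfolding H_def K_def even_row_stab_def odd_col_stab_def by (rule id_fiber_perms)+
  have compH: "h \<circ> h' \<in> H" if "h \<in> H" "h' \<in> H" for h h'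
    using that unfolding H_def even_row_stab_def by (rule comp_fiber_perms)
  have compK: "k \<circ> k' \<in> K" if "k \<in> K" "k' \<in> K" for k k'
    using that unfolding K_def odd_col_stab_def by (rule comp_fiber_perms)
  have invH: "inv_into UNIV h \<in> H" if "h \<in> H" for h
    using that unfolding H_def even_row_stab_def by (rule inv_fiber_perms)
  have invK: "inv_into UNIV k \<in> K" if "k \<in> K" for k
    using that unfolding K_def odd_col_stab_def by (rule inv_fiber_perms)
  have self: "a \<in> q a" for a
    unfolding q_def by (rule image_eqI[of _ _ "(id, id)"]) (simp_all add: idHK)
  have trans: "q b \<subseteq> q a" if ba: "b \<in> q a" for a b
  proof
    fix d assume "d \<in> q b"
    then obtain h k where hk: "h \<in> H" "k \<in> K" "d = (h \<circ> fst b, snd b \<circ> k)" by (auto simp: q_def)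
    obtain h' k' where hk': "h' \<in> H" "k' \<in> K" "b = (h' \<circ> fst a, snd a \<circ> k')"
      using ba by (auto simp: q_def)
    show "d \<in> q a" unfolding q_def
      by (rule image_eqI[of _ _ "(h \<circ> h', k' \<circ> k)"]) (use hk hk' compH compK in \<open>auto simp: comp_assoc\<close>)
  qed
  have sym: "a \<in> q b" if ba: "b \<in> q a" for a b
  proof -
    obtain h k where hk: "h \<in> H" "k \<in> K" "b = (h \<circ> fst a, snd a \<circ> k)" using ba by (auto simp: q_def)
    have "inv_into UNIV h \<circ> h = id" "k \<circ> inv_into UNIV k = id"
      using permutes_inv_o fiber_permsD(1)[OF H(1)[OF hk(1)]] fiber_permsD(1)[OF K(1)[OF hk(2)]]
        by blast+
    then have "a = (inv_into UNIV h \<circ> fst b, snd b \<circ> inv_into UNIV k)"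
      unfolding hk(3) fst_conv snd_conv by (metis comp_assoc comp_id id_comp prod.collapse)
    then show ?thesis unfolding q_def
      by (intro image_eqI[of _ _ "(inv_into UNIV h, inv_into UNIV k)"]) (use hk invH invK in auto)
  qed
  have eq: "q b = q a" if "b \<in> q a" for a b using trans[OF that] trans[OF sym[OF that]] by auto
  have closed: "q a \<subseteq> row_perms \<times> col_perms" if "a \<in> row_perms \<times> col_perms" for a
    using that H(1) K(1) by (auto simp: q_def intro!: comp_fiber_perms)
  have fiber: "{b \<in> row_perms \<times> col_perms. q b = q a} = q a" if "a \<in> row_perms \<times> col_perms" for a
    using closed[OF that] eq self by blast
  have card: "card (q a) = card H * card K" if "a \<in> row_perms \<times> col_perms" for a
  proof -
    obtain \<rho> \<kappa> where a: "a = (\<rho>, \<kappa>)" by (cases a)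
    have "\<rho> \<in> row_perms" "\<kappa> \<in> col_perms" using that by (simp_all add: a)
    then have \<rho>: "surj \<rho>" and \<kappa>: "inj \<kappa>"
      using permutes_surj[OF fiber_permsD(1)] permutes_inj[OF fiber_permsD(1)] by blast+
    have "inj_on (\<lambda>(h, k). (h \<circ> fst a, snd a \<circ> k)) (H \<times> K)"
    proof (rule inj_onI)
      fix p p'
      assume "(case p of (h, k) \<Rightarrow> (h \<circ> fst a, snd a \<circ> k)) = (case p' of (h, k) \<Rightarrow> (h \<circ> fst a,
          snd a \<circ> k))"
      then have hk: "fst p \<circ> \<rho> = fst p' \<circ> \<rho>" "\<kappa> \<circ> snd p = \<kappa> \<circ> snd p'"
        by (auto simp: a case_prod_unfold)
      have "fst p x = fst p' x" for x using hk(1) \<rho> by (metis comp_apply surjD)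
      moreover have "snd p x = snd p' x" for x using hk(2) \<kappa> by (metis comp_apply injD)
      ultimately show "p = p'" by (simp add: prod_eq_iff fun_eq_iff)
    qed
    then show ?thesis unfolding q_def by (simp add: card_image card_cartesian_product)
  qed
  have const: "(case b of (\<rho>, \<kappa>) \<Rightarrow> sign \<kappa> * term_coeff u w (\<rho> \<circ> \<kappa>)) =
      (case a of (\<rho>, \<kappa>) \<Rightarrow> sign \<kappa> * term_coeff u w (\<rho> \<circ> \<kappa>))"
    if a: "a \<in> row_perms \<times> col_perms" and "b \<in> q a" for a b
  proof -
    obtain \<rho> \<kappa> where \<rho>\<kappa>: "a = (\<rho>, \<kappa>)" "\<rho> \<in> row_perms" "\<kappa> \<in> col_perms" using a by auto
    obtain h k where hk: "h \<in> H" "k \<in> K" "b = (h \<circ> \<rho>, \<kappa> \<circ> k)" using \<open>b \<in> q a\<close> by (auto simp: q_def \<rho>\<kappa>)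
    have p: "h permutes X" "k permutes X" "\<rho> permutes X" "\<kappa> permutes X"
      using fiber_permsD(1) H(1) K(1) hk \<rho>\<kappa> by blast+
    have uh: "u \<circ> (h \<circ> \<rho> \<circ> (\<kappa> \<circ> k)) = u \<circ> (\<rho> \<circ> \<kappa>) \<circ> k"
      using H(2)[OF hk(1)] by (metis comp_assoc)
    \<comment> \<open>A right factor fixing \<open>w\<close> does not change whether the target is
      reached, so vanishing terms stay zero along the orbit.\<close>
    have "w \<circ> inv_into UNIV k = w" using K(2)[OF invK[OF hk(2)]] .
    then have iff: "u \<circ> (h \<circ> \<rho> \<circ> (\<kappa> \<circ> k)) = w \<longleftrightarrow> u \<circ> (\<rho> \<circ> \<kappa>) = w"
      unfolding uh using permutes_inv_o(1)[OF p(2)] K(2)[OF hk(2)] by (metis comp_assoc comp_id)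
    show ?thesis
    proof (cases "u \<circ> (\<rho> \<circ> \<kappa>) = w")
      case True
      have p': "\<rho> \<circ> \<kappa> permutes X" using p by (simp add: permutes_compose)
      then have p'': "(\<rho> \<circ> \<kappa>) \<circ> k permutes X" using p by (simp add: permutes_compose)
      have "c u (h \<circ> \<rho> \<circ> (\<kappa> \<circ> k)) = c u (h \<circ> (\<rho> \<circ> \<kappa> \<circ> k))" by (simp only: comp_assoc)
      also have "\<dots> = c u h * c u (\<rho> \<circ> \<kappa> \<circ> k)"
        using c_comp[OF u p(1) p''] H(2)[OF hk(1)] by simp
      \<comment> \<open>Here the target enters: the cocycle of \<open>k\<close> is taken at
        \<open>u \<circ> (\<rho> \<circ> \<kappa>) = w\<close>, where
        \<open>sign k * c w k = 1\<close>.\<close>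
      also have "\<dots> = c u (\<rho> \<circ> \<kappa>) * c w k"
        using c_comp[OF u p' p(2)] True H(3)[OF hk(1)] by simp
      finally have "sign (\<kappa> \<circ> k) * c u (h \<circ> \<rho> \<circ> (\<kappa> \<circ> k)) = sign \<kappa> * c u (\<rho> \<circ> \<kappa>) * (sign k * c w k)"
        using sign_compose[of \<kappa> k] permutes_imp_permutation[OF finite_X] p by simp
      then show ?thesis using K(3)[OF hk(2)] iff True by (simp add: hk(3) \<rho>\<kappa>(1) term_coeff_def)
    next
      case False
      then show ?thesis using iff by (simp add: hk(3) \<rho>\<kappa>(1) term_coeff_def)
    qed
  qed
  have "int (card H * card K) dvd
      (\<Sum>(\<rho>, \<kappa>)\<in>row_perms \<times> col_perms. sign \<kappa> * term_coeff u w (\<rho> \<circ> \<kappa>))"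
  proof (rule sum_fiber_dvd[where q = q])
    show "finite (row_perms \<times> col_perms)" using finite_X by (simp add: finite_fiber_perms)
  next
    fix a assume "a \<in> row_perms \<times> col_perms"
    then show "card {b \<in> row_perms \<times> col_perms. q b = q a} = card H * card K"
      using fiber card by simp
  next
    fix a b assume "a \<in> row_perms \<times> col_perms" "q a = q b"
    then show "(case a of (\<rho>, \<kappa>) \<Rightarrow> sign \<kappa> * term_coeff u w (\<rho> \<circ> \<kappa>)) =
      (case b of (\<rho>, \<kappa>) \<Rightarrow> sign \<kappa> * term_coeff u w (\<rho> \<circ> \<kappa>))"
      using const[of a b] self[of b] by metis
  qed
  then show ?thesis unfolding young_coeff_eq_sum H_def K_def .
qed

section \<open>Unitriangularity on semistandard words and integrality\<close>

lemma semistd_sorted: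
  assumes "semistd u"
  shows "sorted_along X row col u" "sorted_along X col row u"
  using assms unfolding semistd_def sorted_along_def by blast+

text \<open>No odd symbol occurs twice in a row of a semistandard word, so a row permutation fixing
  the word cannot move a box with an odd entry.\<close>

lemma semistd_row_stab:
  assumes "semistd u" "\<rho> \<in> row_perms" "u \<circ> \<rho> = u"
  shows "\<rho> \<in> even_row_stab u"
proof -
  note D = fiber_permsD[OF assms(2)]
  have eq: "u (\<rho> x) = u x" for x using assms(3) by (metis comp_apply)
  have "\<rho> x = x" if x: "x \<in> X" "odd_symb (u x)" for x
  proof (rule ccontr)
    assume ne: "\<rho> x \<noteq> x"
    have X: "\<rho> x \<in> X" using x permutes_in_image[OF D(1)] by simp
    then have "col x < col (\<rho> x) \<or> col (\<rho> x) < col x"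
      using ne box_inj[OF _ x(1)] D(2) by (metis linorder_neqE_nat)
    then show False
      using assms(1) X x eq[of x] D(2)[of x] unfolding semistd_def by metis
  qed
  then have "\<rho> permutes {x \<in> X. \<not> odd_symb (u x)}"
    by (intro permutes_superset[OF D(1)]) auto
  then show ?thesis using D(2) eq by (simp add: even_row_stab_def fiber_perms_def)
qed

lemma semistd_col_stab:
  assumes "semistd u" "\<kappa> \<in> col_perms" "u \<circ> \<kappa> = u"
  shows "\<kappa> \<in> odd_col_stab u"
proof -
  note D = fiber_permsD[OF assms(2)]
  have eq: "u (\<kappa> x) = u x" for x using assms(3) by (metis comp_apply)
  have "\<kappa> x = x" if x: "x \<in> X" "\<not> odd_symb (u x)" for x
  proof (rule ccontr)
    assume ne: "\<kappa> x \<noteq> x"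
    have X: "\<kappa> x \<in> X" using x permutes_in_image[OF D(1)] by simp
    then have "row x < row (\<kappa> x) \<or> row (\<kappa> x) < row x"
      using ne box_inj[OF _ x(1)] D(2) by (metis linorder_neqE_nat)
    then show False
      using assms(1) X x eq[of x] D(2)[of x] unfolding semistd_def by metis
  qed
  then have "\<kappa> permutes {x \<in> X. odd_symb (u x)}"
    by (intro permutes_superset[OF D(1)]) auto
  then show ?thesis using D(2) eq by (simp add: odd_col_stab_def fiber_perms_def)
qed

lemma words_eqI: "u \<in> words \<Longrightarrow> v \<in> words \<Longrightarrow> (\<And>x. x \<in> X \<Longrightarrow> u x = v x) \<Longrightarrow> u = v"
  by (rule PiE_ext) auto

text \<open>Column permutations keep the column weight, and row permutations of the row-sorted
  \<open>u\<close> cannot raise it. In case of equality \<open>\<rho>\<close> fixes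
  \<open>u\<close>, so \<open>v\<close> is a column rearrangement of \<open>u\<close>; both are
  sorted along columns, hence equal.\<close>

lemma semistd_rearrangement:
  assumes u: "u \<in> words" "semistd u" and v: "sorted_along X col row v"
    and \<rho>: "\<rho> \<in> row_perms" and \<kappa>: "\<kappa> \<in> col_perms" and eq: "u \<circ> (\<rho> \<circ> \<kappa>) = v"
  shows "weight X col v \<le> weight X col u"
    and "weight X col v = weight X col u \<Longrightarrow> v = u \<and> u \<circ> \<rho> = u \<and> u \<circ> \<kappa> = u"
proof -
  have wt: "weight X col v = weight X col (u \<circ> \<rho>)"
    unfolding eq[symmetric] comp_assoc[symmetric] by (rule weight_comp_self[OF \<kappa>])
  note W = weight_sorted[OF finite_X box_inj semistd_sorted(1)[OF u(2)] \<rho>]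
  show "weight X col v \<le> weight X col u" unfolding wt by (rule W(1))
  assume "weight X col v = weight X col u"
  then have eqw: "weight X col (u \<circ> \<rho>) = weight X col u" using wt by metis
  have "u (\<rho> x) = u x" if "x \<in> X" for x by (rule W(2)) (assumption | rule that eqw)+
  then have u\<rho>: "u \<circ> \<rho> = u"
    using comp_words[OF u(1) fiber_permsD(1)[OF \<rho>]] u(1) by (intro words_eqI) auto
  then have v\<kappa>: "v = u \<circ> \<kappa>" using eq by (metis comp_assoc)
  have "u (\<kappa> x) = u x" if "x \<in> X" for x
    using sorted_along_unique[OF finite_X _ \<kappa> semistd_sorted(2)[OF u(2)] _ that] v v\<kappa> box_inj by metis
  then have "u \<circ> \<kappa> = u"
    using comp_words[OF u(1) fiber_permsD(1)[OF \<kappa>]] u(1) by (intro words_eqI) auto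
  then show "v = u \<and> u \<circ> \<rho> = u \<and> u \<circ> \<kappa> = u" using u\<rho> v\<kappa> by simp
qed

lemma young_coeff_triangular:
  assumes "u \<in> words" "semistd u" "semistd v" "young_coeff u v \<noteq> 0" "u \<noteq> v"
  shows "weight X col v < weight X col u"
proof -
  have "\<exists>\<rho>\<in>row_perms. \<exists>\<kappa>\<in>col_perms. term_coeff u v (\<rho> \<circ> \<kappa>) \<noteq> 0"
  proof (rule ccontr)
    assume "\<not> ?thesis"
    then have "young_coeff u v = 0"
      unfolding young_coeff_eq_sum by (intro sum.neutral) auto
    then show False using assms(4) by simp
  qed
  then obtain \<rho> \<kappa> where "\<rho> \<in> row_perms" "\<kappa> \<in> col_perms" "term_coeff u v (\<rho> \<circ> \<kappa>) \<noteq> 0"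
    by blast
  moreover from this have "u \<circ> (\<rho> \<circ> \<kappa>) = v" by (auto simp: term_coeff_def split: if_splits)
  ultimately show ?thesis
    using semistd_rearrangement[OF assms(1,2) semistd_sorted(2)[OF assms(3)]] assms(5)
    by (metis order_le_less)
qed

text \<open>Only pairs of stabilizing permutations return \<open>u\<close> to itself, and each
  contributes 1. The general divisor of the coefficients is thus attained on the diagonal, which
  becomes 1 after division.\<close>

lemma young_coeff_diag:
  assumes u: "u \<in> words" "semistd u"
  shows "young_coeff u u = int (card (even_row_stab u) * card (odd_col_stab u))"
proof -
  note H = even_row_stabD[OF u(1)] and K = odd_col_stabD[OF u(1)]
  have "young_coeff u u =
      (\<Sum>(\<rho>, \<kappa>)\<in>even_row_stab u \<times> odd_col_stab u. sign \<kappa> * term_coeff u u (\<rho> \<circ> \<kappa>))"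
    unfolding young_coeff_eq_sum
  proof (rule sum.mono_neutral_right)
    show "finite (row_perms \<times> col_perms)" using finite_X by (simp add: finite_fiber_perms)
    show "even_row_stab u \<times> odd_col_stab u \<subseteq> row_perms \<times> col_perms" using H(1) K(1) by auto
    show "\<forall>a\<in>row_perms \<times> col_perms - even_row_stab u \<times> odd_col_stab u.
        (case a of (\<rho>, \<kappa>) \<Rightarrow> sign \<kappa> * term_coeff u u (\<rho> \<circ> \<kappa>)) = 0"
    proof
      fix a assume "a \<in> row_perms \<times> col_perms - even_row_stab u \<times> odd_col_stab u"
      then obtain \<rho> \<kappa> where a: "a = (\<rho>, \<kappa>)" "\<rho> \<in> row_perms" "\<kappa> \<in> col_perms"
        "\<rho> \<notin> even_row_stab u \<or> \<kappa> \<notin> odd_col_stab u" by auto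
      have "u \<circ> (\<rho> \<circ> \<kappa>) \<noteq> u"
        using semistd_rearrangement(2)[OF u semistd_sorted(2)[OF u(2)] a(2,3)] a(4)
          semistd_row_stab[OF u(2) a(2)] semistd_col_stab[OF u(2) a(3)] by blast
      then show "(case a of (\<rho>, \<kappa>) \<Rightarrow> sign \<kappa> * term_coeff u u (\<rho> \<circ> \<kappa>)) = 0"
        by (simp add: a(1) term_coeff_def)
    qed
  qed
  also have "\<dots> = (\<Sum>(\<rho>, \<kappa>)\<in>even_row_stab u \<times> odd_col_stab u. 1)"
  proof (intro sum.cong refl, clarify)
    fix \<rho> \<kappa> assume a: "\<rho> \<in> even_row_stab u" "\<kappa> \<in> odd_col_stab u"
    have "c u (\<rho> \<circ> \<kappa>) = c u \<kappa>"
      using c_comp[OF u(1) fiber_permsD(1)[OF H(1)[OF a(1)]] fiber_permsD(1)[OF K(1)[OF a(2)]]]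
        H(2,3)[OF a(1)] by simp
    moreover have "u \<circ> (\<rho> \<circ> \<kappa>) = u" using H(2)[OF a(1)] K(2)[OF a(2)] by (metis comp_assoc)
    ultimately show "sign \<kappa> * term_coeff u u (\<rho> \<circ> \<kappa>) = 1"
      using K(3)[OF a(2)] by (simp add: term_coeff_def)
  qed
  also have "\<dots> = int (card (even_row_stab u) * card (odd_col_stab u))"
    by (simp add: case_prod_unfold card_cartesian_product)
  finally show ?thesis .
qed

text \<open>After rescaling by the source stabilizers, the rational coefficients are compared at
  each semistandard \<open>v\<close>, divided by the order of \<open>odd_col_stab v\<close>. There
  only \<open>v\<close>, with entry 1, and words of larger column weight contribute, so integrality
  descends from the largest weight.\<close>

lemma integral_straightening:
  assumes i: "i \<in> words"
  shows "\<exists>k :: _ \<Rightarrow> int. \<forall>w. of_int (young_coeff i w) / of_nat (card (even_row_stab i)) =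
    (\<Sum>u\<in>semistd_words. of_int (k u) * (of_int (young_coeff u w) / of_nat (card (even_row_stab u)) ::
        rat))"
proof -
  let ?H = "\<lambda>u. of_nat (card (even_row_stab u)) :: rat"
  let ?K = "\<lambda>u. of_nat (card (odd_col_stab u)) :: rat"
  let ?e = "\<lambda>u w. of_int (young_coeff u w) :: rat"
  have pos [simp]: "card (even_row_stab u) \<noteq> 0" "card (odd_col_stab u) \<noteq> 0" for u
    using card_stabs_pos[of u] by simp_all
  have fin: "finite semistd_words" using finite_words by simp
  obtain k where k: "\<And>w. ?e i w = (\<Sum>u\<in>semistd_words. k u * ?e u w)"
    using spanned_young_coeff[OF i] unfolding spanned_def by blast
  define l where "l u = k u * ?H u / ?H i" for u
  have expand: "?e i w / ?H i = (\<Sum>u\<in>semistd_words. l u * (?e u w / ?H u))" for w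
    unfolding k sum_divide_distrib by (intro sum.cong refl) (simp add: l_def)
  have int_coeff: "?e u w / (?H u * ?K w) \<in> \<int>" if uw: "u \<in> words" "w \<in> words" for u w
  proof -
    obtain d where "young_coeff u w = int (card (even_row_stab u) * card (odd_col_stab w)) * d"
      using card_stabs_dvd_young_coeff[OF uw] by (rule dvdE)
    then have "?e u w / (?H u * ?K w) = of_int d" by simp
    then show ?thesis by simp
  qed
  have l_int: "l v \<in> \<int>" if "v \<in> semistd_words" for v
    using that
  proof (induction v rule: measure_induct_rule[where
        f = "\<lambda>v. card {u \<in> semistd_words. weight X col v < weight X col u}"])
    case (less v)
    have v: "v \<in> words" "semistd v" using less.prems by auto
    have "?e i v / (?H i * ?K v) = (\<Sum>u\<in>semistd_words. l u * (?e u v / ?H u)) / ?K v"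
      unfolding expand[symmetric] by simp
    also have "\<dots> = (\<Sum>u\<in>semistd_words. l u * (?e u v / (?H u * ?K v)))"
      unfolding sum_divide_distrib by (intro sum.cong refl) simp
    also have "\<dots> = l v * (?e v v / (?H v * ?K v)) +
        (\<Sum>u\<in>semistd_words - {v}. l u * (?e u v / (?H u * ?K v)))"
      by (rule sum.remove[OF fin less.prems])
    also have "?e v v / (?H v * ?K v) = 1"
      by (simp add: young_coeff_diag[OF v])
    finally have "l v = ?e i v / (?H i * ?K v) -
        (\<Sum>u\<in>semistd_words - {v}. l u * (?e u v / (?H u * ?K v)))" by simp
    also have "\<dots> \<in> \<int>"
    proof (intro Ints_diff Ints_sum int_coeff i v(1))
      fix u assume "u \<in> semistd_words - {v}"
      then have u: "u \<in> words" "semistd u" "u \<noteq> v" by auto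
      show "l u * (?e u v / (?H u * ?K v)) \<in> \<int>"
      proof (cases "young_coeff u v = 0")
        case False
        have "weight X col v < weight X col u"
          by (rule young_coeff_triangular[OF u(1,2) v(2) False u(3)])
        then have "card {u' \<in> semistd_words. weight X col u < weight X col u'} <
            card {u' \<in> semistd_words. weight X col v < weight X col u'}"
          using u finite_words by (intro psubset_card_mono) auto
        then have "l u \<in> \<int>" using less.IH u by simp
        then show ?thesis by (intro Ints_mult int_coeff u(1) v(1))
      qed simp
    qed
    finally show ?case .
  qed
  then have "\<forall>u\<in>semistd_words. \<exists>z. l u = of_int z" unfolding Ints_def by blast
  then obtain k' where "\<forall>u\<in>semistd_words. l u = of_int (k' u)" by (rule bchoice[THEN exE])
  then have "?e i w / ?H i = (\<Sum>u\<in>semistd_words. of_int (k' u) * (?e u w / ?H u))" for w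
    unfolding expand by (intro sum.cong refl) simp
  then show ?thesis by blast
qed

text \<open>\<open>\<Phi>\<close> is an arbitrary linear form on words; collecting the double sum by
  resulting word lets the straightening of coefficient vectors act on the elements \<chi>.\<close>

lemma young_coeff_expand:
  fixes \<Phi> :: "('a \<Rightarrow> nat) \<Rightarrow> rat"
  assumes u: "u \<in> words"
  shows "(\<Sum>\<rho>\<in>row_perms. \<Sum>\<kappa>\<in>col_perms. of_int (sign \<kappa> * c u (\<rho> \<circ> \<kappa>)) * \<Phi> (u \<circ> (\<rho> \<circ> \<kappa>))) =
    (\<Sum>z\<in>words. of_int (young_coeff u z) * \<Phi> z)"
proof -
  have delta: "of_int (sign \<kappa> * c u (\<rho> \<circ> \<kappa>)) * \<Phi> (u \<circ> (\<rho> \<circ> \<kappa>)) =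
      (\<Sum>z\<in>words. of_int (sign \<kappa> * term_coeff u z (\<rho> \<circ> \<kappa>)) * \<Phi> z)"
    if "\<rho> \<in> row_perms" "\<kappa> \<in> col_perms" for \<rho> \<kappa>
  proof -
    define v where "v = u \<circ> (\<rho> \<circ> \<kappa>)"
    have v: "v \<in> words"
      unfolding v_def by (intro comp_words[OF u] permutes_compose fiber_permsD(1)[OF that(1)]
          fiber_permsD(1)[OF that(2)])
    have "(\<Sum>z\<in>words. of_int (sign \<kappa> * term_coeff u z (\<rho> \<circ> \<kappa>)) * \<Phi> z) =
        (\<Sum>z\<in>{v}. of_int (sign \<kappa> * term_coeff u z (\<rho> \<circ> \<kappa>)) * \<Phi> z)"
      using v finite_words by (intro sum.mono_neutral_right) (auto simp: term_coeff_def v_def)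
    then show ?thesis by (simp add: term_coeff_def v_def)
  qed
  have "(\<Sum>\<rho>\<in>row_perms. \<Sum>\<kappa>\<in>col_perms. of_int (sign \<kappa> * c u (\<rho> \<circ> \<kappa>)) * \<Phi> (u \<circ> (\<rho> \<circ> \<kappa>))) =
      (\<Sum>\<rho>\<in>row_perms. \<Sum>\<kappa>\<in>col_perms. \<Sum>z\<in>words. of_int (sign \<kappa> * term_coeff u z (\<rho> \<circ> \<kappa>)) * \<Phi> z)"
    by (intro sum.cong refl delta)
  also have "\<dots> = (\<Sum>\<rho>\<in>row_perms. \<Sum>z\<in>words. \<Sum>\<kappa>\<in>col_perms. of_int (sign \<kappa> * term_coeff u z (\<rho> \<circ> \<kappa>)) * \<Phi> z)"
    by (intro sum.cong refl sum.swap)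
  also have "\<dots> = (\<Sum>z\<in>words. \<Sum>\<rho>\<in>row_perms. \<Sum>\<kappa>\<in>col_perms. of_int (sign \<kappa> * term_coeff u z (\<rho> \<circ> \<kappa>)) * \<Phi> z)"
    by (rule sum.swap)
  also have "\<dots> = (\<Sum>z\<in>words. of_int (young_coeff u z) * \<Phi> z)"
    by (simp only: young_coeff_def young_sum_def of_int_sum sum_distrib_right)
  finally show ?thesis .
qed

end

section \<open>Signs of the action on multiindices\<close>

text \<open>Signs and commutation relations are explicit for neighbouring positions, so arbitrary
  transpositions are reduced to adjacent ones by conjugation.\<close>

lemma adjacent_transpositions_induct [consumes 1, case_names id adjacent]:
  assumes \<pi>: "\<pi> permutes {1..r}"
    and id: "P id"
    and step: "\<And>\<pi> k. \<pi> permutes {1..r} \<Longrightarrow> 1 \<le> k \<Longrightarrow> k < r \<Longrightarrow> P \<pi> \<Longrightarrow> P (\<pi> \<circ> transpose k (Suc k))"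
  shows "P \<pi>"
proof -
  \<comment> \<open>The positions are \<open>d + 1\<close> apart, so \<open>d = 0\<close> is the
    adjacent case; a longer transposition is a shorter one conjugated by the adjacent transposition
    at its right end.\<close>
  have apply_swap: "P (\<pi> \<circ> transpose a (Suc (a + d)))"
    if "\<pi> permutes {1..r}" "P \<pi>" "1 \<le> a" "Suc (a + d) \<le> r" for \<pi> a d
    using that
  proof (induction d arbitrary: \<pi>)
    case 0
    then show ?case using step[OF 0(1) 0(3) _ 0(2)] by (simp only: add_0_right Suc_le_eq)
  next
    case (Suc d)
    define s where "s = transpose (Suc (a + d)) (Suc (Suc (a + d)))"
    have perm: "\<pi> \<circ> s permutes {1..r}" "\<pi> \<circ> s \<circ> transpose a (Suc (a + d)) permutes {1..r}"
      unfolding s_def using Suc.prems by (auto intro!: permutes_compose permutes_swap_id)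
    have ad: "1 \<le> Suc (a + d)" "Suc (a + d) < r" "Suc (a + d) \<le> r" using Suc.prems by auto
    have "P (\<pi> \<circ> s)" unfolding s_def by (rule step[OF Suc.prems(1) ad(1,2) Suc.prems(2)])
    then have "P (\<pi> \<circ> s \<circ> transpose a (Suc (a + d)))" by (rule Suc.IH[OF perm(1) _ Suc.prems(3) ad(3)])
    then have "P (\<pi> \<circ> s \<circ> transpose a (Suc (a + d)) \<circ> s)"
      unfolding s_def by (rule step[OF perm(2)[unfolded s_def] ad(1,2)])
    also have "\<pi> \<circ> s \<circ> transpose a (Suc (a + d)) \<circ> s = \<pi> \<circ> transpose a (Suc (a + Suc d))"
      by (auto simp: fun_eq_iff s_def transpose_def)
    finally show ?case .
  qed
  have "finite {1..r}" by simp
  then show ?thesis using \<pi>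
  proof (induction rule: permutes_rev_induct)
    case id
    show ?case by (rule assms(2))
  next
    case (swap a b p)
    show ?case
    proof (cases a b rule: linorder_cases)
      case less
      then obtain d where d: "b = Suc (a + d)" using less_imp_Suc_add by blast
      show ?thesis unfolding d
        by (rule apply_swap) (use swap d in simp_all)
    next
      case greater
      then obtain d where d: "a = Suc (b + d)" using less_imp_Suc_add by blast
      show ?thesis unfolding transpose_commute[of a b] unfolding d
        by (rule apply_swap) (use swap d in simp_all)
    next
      case equal
      then show ?thesis using swap(3) by contradiction
    qed
  qed
qed

section \<open>The sign of the action as a cocycle\<close>

definition index_pairs :: "nat \<Rightarrow> (nat \<times> nat) set" where
  "index_pairs r = {(a, b). 1 \<le> a \<and> a < b \<and> b \<le> r}"

lemma finite_index_pairs: "finite (index_pairs r)"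
  by (rule finite_subset[of _ "{1..r} \<times> {1..r}"]) (auto simp: index_pairs_def)

text \<open>An adjacent transposition permutes the increasing pairs among themselves, except that
  \<open>(k, Suc k)\<close> is reversed. The additive form avoids subtraction of naturals; it serves
  both inversion counts and the exponent in \<chi>.\<close>

lemma sum_index_pairs_adjacent:
  fixes F :: "nat \<Rightarrow> nat \<Rightarrow> nat"
  assumes k: "1 \<le> k" "k < r"
  defines "s \<equiv> transpose k (Suc k)"
  shows "(\<Sum>(a, b)\<in>index_pairs r. F (s a) (s b)) + F k (Suc k) =
    (\<Sum>(a, b)\<in>index_pairs r. F a b) + F (Suc k) k"
proof -
  have p: "(k, Suc k) \<in> index_pairs r" using k by (auto simp: index_pairs_def)
  have split: "sum G (index_pairs r) = G (k, Suc k) + sum G (index_pairs r - {(k, Suc k)})"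
    for G :: "nat \<times> nat \<Rightarrow> nat"
    by (rule sum.remove[OF finite_index_pairs p])
  have "(\<Sum>(a, b)\<in>index_pairs r - {(k, Suc k)}. F (s a) (s b)) =
      (\<Sum>(a, b)\<in>index_pairs r - {(k, Suc k)}. F a b)"
    by (rule sum.reindex_bij_witness[where i = "map_prod s s" and j = "map_prod s s"])
      (use k in \<open>auto simp: s_def index_pairs_def transpose_def split: if_splits\<close>)
  then show ?thesis by (simp add: split s_def)
qed

lemma inv_count_eq_sum:
  "inv_count m r j \<pi> = (\<Sum>(a, b)\<in>index_pairs r. of_bool (\<pi> b < \<pi> a \<and> m < j (\<pi> a) \<and> m < j (\<pi> b)))"
proof -
  have "{(a, b). 1 \<le> a \<and> a < b \<and> b \<le> r \<and> \<pi> a > \<pi> b \<and> j (\<pi> a) > m \<and> j (\<pi> b) > m} =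
      index_pairs r \<inter> {x. case x of (a, b) \<Rightarrow> \<pi> b < \<pi> a \<and> m < j (\<pi> a) \<and> m < j (\<pi> b)}"
    by (auto simp: index_pairs_def)
  then show ?thesis
    unfolding inv_count_def using finite_index_pairs[of r]
    by (simp add: case_prod_unfold of_bool_def sum.If_cases)
qed

definition inv_sign :: "nat \<Rightarrow> nat \<Rightarrow> (nat \<Rightarrow> nat) \<Rightarrow> (nat \<Rightarrow> nat) \<Rightarrow> int" where
  "inv_sign m r j \<pi> = (- 1) ^ inv_count m r j \<pi>"

lemma inv_sign_id: "inv_sign m r j id = 1"
proof -
  have "inv_count m r j id = 0"
    unfolding inv_count_eq_sum by (intro sum.neutral) (auto simp: index_pairs_def)
  then show ?thesis by (simp add: inv_sign_def)
qed

lemma inv_sign_adjacent: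
  assumes "1 \<le> k" "k < r"
  shows "inv_sign m r j (transpose k (Suc k)) = (if m < j k \<and> m < j (Suc k) then - 1 else 1)"
proof -
  have "(\<Sum>(a, b)\<in>index_pairs r. of_bool (b < a \<and> m < j a \<and> m < j b)) = (0 :: nat)"
    by (intro sum.neutral) (auto simp: index_pairs_def)
  then show ?thesis
    using sum_index_pairs_adjacent[OF assms, of "\<lambda>a b. of_bool (b < a \<and> m < j a \<and> m < j b)"]
    by (simp add: inv_sign_def inv_count_eq_sum)
qed

text \<open>Only the pair at positions \<open>k\<close>, \<open>Suc k\<close> changes its
  contribution. As \<pi> is injective, exactly one of its two orders is an inversion, so the sign
  flips exactly if both entries there are odd.\<close>

lemma inv_sign_comp_adjacent:
  assumes "\<pi> permutes {1..r}" "1 \<le> k" "k < r"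
  shows "inv_sign m r j (\<pi> \<circ> transpose k (Suc k)) =
    inv_sign m r j \<pi> * inv_sign m r (j \<circ> \<pi>) (transpose k (Suc k))"
proof -
  have "\<pi> k \<noteq> \<pi> (Suc k)" using permutes_inj[OF assms(1)] by (simp add: inj_eq)
  define F where "F a b = (of_bool (\<pi> b < \<pi> a \<and> m < j (\<pi> a) \<and> m < j (\<pi> b)) :: nat)" for a b
  have eq: "inv_count m r j (\<pi> \<circ> transpose k (Suc k)) + F k (Suc k) = inv_count m r j \<pi> + F (Suc k) k"
    using sum_index_pairs_adjacent[OF assms(2,3), of F] by (simp add: inv_count_eq_sum F_def)
  have "inv_sign m r j (\<pi> \<circ> transpose k (Suc k)) * (- 1) ^ F k (Suc k) = inv_sign m r j \<pi> *
      (- 1) ^ F (Suc k) k"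
    unfolding inv_sign_def power_add[symmetric] eq ..
  then show ?thesis
    unfolding inv_sign_adjacent[OF assms(2,3)] using \<open>\<pi> k \<noteq> \<pi> (Suc k)\<close>
    by (cases "\<pi> k" "\<pi> (Suc k)" rule: linorder_cases) (auto simp: F_def)
qed

lemma inv_sign_comp:
  assumes "\<pi> permutes {1..r}" "\<sigma> permutes {1..r}"
  shows "inv_sign m r j (\<pi> \<circ> \<sigma>) = inv_sign m r j \<pi> * inv_sign m r (j \<circ> \<pi>) \<sigma>"
  using assms(2)
proof (induction rule: adjacent_transpositions_induct)
  case id
  show ?case by (simp only: comp_id inv_sign_id mult_1_right)
next
  case (adjacent \<sigma> k)
  have "\<pi> \<circ> \<sigma> permutes {1..r}" by (rule permutes_compose[OF adjacent(1) assms(1)])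
  then show ?case
    using inv_sign_comp_adjacent[OF _ adjacent(2,3)] adjacent(1,4)
    by (metis comp_assoc mult.assoc)
qed

lemma inv_sign_square: "inv_sign m r j \<pi> * inv_sign m r j \<pi> = 1"
  by (simp add: inv_sign_def flip: power_mult_distrib)

text \<open>Conjugation by an adjacent transposition shortens the distance. The two outer signs are
  taken at words with the same two entries at \<open>k\<close> and \<open>Suc k\<close> up to order,
  so they cancel.\<close>

lemma inv_sign_swap_less:
  assumes "1 \<le> x" "x < y" "y \<le> r" "j x = j y"
  shows "inv_sign m r j (transpose x y) = (if m < j x then - 1 else 1)"
proof -
  have "inv_sign m r j (transpose x (Suc (x + d))) = (if m < j x then - 1 else 1)"
    if "1 \<le> x" "Suc (x + d) \<le> r" "j x = j (Suc (x + d))" for d j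
    using that
  proof (induction d arbitrary: j)
    case 0
    then show ?case by (simp add: inv_sign_adjacent)
  next
    case (Suc d)
    define k where "k = Suc (x + d)"
    define s where "s = transpose k (Suc k)"
    define t where "t = transpose x k"
    have k: "1 \<le> k" "k < r" using Suc.prems by (auto simp: k_def)
    have st: "s permutes {1..r}" "t permutes {1..r}"
      unfolding s_def t_def using Suc.prems by (auto simp: k_def intro!: permutes_swap_id)
    have "transpose x (Suc (x + Suc d)) = s \<circ> (t \<circ> s)"
      by (auto simp: fun_eq_iff s_def t_def k_def transpose_def)
    then have "inv_sign m r j (transpose x (Suc (x + Suc d))) =
        inv_sign m r j s * (inv_sign m r (j \<circ> s) t * inv_sign m r (j \<circ> s \<circ> t) s)"
      using inv_sign_comp[OF st(1) permutes_compose[OF st(1,2)]] inv_sign_comp[OF st(2,1)] by simp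
    also have "inv_sign m r (j \<circ> s) t = (if m < j x then - 1 else 1)"
    proof -
      define j' where "j' = j \<circ> s"
      have "j' x = j x" "j' k = j x" using Suc.prems by (simp_all add: j'_def s_def k_def)
      then show ?thesis
        using Suc.IH[of j', folded k_def, folded t_def] Suc.prems(1) k
        unfolding j'_def[symmetric] by simp
    qed
    also have "inv_sign m r (j \<circ> s \<circ> t) s = inv_sign m r j s"
    proof -
      have "(j \<circ> s \<circ> t) k = j (Suc k)" "(j \<circ> s \<circ> t) (Suc k) = j k"
        using Suc.prems by (simp_all add: s_def t_def k_def)
      then show ?thesis unfolding s_def inv_sign_adjacent[OF k] by auto
    qed
    finally show ?case using inv_sign_square[of m r j s] by simp
  qed
  moreover obtain d where "y = Suc (x + d)" using assms(2) less_imp_Suc_add by blast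
  ultimately show ?thesis using assms by simp
qed

lemma inv_sign_swap:
  assumes "x \<in> {1..r}" "y \<in> {1..r}" "x \<noteq> y" "j x = j y"
  shows "inv_sign m r j (transpose x y) = (if m < j x then - 1 else 1)"
proof (cases "x < y")
  case True
  then show ?thesis using assms by (intro inv_sign_swap_less) auto
next
  case False
  then have "inv_sign m r j (transpose y x) = (if m < j y then - 1 else 1)"
    using assms by (intro inv_sign_swap_less) auto
  then show ?thesis using assms(4) by (simp add: transpose_commute[of y x])
qed

section \<open>Classes in the supercommutative algebra\<close>

definition salg_class :: "nat \<Rightarrow> nat \<Rightarrow> ((nat \<times> nat) list \<Rightarrow> rat) \<Rightarrow> ((nat \<times> nat) list \<Rightarrow> rat) set" where
  "salg_class m n f = supercomm_ideal m n +>\<^bsub>free_alg (gens m n)\<^esub> f"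

abbreviation salg_reps :: "nat \<Rightarrow> nat \<Rightarrow> ((nat \<times> nat) list \<Rightarrow> rat) set" where
  "salg_reps m n \<equiv> carrier (free_alg (gens m n))"

lemma salg_class_hom:
  "salg_class m n \<in> ring_hom (free_alg (gens m n)) (free_alg (gens m n) Quot supercomm_ideal m n)"
  using ring_hom_ring.homh[OF ideal.rcos_ring_hom_ring[OF ideal_supercomm]]
  unfolding salg_class_def[abs_def] .

lemma salg_class_closed: "f \<in> salg_reps m n \<Longrightarrow> salg_class m n f \<in> carrier (salg m n)"
  unfolding salg_eq_Quot by (rule ring_hom_closed[OF salg_class_hom])

lemma salg_class_mult:
  "f \<in> salg_reps m n \<Longrightarrow> g \<in> salg_reps m n \<Longrightarrow>
    salg_class m n f \<otimes>\<^bsub>salg m n\<^esub> salg_class m n g = salg_class m n (wmult f g)"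
  unfolding salg_eq_Quot using ring_hom_mult[OF salg_class_hom, of f m n g]
    by (simp only: free_alg_simps)

lemma salg_class_add:
  "f \<in> salg_reps m n \<Longrightarrow> g \<in> salg_reps m n \<Longrightarrow>
    salg_class m n f \<oplus>\<^bsub>salg m n\<^esub> salg_class m n g = salg_class m n (\<lambda>w. f w + g w)"
  unfolding salg_eq_Quot using ring_hom_add[OF salg_class_hom, of f m n g]
    by (simp only: free_alg_simps)

lemma salg_class_one: "\<one>\<^bsub>salg m n\<^esub> = salg_class m n (wmonom [])"
  unfolding salg_eq_Quot using ring_hom_one[OF salg_class_hom, of m n] by (simp only: free_alg_simps)

lemma salg_class_smult:
  "f \<in> salg_reps m n \<Longrightarrow> q \<odot>\<^bsub>salg m n\<^esub> salg_class m n f = salg_class m n (\<lambda>w. q * f w)"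
  unfolding salg_class_def using smult_salg_coset[of f m n q] by (simp only: free_alg_simps)

lemma salg_reps_cmult: "f \<in> salg_reps m n \<Longrightarrow> (\<lambda>w. q * f w) \<in> salg_reps m n"
  by (auto elim: rev_finite_subset)

lemma salg_reps_zero: "(\<lambda>w. 0) \<in> salg_reps m n"
  by simp

lemma salg_reps_add: "f \<in> salg_reps m n \<Longrightarrow> g \<in> salg_reps m n \<Longrightarrow> (\<lambda>w. f w + g w) \<in> salg_reps m n"
  using abelian_monoid.a_closed[OF ring.axioms(1)[OF ring_free_alg, THEN abelian_group.axioms(1)],
      of f "gens m n" g]
  by (simp only: free_alg_simps(5))

lemma salg_reps_sum: "(\<And>a. a \<in> A \<Longrightarrow> f a \<in> salg_reps m n) \<Longrightarrow> (\<lambda>w. \<Sum>a\<in>A. f a w) \<in> salg_reps m n"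
proof (induction A rule: infinite_finite_induct)
  case (insert a A)
  have "(\<lambda>w. f a w + (\<Sum>a\<in>A. f a w)) \<in> salg_reps m n"
    by (intro salg_reps_add insert.IH insert.prems) simp_all
  then show ?case using insert.hyps by (simp only: sum.insert not_False_eq_True)
qed (simp_all only: sum.infinite sum.empty salg_reps_zero not_False_eq_True)

lemma salg_reps_wmult: "f \<in> salg_reps m n \<Longrightarrow> g \<in> salg_reps m n \<Longrightarrow> wmult f g \<in> salg_reps m n"
  using monoid.m_closed[OF ring.axioms(2)[OF ring_free_alg], of f "gens m n" g]
  by (simp only: free_alg_simps(2))

lemma salg_reps_wmonom: "xs \<in> lists (gens m n) \<Longrightarrow> wmonom xs \<in> salg_reps m n"
  by (auto simp: wmonom_def)

lemma salg_class_zero: "\<zero>\<^bsub>salg m n\<^esub> = salg_class m n (\<lambda>w. 0)"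
proof -
  interpret salg: ring "salg m n" by (rule ring_salg)
  have "salg_class m n (\<lambda>w. 0) \<oplus>\<^bsub>salg m n\<^esub> salg_class m n (\<lambda>w. 0) = salg_class m n (\<lambda>w. 0)"
    using salg_class_add[OF salg_reps_zero salg_reps_zero, of m n] by simp
  then show ?thesis
    using salg_class_closed[OF salg_reps_zero] by (metis salg.l_neg salg.r_neg1 salg.r_zero)
qed

lemma salg_class_finsum:
  assumes "finite A" "\<And>a. a \<in> A \<Longrightarrow> f a \<in> salg_reps m n"
  shows "(\<Oplus>\<^bsub>salg m n\<^esub>a\<in>A. salg_class m n (f a)) = salg_class m n (\<lambda>w. \<Sum>a\<in>A. f a w)"
proof -
  interpret salg: ring "salg m n" by (rule ring_salg)
  show ?thesis using assms
  proof (induction A rule: finite_induct)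
    case empty
    show ?case by (simp add: salg_class_zero)
  next
    case (insert a A)
    have "(\<Oplus>\<^bsub>salg m n\<^esub>a\<in>insert a A. salg_class m n (f a)) =
        salg_class m n (f a) \<oplus>\<^bsub>salg m n\<^esub> (\<Oplus>\<^bsub>salg m n\<^esub>a\<in>A. salg_class m n (f a))"
      using insert.hyps insert.prems salg_class_closed
      by (intro salg.finsum_insert) auto
    also have "\<dots> = salg_class m n (f a) \<oplus>\<^bsub>salg m n\<^esub> salg_class m n (\<lambda>w. \<Sum>a\<in>A. f a w)"
      using insert by (metis insertCI)
    also have "\<dots> = salg_class m n (\<lambda>w. f a w + (\<Sum>a\<in>A. f a w))"
      by (intro salg_class_add salg_reps_sum insert.prems) simp_all
    finally show ?case using insert.hyps by simp
  qed
qed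

text \<open>The integer multiples in the theorem are iterated sums in the ring; on classes they
  agree with scalar multiples. The negative case rests on uniqueness of additive inverses.\<close>

lemma salg_class_int_mult:
  assumes f: "f \<in> salg_reps m n"
  shows "[k] \<cdot>\<^bsub>salg m n\<^esub> salg_class m n f = salg_class m n (\<lambda>w. of_int k * f w)"
proof -
  interpret salg: ring "salg m n" by (rule ring_salg)
  have nat: "[l] \<cdot>\<^bsub>salg m n\<^esub> salg_class m n f = salg_class m n (\<lambda>w. of_nat l * f w)" for l :: nat
  proof (induction l)
    case 0
    show ?case by (simp add: salg_class_zero)
  next
    case (Suc l)
    have "[Suc l] \<cdot>\<^bsub>salg m n\<^esub> salg_class m n f = salg_class m n (\<lambda>w. of_nat l * f w + f w)"
      using salg_class_add[OF salg_reps_cmult[OF f] f] Suc by (simp add: salg.add.nat_pow_Suc)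
    then show ?case by (simp add: algebra_simps)
  qed
  show ?thesis
  proof (cases k rule: int_cases2)
    case (nonneg l)
    then show ?thesis using nat[of l] by (simp add: add_pow_def int_pow_int)
  next
    case (nonpos l)
    have "salg_class m n (\<lambda>w. - of_nat l * f w) \<oplus>\<^bsub>salg m n\<^esub> salg_class m n (\<lambda>w. of_nat l * f w) =
        \<zero>\<^bsub>salg m n\<^esub>"
      using salg_class_add[OF salg_reps_cmult[OF f] salg_reps_cmult[OF f], of "- of_nat l" "of_nat l"]
      by (simp add: salg_class_zero)
    then have "\<ominus>\<^bsub>salg m n\<^esub> ([l] \<cdot>\<^bsub>salg m n\<^esub> salg_class m n f) = salg_class m n (\<lambda>w. - of_nat l * f w)"
      unfolding nat by (intro salg.minus_equality salg_class_closed salg_reps_cmult f)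
    moreover have "[(- int l)] \<cdot>\<^bsub>salg m n\<^esub> salg_class m n f =
        \<ominus>\<^bsub>salg m n\<^esub> ([l] \<cdot>\<^bsub>salg m n\<^esub> salg_class m n f)"
      using salg.add.int_pow_neg_int[OF salg_class_closed[OF f]] by simp
    ultimately show ?thesis by (simp add: nonpos)
  qed
qed

lemma wmult_wmonom: "wmult (wmonom u) (wmonom v) = (wmonom (u @ v) :: 'a list \<Rightarrow> rat)"
proof
  fix w :: "'a list"
  have split: "take k w = u \<and> drop k w = v \<longleftrightarrow> k = length u \<and> w = u @ v" if "k \<le> length w" for k
  proof
    assume kw: "take k w = u \<and> drop k w = v"
    then have "length u = k" using that by (metis length_take min_absorb2)
    then show "k = length u \<and> w = u @ v" using kw by (metis append_take_drop_id)
  qed simp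
  have "wmult (wmonom u) (wmonom v) w =
      (\<Sum>k\<le>length w. if k = length u then of_bool (w = u @ v) else (0 :: rat))"
    unfolding wmult_def
  proof (intro sum.cong refl)
    fix k assume "k \<in> {..length w}"
    then have "take k w = u \<and> drop k w = v \<longleftrightarrow> k = length u \<and> w = u @ v" using split by simp
    then show "wmonom u (take k w) * wmonom v (drop k w) =
        (if k = length u then of_bool (w = u @ v) else (0 :: rat))"
      unfolding wmonom_def by auto
  qed
  also have "\<dots> = wmonom (u @ v) w" by (simp add: wmonom_def)
  finally show "wmult (wmonom u) (wmonom v) w = (wmonom (u @ v) w :: rat)" .
qed

lemma wmult_cmult:
  "wmult (\<lambda>w. q * f w) g = (\<lambda>w. q * wmult f g w)" "wmult f (\<lambda>w. q * g w) = (\<lambda>w. q * wmult f g w)"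
  by (simp_all add: wmult_def sum_distrib_left algebra_simps)

text \<open>The only use of the defining relations: the relator lies in the ideal, so its class
  vanishes, and the resulting equation is multiplied by words from both sides.\<close>

lemma salg_class_swap:
  assumes xs: "xs \<in> lists (gens m n)" and ys: "ys \<in> lists (gens m n)"
    and x: "x \<in> gens m n" and y: "y \<in> gens m n"
  shows "salg_class m n (wmonom (xs @ [x, y] @ ys)) =
    salg_class m n (\<lambda>w. (- 1) ^ (gpar m x * gpar m y) * wmonom (xs @ [y, x] @ ys) w)"
proof -
  interpret salg: ring "salg m n" by (rule ring_salg)
  interpret J: ideal "supercomm_ideal m n" "free_alg (gens m n)" by (rule ideal_supercomm)
  define q :: rat where "q = (- 1) ^ (gpar m x * gpar m y)"
  define f where "f = (\<lambda>w. q * wmonom [y, x] w)"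
  define g where "g = (\<lambda>w. wmonom [x, y] w - f w)"
  have g: "g \<in> supercomm_ideal m n"
    unfolding supercomm_ideal_def g_def f_def q_def
    by (rule subsetD[OF ring.genideal_self[OF ring_free_alg supercomm_rels_carrier]])
      (unfold supercomm_rels_def, use x y in blast)
  then have g': "g \<in> salg_reps m n" by (rule J.a_Hcarr)
  have f: "f \<in> salg_reps m n"
    unfolding f_def using x y by (intro salg_reps_cmult salg_reps_wmonom) simp
  have "salg_class m n g = salg_class m n (\<lambda>w. 0)"
    unfolding salg_class_def using J.a_rcos_const[OF g] J.a_rcos_const[OF
        additive_subgroup.zero_closed[OF J.additive_subgroup_axioms]]
    by (simp only: free_alg_simps)
  then have "salg_class m n f \<oplus>\<^bsub>salg m n\<^esub> salg_class m n g = salg_class m n f"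
    using salg_class_closed[OF f] by (simp flip: salg_class_zero)
  then have "salg_class m n (wmonom [x, y]) = salg_class m n f"
    unfolding salg_class_add[OF f g'] by (simp add: g_def)
  then have "salg_class m n (wmonom xs) \<otimes>\<^bsub>salg m n\<^esub> salg_class m n (wmonom [x,
      y]) \<otimes>\<^bsub>salg m n\<^esub> salg_class m n (wmonom ys) =
      salg_class m n (wmonom xs) \<otimes>\<^bsub>salg m n\<^esub> salg_class m n f \<otimes>\<^bsub>salg m n\<^esub> salg_class m n (wmonom ys)"
        by simp
  moreover have "wmonom xs \<in> salg_reps m n" "wmonom ys \<in> salg_reps m n" "wmonom [x, y] \<in> salg_reps m n"
    using assms by (auto intro!: salg_reps_wmonom simp del: free_alg_simps(1))
  ultimately have "salg_class m n (wmult (wmult (wmonom xs) (wmonom [x, y])) (wmonom ys)) =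
      salg_class m n (wmult (wmult (wmonom xs) f) (wmonom ys))"
    using f by (simp only: salg_class_mult salg_reps_wmult)
  then show ?thesis
    unfolding f_def wmult_cmult wmult_wmonom q_def by simp
qed

lemma salg_finsum_eq_class:
  assumes "finite A" "\<And>a. a \<in> A \<Longrightarrow> f a \<in> salg_reps m n" "\<And>a. a \<in> A \<Longrightarrow> x a = salg_class m n (f a)"
  shows "(\<Oplus>\<^bsub>salg m n\<^esub>a\<in>A. x a) = salg_class m n (\<lambda>w. \<Sum>a\<in>A. f a w)"
proof -
  interpret salg: ring "salg m n" by (rule ring_salg)
  have "(\<Oplus>\<^bsub>salg m n\<^esub>a\<in>A. x a) = (\<Oplus>\<^bsub>salg m n\<^esub>a\<in>A. salg_class m n (f a))"
    using assms(2,3) by (intro salg.finsum_cong') (auto intro: salg_class_closed simp del: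
        free_alg_simps(1))
  then show ?thesis using salg_class_finsum[OF assms(1,2)] by simp
qed

section \<open>Straightening of modified symmetrizers\<close>

definition index_word :: "nat \<Rightarrow> (nat \<Rightarrow> nat) \<Rightarrow> (nat \<Rightarrow> nat) \<Rightarrow> (nat \<times> nat) list" where
  "index_word r i j = map (\<lambda>t. (i t, j t)) [1..<r + 1]"

definition chi_exp :: "nat \<Rightarrow> nat \<Rightarrow> (nat \<Rightarrow> nat) \<Rightarrow> (nat \<Rightarrow> nat) \<Rightarrow> nat" where
  "chi_exp m r i j = (\<Sum>(t, u)\<in>index_pairs r. par m (i t) * (par m (i u) + par m (j u)))"

definition chi_rep :: "nat \<Rightarrow> nat \<Rightarrow> (nat \<Rightarrow> nat) \<Rightarrow> (nat \<Rightarrow> nat) \<Rightarrow> (nat \<times> nat) list \<Rightarrow> rat" where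
  "chi_rep m r i j = (\<lambda>w. (- 1) ^ chi_exp m r i j * wmonom (index_word r i j) w)"

lemma index_word_gens:
  assumes "i \<in> multiindices m n r" "j \<in> multiindices m n r"
  shows "index_word r i j \<in> lists (gens m n)"
  using assms by (auto simp: index_word_def gens_def multiindices_def PiE_iff)

lemma chi_rep_closed:
  "i \<in> multiindices m n r \<Longrightarrow> j \<in> multiindices m n r \<Longrightarrow> chi_rep m r i j \<in> salg_reps m n"
  unfolding chi_rep_def by (intro salg_reps_cmult salg_reps_wmonom index_word_gens)

lemma chi_eq_class:
  assumes ij: "i \<in> multiindices m n r" "j \<in> multiindices m n r"
  shows "chi m n r i j = salg_class m n (chi_rep m r i j)"
proof -
  interpret salg: ring "salg m n" by (rule ring_salg)
  have foldr: "foldr (\<otimes>\<^bsub>salg m n\<^esub>) (map (\<lambda>t. cgen m n (i t) (j t)) L) \<one>\<^bsub>salg m n\<^esub> =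
      salg_class m n (wmonom (map (\<lambda>t. (i t, j t)) L))"
    if "(\<lambda>t. (i t, j t)) ` set L \<subseteq> gens m n" for L
    using that
  proof (induction L)
    case Nil
    show ?case by (simp add: salg_class_one)
  next
    case (Cons t L)
    have "wmonom [(i t, j t)] \<in> salg_reps m n" "wmonom (map (\<lambda>t. (i t, j t)) L) \<in> salg_reps m n"
      using Cons.prems by (auto intro!: salg_reps_wmonom simp del: free_alg_simps(1))
    then show ?case
      using Cons by (simp add: cgen_def salg_class_mult wmult_wmonom flip: salg_class_def del:
          free_alg_simps(1))
  qed
  have "(\<lambda>t. (i t, j t)) ` set [1..<r + 1] \<subseteq> gens m n"
    using index_word_gens[OF ij] by (auto simp: index_word_def)
  note prod = foldr[OF this, folded index_word_def]
  have "(\<Sum>t = 1..r. par m (i t) * (\<Sum>u = t + 1..r. par m (i u) + par m (j u))) =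
      (\<Sum>(t, u)\<in>Sigma {1..r} (\<lambda>t. {t + 1..r}). par m (i t) * (par m (i u) + par m (j u)))"
    unfolding sum_distrib_left by (rule sum.Sigma) auto
  also have "Sigma {1..r} (\<lambda>t. {t + 1..r}) = index_pairs r" by (auto simp: index_pairs_def)
  finally show ?thesis
    unfolding chi_def prod chi_rep_def chi_exp_def[symmetric]
    by (simp only: salg_class_smult[OF salg_reps_wmonom[OF index_word_gens[OF ij]]] chi_exp_def)
qed

lemma multiindices_comp:
  "i \<in> multiindices m n r \<Longrightarrow> \<pi> permutes {1..r} \<Longrightarrow> i \<circ> \<pi> \<in> multiindices m n r"
  unfolding multiindices_def by (rule PiE_comp_permutes)

text \<open>Let a, b be the parities of i, j at \<open>k\<close> and a', b' those at
  \<open>Suc k\<close>. Exchanging the letters costs (a + b)(a' + b'), the exponent of \<chi>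
  changes by a(a' + b') + a'(a + b), and modulo 2 the sum is aa' + bb', the exponents of the two
  action signs.\<close>

lemma chi_rep_adjacent:
  assumes ij: "i \<in> multiindices m n r" "j \<in> multiindices m n r" and k: "1 \<le> k" "k < r"
  defines "s \<equiv> transpose k (Suc k)"
  shows "salg_class m n (chi_rep m r i j) =
    salg_class m n (\<lambda>w. of_int (inv_sign m r i s * inv_sign m r j s) * chi_rep m r (i \<circ> s) (j \<circ> s) w)"
proof -
  define c where "c t = (i t, j t)" for t
  define pre where "pre = map c [1..<k]"
  define suf where "suf = map c [Suc (Suc k)..<r + 1]"
  have upt: "[1..<r + 1] = [1..<k] @ [k, Suc k] @ [Suc (Suc k)..<r + 1]"
  proof -
    have "[1..<r + 1] = [1..<k] @ [k..<r + 1]"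
      using upt_add_eq_append[of 1 k "r + 1 - k"] k by simp
    also have "[k..<r + 1] = k # Suc k # [Suc (Suc k)..<r + 1]"
      using k by (simp add: upt_rec[of k] upt_rec[of "Suc k"])
    finally show ?thesis by simp
  qed
  have word: "index_word r i j = pre @ [c k, c (Suc k)] @ suf"
    unfolding index_word_def upt pre_def suf_def by (simp add: c_def)
  have "map (\<lambda>t. ((i \<circ> s) t, (j \<circ> s) t)) [1..<k] = pre"
    "map (\<lambda>t. ((i \<circ> s) t, (j \<circ> s) t)) [Suc (Suc k)..<r + 1] = suf"
    unfolding pre_def suf_def by (auto simp: c_def s_def transpose_def simp del: upt_Suc)
  then have word_s: "index_word r (i \<circ> s) (j \<circ> s) = pre @ [c (Suc k), c k] @ suf"
    unfolding index_word_def upt map_append by (simp add: c_def s_def)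
  have gens: "pre \<in> lists (gens m n)" "suf \<in> lists (gens m n)" "c k \<in> gens m n" "c (Suc k) \<in> gens m n"
    using index_word_gens[OF ij] unfolding word by auto
  define F where "F t u = par m (i t) * (par m (i u) + par m (j u))" for t u
  have exp: "chi_exp m r (i \<circ> s) (j \<circ> s) + F k (Suc k) = chi_exp m r i j + F (Suc k) k"
    using sum_index_pairs_adjacent[OF k, of F, folded s_def] by (simp add: chi_exp_def F_def)
  have "(- 1 :: rat) ^ chi_exp m r (i \<circ> s) (j \<circ> s) * (- 1) ^ F k (Suc k) = (- 1) ^ chi_exp m r i j *
      (- 1) ^ F (Suc k) k"
    unfolding power_add[symmetric] exp ..
  then have "(- 1 :: rat) ^ chi_exp m r i j * (- 1) ^ (gpar m (c k) * gpar m (c (Suc k))) =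
      of_int (inv_sign m r i s * inv_sign m r j s) * (- 1) ^ chi_exp m r (i \<circ> s) (j \<circ> s)"
    unfolding s_def inv_sign_adjacent[OF k]
    by (simp add: F_def c_def gpar_def par_def split: if_splits)
  then have "(\<lambda>w. (- 1) ^ chi_exp m r i j * ((- 1) ^ (gpar m (c k) * gpar m (c (Suc k))) *
      wmonom (pre @ [c (Suc k), c k] @ suf) w)) =
      (\<lambda>w. of_int (inv_sign m r i s * inv_sign m r j s) * chi_rep m r (i \<circ> s) (j \<circ> s) w)"
    unfolding chi_rep_def word_s mult.assoc[symmetric] by (simp only:)
  moreover have "salg_class m n (chi_rep m r i j) =
      (- 1) ^ chi_exp m r i j \<odot>\<^bsub>salg m n\<^esub> salg_class m n (wmonom (index_word r i j))"
    unfolding chi_rep_def by (rule salg_class_smult[symmetric,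
        OF salg_reps_wmonom[OF index_word_gens[OF ij]]])
  moreover have "salg_class m n (wmonom (index_word r i j)) =
      salg_class m n (\<lambda>w. (- 1) ^ (gpar m (c k) * gpar m (c (Suc k))) * wmonom (pre @ [c (Suc k),
          c k] @ suf) w)"
    unfolding word by (rule salg_class_swap[OF gens])
  moreover have "pre @ [c (Suc k), c k] @ suf \<in> lists (gens m n)" using gens by simp
  ultimately show ?thesis
    by (simp only: salg_class_smult salg_reps_cmult salg_reps_wmonom)
qed

text \<open>The signs of the adjacent steps multiply to the sign of the whole permutation by the
  cocycle law, which gives the invariance of \<chi>.\<close>

lemma chi_rep_permute:
  assumes ij: "i \<in> multiindices m n r" "j \<in> multiindices m n r" and \<pi>: "\<pi> permutes {1..r}"
  shows "salg_class m n (chi_rep m r i j) =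
    salg_class m n (\<lambda>w. of_int (inv_sign m r i \<pi> * inv_sign m r j \<pi>) * chi_rep m r (i \<circ> \<pi>) (j \<circ> \<pi>) w)"
  using \<pi>
proof (induction rule: adjacent_transpositions_induct)
  case id
  show ?case by (simp only: inv_sign_id comp_id mult_1 of_int_1)
next
  case (adjacent \<pi> k)
  define s where "s = transpose k (Suc k)"
  have s: "s permutes {1..r}" unfolding s_def using adjacent by (intro permutes_swap_id) auto
  define q :: rat where "q = of_int (inv_sign m r i \<pi> * inv_sign m r j \<pi>)"
  define q' :: rat where "q' = of_int (inv_sign m r (i \<circ> \<pi>) s * inv_sign m r (j \<circ> \<pi>) s)"
  note ij\<pi> = multiindices_comp[OF ij(1) adjacent(1)] multiindices_comp[OF ij(2) adjacent(1)]
  note ij\<pi>s = multiindices_comp[OF ij\<pi>(1) s] multiindices_comp[OF ij\<pi>(2) s]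
  have "salg_class m n (chi_rep m r i j) = q \<odot>\<^bsub>salg m n\<^esub> salg_class m n (chi_rep m r (i \<circ> \<pi>) (j \<circ> \<pi>))"
    unfolding adjacent(4) q_def by (rule salg_class_smult[symmetric, OF chi_rep_closed[OF ij\<pi>]])
  also have "\<dots> = q \<odot>\<^bsub>salg m n\<^esub> salg_class m n (\<lambda>w. q' * chi_rep m r (i \<circ> \<pi> \<circ> s) (j \<circ> \<pi> \<circ> s) w)"
    unfolding q'_def s_def by (rule arg_cong[OF chi_rep_adjacent[OF ij\<pi> adjacent(2,3)]])
  also have "\<dots> = salg_class m n (\<lambda>w. q * (q' * chi_rep m r (i \<circ> \<pi> \<circ> s) (j \<circ> \<pi> \<circ> s) w))"
    by (rule salg_class_smult[OF salg_reps_cmult[OF chi_rep_closed[OF ij\<pi>s]]])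
  also have "(\<lambda>w. q * (q' * chi_rep m r (i \<circ> \<pi> \<circ> s) (j \<circ> \<pi> \<circ> s) w)) =
      (\<lambda>w. of_int (inv_sign m r i (\<pi> \<circ> s) * inv_sign m r j (\<pi> \<circ> s)) *
          chi_rep m r (i \<circ> (\<pi> \<circ> s)) (j \<circ> (\<pi> \<circ> s)) w)"
    unfolding inv_sign_comp[OF adjacent(1) s] q_def q'_def by (simp add: comp_assoc mult_ac)
  finally show ?case unfolding s_def .
qed

lemma part_antimono:
  assumes "is_partition lam r" "1 \<le> p" "p \<le> p'"
  shows "part lam p' \<le> part lam p"
proof (cases "p' \<le> length lam \<and> p < p'")
  case True
  then have "lam ! (p' - 1) \<le> lam ! (p - 1)"
    using assms sorted_wrt_nth_less[of "(\<ge>)" lam "p - 1" "p' - 1"] by (auto simp: is_partition_def)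
  then show ?thesis using True assms by (simp add: part_def)
next
  case False
  then show ?thesis using assms by (cases "p = p'") (auto simp: part_def)
qed

section \<open>The two straightening problems attached to a tableau\<close>

locale tableau_shape =
  fixes m n r :: nat and lam :: "nat list" and T :: "nat \<times> nat \<Rightarrow> nat"
  assumes partition: "is_partition lam r" and basic: "basic_tableau lam r T"
begin

text \<open>Boxes are identified with their numbers under \<open>T\<close>, so that multiindices are
  themselves words on the boxes and rows and columns become functions of positions.\<close>

definition box :: "nat \<Rightarrow> nat \<times> nat" where "box = inv_into (diagram lam) T"
definition row :: "nat \<Rightarrow> nat" where "row x = fst (box x)"
definition col :: "nat \<Rightarrow> nat" where "col x = snd (box x)"

lemma box_in: "x \<in> {1..r} \<Longrightarrow> box x \<in> diagram lam"
  and T_box: "x \<in> {1..r} \<Longrightarrow> T (box x) = x"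
  using basic unfolding basic_tableau_def box_def bij_betw_def
  by (metis inv_into_into, metis f_inv_into_f)

lemma T_in: "b \<in> diagram lam \<Longrightarrow> T b \<in> {1..r}"
  and box_T: "b \<in> diagram lam \<Longrightarrow> box (T b) = b"
  using basic unfolding basic_tableau_def box_def bij_betw_def by (blast, metis inv_into_f_f)

lemma row_col_T: "(p, q) \<in> diagram lam \<Longrightarrow> row (T (p, q)) = p" "(p, q) \<in> diagram lam \<Longrightarrow> col (T (p, q)) = q"
  by (simp_all add: row_def col_def box_T)

lemma row_col_box: "x \<in> {1..r} \<Longrightarrow> (row x, col x) \<in> diagram lam" "x \<in> {1..r} \<Longrightarrow> T (row x, col x) = x"
  using box_in T_box by (simp_all add: row_def col_def)

lemma row_col_inj:
  assumes "x \<in> {1..r}" "y \<in> {1..r}" "row x = row y" "col x = col y"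
  shows "x = y"
  using row_col_box(2)[OF assms(1)] row_col_box(2)[OF assms(2)] assms(3,4) by metis

lemma corner:
  assumes "x \<in> {1..r}" "y \<in> {1..r}" "row x \<le> row y"
  shows "\<exists>z\<in>{1..r}. row z = row x \<and> col z = col y"
proof -
  have "(row x, col y) \<in> diagram lam"
    using row_col_box(1)[OF assms(1)] row_col_box(1)[OF assms(2)] part_antimono[OF partition,
        of "row x" "row y"] assms(3)
    by (auto simp: diagram_def)
  then show ?thesis using T_in row_col_T by blast
qed

lemma corner':
  assumes "x \<in> {1..r}" "y \<in> {1..r}" "col x \<le> col y"
  shows "\<exists>z\<in>{1..r}. row z = row y \<and> col z = col x"
proof -
  have "(row y, col x) \<in> diagram lam"
    using row_col_box(1)[OF assms(1)] row_col_box(1)[OF assms(2)] assms(3) by (auto simp: diagram_def)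
  then show ?thesis using T_in row_col_T by blast
qed

sublocale rows: young_words "{1..r}" row col "{1..m + n}" "\<lambda>a. m < a" "inv_sign m r"
proof
  fix x y :: nat
  assume xy: "x \<in> {1..r}" "y \<in> {1..r}"
  then show "row x = row y \<Longrightarrow> col x = col y \<Longrightarrow> x = y"
    "row x \<le> row y \<Longrightarrow> \<exists>z\<in>{1..r}. row z = row x \<and> col z = col y"
    "col x \<le> col y \<Longrightarrow> \<exists>z\<in>{1..r}. row z = row y \<and> col z = col x"
    by (blast intro: row_col_inj corner corner')+
  show "x \<noteq> y \<Longrightarrow> w x = w y \<Longrightarrow> inv_sign m r w (transpose x y) = (if m < w x then - 1 else 1)" for w
    using inv_sign_swap xy by blast
next
  show "finite {1..r}" "finite {1..m + n}" by simp_all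
  show "inv_sign m r w id = 1" for w by (rule inv_sign_id)
  show "inv_sign m r w (\<pi> \<circ> \<sigma>) = inv_sign m r w \<pi> * inv_sign m r (w \<circ> \<pi>) \<sigma>"
    if "\<pi> permutes {1..r}" "\<sigma> permutes {1..r}" for w \<pi> \<sigma>
    using that by (rule inv_sign_comp)
qed

text \<open>Multiplying the action by \<open>sign\<close> interchanges the roles of even and odd symbols, and transposing
  the tableau interchanges symmetrization and antisymmetrization.\<close>

sublocale cols: young_words "{1..r}" col row "{1..m + n}" "\<lambda>a. \<not> m < a" "\<lambda>w \<pi>. sign \<pi> *
    inv_sign m r w \<pi>"
proof
  fix x y :: nat
  assume xy: "x \<in> {1..r}" "y \<in> {1..r}"
  show "x = y" if "col x = col y" "row x = row y"
    by (rule row_col_inj[OF xy that(2,1)])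
  show "\<exists>z\<in>{1..r}. col z = col x \<and> row z = row y" if "col x \<le> col y"
    using corner'[OF xy that] by (simp only: conj_commute)
  show "\<exists>z\<in>{1..r}. col z = col y \<and> row z = row x" if "row x \<le> row y"
    using corner[OF xy that] by (simp only: conj_commute)
  show "x \<noteq> y \<Longrightarrow> w x = w y \<Longrightarrow> sign (transpose x y) * inv_sign m r w (transpose x y) =
      (if \<not> m < w x then - 1 else 1)"
    for w using inv_sign_swap[OF xy, of w m] by (simp add: sign_swap_id)
next
  fix w :: "nat \<Rightarrow> nat" and \<pi> \<sigma> :: "nat \<Rightarrow> nat"
  assume p: "\<pi> permutes {1..r}" "\<sigma> permutes {1..r}"
  have "sign (\<pi> \<circ> \<sigma>) = sign \<pi> * sign \<sigma>"
    using p by (intro sign_compose permutes_imp_permutation[of "{1..r}"]) simp_all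
  then show "sign (\<pi> \<circ> \<sigma>) * inv_sign m r w (\<pi> \<circ> \<sigma>) =
      sign \<pi> * inv_sign m r w \<pi> * (sign \<sigma> * inv_sign m r (w \<circ> \<pi>) \<sigma>)"
    by (simp only: inv_sign_comp[OF p] mult_ac)
next
  show "finite {1..r}" "finite {1..m + n}" by simp_all
  show "sign id * inv_sign m r w id = 1" for w by (simp only: inv_sign_id sign_id mult_1)
qed

lemma row_group_eq: "row_group lam r T = fiber_perms {1..r} row"
proof -
  have row_set: "row_set lam T p = {x \<in> {1..r}. row x = p}" for p
  proof (intro equalityI subsetI)
    fix x assume "x \<in> row_set lam T p"
    then obtain b where "b \<in> diagram lam" "fst b = p" "x = T b" by (auto simp: row_set_def)
    then show "x \<in> {x \<in> {1..r}. row x = p}" using T_in by (simp add: row_def box_T)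
  next
    fix x assume "x \<in> {x \<in> {1..r}. row x = p}"
    then show "x \<in> row_set lam T p"
      unfolding row_set_def using row_col_box[of x] by (intro image_eqI[of _ _ "(row x, col x)"]) auto
  qed
  show ?thesis
    unfolding row_group_def row_set by (rule fiber_perms_altdef[symmetric]) simp
qed

lemma col_group_eq: "col_group lam r T = fiber_perms {1..r} col"
proof -
  have col_set: "col_set lam T p = {x \<in> {1..r}. col x = p}" for p
  proof (intro equalityI subsetI)
    fix x assume "x \<in> col_set lam T p"
    then obtain b where "b \<in> diagram lam" "snd b = p" "x = T b" by (auto simp: col_set_def)
    then show "x \<in> {x \<in> {1..r}. col x = p}" using T_in by (simp add: col_def box_T)
  next
    fix x assume "x \<in> {x \<in> {1..r}. col x = p}"
    then show "x \<in> col_set lam T p"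
      unfolding col_set_def using row_col_box[of x] by (intro image_eqI[of _ _ "(row x, col x)"]) auto
  qed
  show ?thesis
    unfolding col_group_def col_set by (rule fiber_perms_altdef[symmetric]) simp
qed

section \<open>Symmetrizers as combinations of the elements \<chi>\<close>

lemma finite_groups: "finite (fiber_perms {1..r} row)" "finite (fiber_perms {1..r} col)"
  by (simp_all add: finite_fiber_perms)

lemma signed_chi_class:
  assumes ij: "i \<in> multiindices m n r" "j \<in> multiindices m n r"
    and p: "\<rho> permutes {1..r}" "\<kappa> permutes {1..r}" "\<pi> permutes {1..r}"
  shows "rat_of_int (sign \<kappa>) \<odot>\<^bsub>salg m n\<^esub> signed_chi m n r (signed_act m r i \<rho>) (signed_act m r j \<kappa>) =
    salg_class m n (\<lambda>w. of_int (sign \<kappa> * inv_sign m r i (\<rho> \<circ> \<pi>) * inv_sign m r j (\<kappa> \<circ> \<pi>)) *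
      chi_rep m r (i \<circ> (\<rho> \<circ> \<pi>)) (j \<circ> (\<kappa> \<circ> \<pi>)) w)"
proof -
  note ip = multiindices_comp[OF ij(1) p(1)] and jp = multiindices_comp[OF ij(2) p(2)]
  note closed = chi_rep_closed[OF multiindices_comp[OF ip p(3)] multiindices_comp[OF jp p(3)]]
  have "signed_chi m n r (signed_act m r i \<rho>) (signed_act m r j \<kappa>) =
      of_int (inv_sign m r i \<rho> * inv_sign m r j \<kappa>) \<odot>\<^bsub>salg m n\<^esub> chi m n r (i \<circ> \<rho>) (j \<circ> \<kappa>)"
    by (simp add: signed_chi_def signed_act_def inv_sign_def)
  also have "chi m n r (i \<circ> \<rho>) (j \<circ> \<kappa>) = salg_class m n (\<lambda>w.
      of_int (inv_sign m r (i \<circ> \<rho>) \<pi> * inv_sign m r (j \<circ> \<kappa>) \<pi>) * chi_rep m r (i \<circ> \<rho> \<circ> \<pi>) (j \<circ> \<kappa> \<circ> \<pi>) w)"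
    unfolding chi_eq_class[OF ip jp] by (rule chi_rep_permute[OF ip jp p(3)])
  finally show ?thesis
    unfolding inv_sign_comp[OF p(1,3)] inv_sign_comp[OF p(2,3)]
    by (simp only: salg_class_smult[OF salg_reps_cmult[OF closed]] salg_class_smult[OF
        salg_reps_cmult[OF salg_reps_cmult[OF closed]]])
      (simp add: comp_assoc mult_ac)
qed

text \<open>Invariance of \<chi> allows a diagonal permutation that depends on the summation
  indices. The inverse of \<kappa> moves the whole action to \<open>i\<close>, the inverse of \<rho>
  moves it to \<open>j\<close>.\<close>

lemma symmetrizer_class_general:
  assumes ij: "i \<in> multiindices m n r" "j \<in> multiindices m n r"
    and \<pi>: "\<And>\<rho> \<kappa>. \<rho> permutes {1..r} \<Longrightarrow> \<kappa> permutes {1..r} \<Longrightarrow> \<pi> \<rho> \<kappa> permutes {1..r}"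
  shows "symmetrizer m n r lam T i j = salg_class m n (\<lambda>w.
    \<Sum>\<rho>\<in>fiber_perms {1..r} row. \<Sum>\<kappa>\<in>fiber_perms {1..r} col.
      of_int (sign \<kappa> * inv_sign m r i (\<rho> \<circ> \<pi> \<rho> \<kappa>) * inv_sign m r j (\<kappa> \<circ> \<pi> \<rho> \<kappa>)) *
      chi_rep m r (i \<circ> (\<rho> \<circ> \<pi> \<rho> \<kappa>)) (j \<circ> (\<kappa> \<circ> \<pi> \<rho> \<kappa>)) w)"
proof -
  let ?f = "\<lambda>\<rho> \<kappa> w. of_int (sign \<kappa> * inv_sign m r i (\<rho> \<circ> \<pi> \<rho> \<kappa>) * inv_sign m r j (\<kappa> \<circ> \<pi> \<rho> \<kappa>)) *
      chi_rep m r (i \<circ> (\<rho> \<circ> \<pi> \<rho> \<kappa>)) (j \<circ> (\<kappa> \<circ> \<pi> \<rho> \<kappa>)) w"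
  have closed: "?f \<rho> \<kappa> \<in> salg_reps m n"
    if "\<rho> \<in> fiber_perms {1..r} row" "\<kappa> \<in> fiber_perms {1..r} col" for \<rho> \<kappa>
    using fiber_permsD(1)[OF that(1)] fiber_permsD(1)[OF that(2)] \<pi>
    by (intro salg_reps_cmult chi_rep_closed multiindices_comp ij permutes_compose) auto
  show ?thesis
    unfolding symmetrizer_def row_group_eq col_group_eq
  proof (intro salg_finsum_eq_class finite_groups salg_reps_sum closed)
    fix \<rho> \<kappa> assume "\<rho> \<in> fiber_perms {1..r} row" "\<kappa> \<in> fiber_perms {1..r} col"
    then have "\<rho> permutes {1..r}" "\<kappa> permutes {1..r}" using fiber_permsD(1) by blast+
    then show "rat_of_int (sign \<kappa>) \<odot>\<^bsub>salg m n\<^esub> signed_chi m n r (signed_act m r i \<rho>) (signed_act m r j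
        \<kappa>) =
        salg_class m n (?f \<rho> \<kappa>)"
      using \<pi> by (intro signed_chi_class ij)
  qed
qed

text \<open>With the inverse of \<kappa> applied to both arguments, \<open>j\<close> is restored.
  Replacing \<kappa> by its inverse keeps the sign and the sum, which leaves row symmetrization of
  \<open>i\<close> followed by column antisymmetrization.\<close>

lemma symmetrizer_class_rows:
  assumes ij: "i \<in> multiindices m n r" "j \<in> multiindices m n r"
  shows "symmetrizer m n r lam T i j =
    salg_class m n (\<lambda>w. \<Sum>z\<in>multiindices m n r. of_int (rows.young_coeff i z) * chi_rep m r z j w)"
proof -
  have "(\<Sum>\<rho>\<in>fiber_perms {1..r} row. \<Sum>\<kappa>\<in>fiber_perms {1..r} col.
      of_int (sign \<kappa> * inv_sign m r i (\<rho> \<circ> inv_into UNIV \<kappa>) * inv_sign m r j (\<kappa> \<circ> inv_into UNIV \<kappa>)) *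
      chi_rep m r (i \<circ> (\<rho> \<circ> inv_into UNIV \<kappa>)) (j \<circ> (\<kappa> \<circ> inv_into UNIV \<kappa>)) w) =
    (\<Sum>\<rho>\<in>fiber_perms {1..r} row. \<Sum>\<kappa>\<in>fiber_perms {1..r} col.
      of_int (sign (inv_into UNIV \<kappa>) * inv_sign m r i (\<rho> \<circ> inv_into UNIV \<kappa>)) *
      chi_rep m r (i \<circ> (\<rho> \<circ> inv_into UNIV \<kappa>)) j w)" for w
  proof (intro sum.cong refl)
    fix \<rho> \<kappa> assume "\<kappa> \<in> fiber_perms {1..r} col"
    then have \<kappa>: "\<kappa> permutes {1..r}" by (rule fiber_permsD(1))
    then have "sign (inv_into UNIV \<kappa>) = sign \<kappa>"
      by (intro sign_inverse permutes_imp_permutation[of "{1..r}"]) simp_all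
    then show "of_int (sign \<kappa> * inv_sign m r i (\<rho> \<circ> inv_into UNIV \<kappa>) *
        inv_sign m r j (\<kappa> \<circ> inv_into UNIV \<kappa>)) *
        chi_rep m r (i \<circ> (\<rho> \<circ> inv_into UNIV \<kappa>)) (j \<circ> (\<kappa> \<circ> inv_into UNIV \<kappa>)) w =
      of_int (sign (inv_into UNIV \<kappa>) * inv_sign m r i (\<rho> \<circ> inv_into UNIV \<kappa>)) *
        chi_rep m r (i \<circ> (\<rho> \<circ> inv_into UNIV \<kappa>)) j w"
      by (simp only: permutes_inv_o(1)[OF \<kappa>] inv_sign_id comp_id mult_1_right)
  qed
  also have "\<dots> w = (\<Sum>\<rho>\<in>fiber_perms {1..r} row. \<Sum>\<kappa>\<in>fiber_perms {1..r} col.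
      of_int (sign \<kappa> * inv_sign m r i (\<rho> \<circ> \<kappa>)) * chi_rep m r (i \<circ> (\<rho> \<circ> \<kappa>)) j w)" for w
    by (intro sum.cong refl sum_fiber_perms_inv)
  also have "\<dots> w = (\<Sum>z\<in>multiindices m n r. of_int (rows.young_coeff i z) * chi_rep m r z j w)" for w
    unfolding multiindices_def
    by (rule rows.young_coeff_expand) (use ij in \<open>simp add: multiindices_def\<close>)
  finally show ?thesis
    using symmetrizer_class_general[OF ij, of "\<lambda>\<rho> \<kappa>. inv_into UNIV \<kappa>"] by (simp only: permutes_inv)
qed

lemma symmetrizer_class_cols:
  assumes ij: "i \<in> multiindices m n r" "j \<in> multiindices m n r"
  shows "symmetrizer m n r lam T i j =
    salg_class m n (\<lambda>w. \<Sum>z\<in>multiindices m n r. of_int (cols.young_coeff j z) * chi_rep m r i z w)"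
proof -
  have "(\<Sum>\<rho>\<in>fiber_perms {1..r} row. \<Sum>\<kappa>\<in>fiber_perms {1..r} col.
      of_int (sign \<kappa> * inv_sign m r i (\<rho> \<circ> inv_into UNIV \<rho>) * inv_sign m r j (\<kappa> \<circ> inv_into UNIV \<rho>)) *
      chi_rep m r (i \<circ> (\<rho> \<circ> inv_into UNIV \<rho>)) (j \<circ> (\<kappa> \<circ> inv_into UNIV \<rho>)) w) =
    (\<Sum>\<rho>\<in>fiber_perms {1..r} row. \<Sum>\<kappa>\<in>fiber_perms {1..r} col.
      of_int (sign \<kappa> * inv_sign m r j (\<kappa> \<circ> inv_into UNIV \<rho>)) *
          chi_rep m r i (j \<circ> (\<kappa> \<circ> inv_into UNIV \<rho>)) w)" for w
  proof (intro sum.cong refl)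
    fix \<rho> \<kappa> assume "\<rho> \<in> fiber_perms {1..r} row"
    then have \<rho>: "\<rho> permutes {1..r}" by (rule fiber_permsD(1))
    show "of_int (sign \<kappa> * inv_sign m r i (\<rho> \<circ> inv_into UNIV \<rho>) *
        inv_sign m r j (\<kappa> \<circ> inv_into UNIV \<rho>)) *
        chi_rep m r (i \<circ> (\<rho> \<circ> inv_into UNIV \<rho>)) (j \<circ> (\<kappa> \<circ> inv_into UNIV \<rho>)) w =
      of_int (sign \<kappa> * inv_sign m r j (\<kappa> \<circ> inv_into UNIV \<rho>)) *
          chi_rep m r i (j \<circ> (\<kappa> \<circ> inv_into UNIV \<rho>)) w"
      by (simp only: permutes_inv_o(1)[OF \<rho>] inv_sign_id comp_id mult_1_right)
  qed
  also have "\<dots> w = (\<Sum>\<rho>\<in>fiber_perms {1..r} row. \<Sum>\<kappa>\<in>fiber_perms {1..r} col.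
      of_int (sign \<kappa> * inv_sign m r j (\<kappa> \<circ> \<rho>)) * chi_rep m r i (j \<circ> (\<kappa> \<circ> \<rho>)) w)" for w
    by (rule sum_fiber_perms_inv)
  also have "\<dots> w = (\<Sum>\<kappa>\<in>fiber_perms {1..r} col. \<Sum>\<rho>\<in>fiber_perms {1..r} row.
      of_int (sign \<kappa> * inv_sign m r j (\<kappa> \<circ> \<rho>)) * chi_rep m r i (j \<circ> (\<kappa> \<circ> \<rho>)) w)" for w
    by (rule sum.swap)
  \<comment> \<open>The cocycle of \<open>cols\<close> contains the sign of the product
    \<open>\<kappa> \<circ> \<rho>\<close>. Extracting it moves the remaining sign from \<kappa> to
    \<rho>, so that columns are symmetrized and rows antisymmetrized.\<close>
  also have "\<dots> w = (\<Sum>\<kappa>\<in>fiber_perms {1..r} col. \<Sum>\<rho>\<in>fiber_perms {1..r} row.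
      of_int (sign \<rho> * (sign (\<kappa> \<circ> \<rho>) * inv_sign m r j (\<kappa> \<circ> \<rho>))) * chi_rep m r i (j \<circ> (\<kappa> \<circ> \<rho>)) w)" for w
  proof (intro sum.cong refl)
    fix \<rho> \<kappa> assume "\<rho> \<in> fiber_perms {1..r} row" "\<kappa> \<in> fiber_perms {1..r} col"
    then have "permutation \<rho>" "permutation \<kappa>"
      using permutes_imp_permutation[OF finite_atLeastAtMost fiber_permsD(1)] by blast+
    then have "sign \<rho> * sign (\<kappa> \<circ> \<rho>) = sign \<kappa>" by (simp add: sign_compose)
    then show "of_int (sign \<kappa> * inv_sign m r j (\<kappa> \<circ> \<rho>)) * chi_rep m r i (j \<circ> (\<kappa> \<circ> \<rho>)) w =
        of_int (sign \<rho> * (sign (\<kappa> \<circ> \<rho>) * inv_sign m r j (\<kappa> \<circ> \<rho>))) * chi_rep m r i (j \<circ> (\<kappa> \<circ> \<rho>)) w"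
      by (simp only: mult.assoc[symmetric])
  qed
  also have "\<dots> w = (\<Sum>z\<in>multiindices m n r. of_int (cols.young_coeff j z) * chi_rep m r i z w)" for w
    unfolding multiindices_def
    by (rule cols.young_coeff_expand) (use ij in \<open>simp add: multiindices_def\<close>)
  finally show ?thesis
    using symmetrizer_class_general[OF ij, of "\<lambda>\<rho> \<kappa>. inv_into UNIV \<rho>"] by (simp only: permutes_inv)
qed

section \<open>Normalizing factors and semistandardness\<close>

lemma row_factor_eq_card:
  assumes i: "i \<in> multiindices m n r"
  shows "row_factor m lam (tab T i) = card (rows.even_row_stab i)"
proof -
  let ?S = "{x \<in> {1..r}. \<not> m < i x}" and ?V = "{1..length lam} \<times> {1..m}"
  have "row x \<in> {1..length lam} \<and> i x \<in> {1..m}" if x: "x \<in> {1..r}" "\<not> m < i x" for x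
  proof -
    have "1 \<le> i x" using i x by (auto simp: multiindices_def)
    moreover have "1 \<le> row x" "row x \<le> length lam"
      using row_col_box(1)[OF x(1)] by (auto simp: diagram_def part_def split: if_splits)
    ultimately show ?thesis using x by simp
  qed
  then have "(\<lambda>x. (row x, i x)) ` ?S \<subseteq> ?V" by blast
  then have "card (rows.even_row_stab i) = (\<Prod>v\<in>?V. fact (card {x \<in> ?S. (row x, i x) = v}))"
    unfolding rows.even_row_stab_def by (intro card_fiber_perms) simp_all
  also have "\<dots> = (\<Prod>(q, a)\<in>?V. fact (row_mult lam (tab T i) a q))"
  proof (intro prod.cong refl, clarify)
    fix q a assume "q \<in> {1..length lam}" "a \<in> {1..m}"
    have "bij_betw T {b \<in> diagram lam. fst b = q \<and> tab T i b = a} {x \<in> ?S. (row x, i x) = (q, a)}"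
      by (rule bij_betw_byWitness[where f' = box])
        (use \<open>a \<in> {1..m}\<close> T_in T_box box_in box_T in \<open>auto simp: row_def tab_def\<close>)
    then show "fact (card {x \<in> ?S. (row x, i x) = (q, a)}) = fact (row_mult lam (tab T i) a q)"
      unfolding row_mult_def by (simp add: bij_betw_same_card)
  qed
  also have "\<dots> = row_factor m lam (tab T i)"
    unfolding row_factor_def prod.cartesian_product[symmetric] by (rule prod.swap)
  finally show ?thesis by simp
qed

text \<open>In \<open>cols\<close> both parity and the roles of rows and columns are exchanged, so
  its \<open>even_row_stab\<close> permutes boxes with equal odd entries within columns, a group of
  order c(T_j).\<close>

lemma col_factor_eq_card:
  assumes j: "j \<in> multiindices m n r"
  shows "col_factor m n lam (tab T j) = card (cols.even_row_stab j)"
proof -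
  let ?S = "{x \<in> {1..r}. \<not> \<not> m < j x}" and ?V = "{1..part lam 1} \<times> {m + 1..m + n}"
  have "col x \<in> {1..part lam 1} \<and> j x \<in> {m + 1..m + n}" if x: "x \<in> {1..r}" "m < j x" for x
  proof -
    have "j x \<le> m + n" using j x by (auto simp: multiindices_def)
    moreover have "1 \<le> col x" "col x \<le> part lam 1"
      using row_col_box(1)[OF x(1)] part_antimono[OF partition, of 1 "row x"]
        by (auto simp: diagram_def)
    ultimately show ?thesis using x by simp
  qed
  then have "(\<lambda>x. (col x, j x)) ` ?S \<subseteq> ?V" by blast
  then have "card (cols.even_row_stab j) = (\<Prod>v\<in>?V. fact (card {x \<in> ?S. (col x, j x) = v}))"
    unfolding cols.even_row_stab_def by (intro card_fiber_perms) simp_all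
  also have "\<dots> = (\<Prod>(d, a)\<in>?V. fact (col_mult lam (tab T j) a d))"
  proof (intro prod.cong refl, clarify)
    fix d a assume "d \<in> {1..part lam 1}" "a \<in> {m + 1..m + n}"
    have "bij_betw T {b \<in> diagram lam. snd b = d \<and> tab T j b = a} {x \<in> ?S. (col x, j x) = (d, a)}"
      by (rule bij_betw_byWitness[where f' = box])
        (use \<open>a \<in> {m + 1..m + n}\<close> T_in T_box box_in box_T in \<open>auto simp: col_def tab_def\<close>)
    then show "fact (card {x \<in> ?S. (col x, j x) = (d, a)}) = fact (col_mult lam (tab T j) a d)"
      unfolding col_mult_def by (simp add: bij_betw_same_card)
  qed
  also have "\<dots> = col_factor m n lam (tab T j)"
    unfolding col_factor_def prod.cartesian_product[symmetric] by (rule prod.swap)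
  finally show ?thesis by simp
qed

lemma semistandard_iff: "semistandard m lam (tab T u) \<longleftrightarrow> rows.semistd u"
proof
  assume L: "semistandard m lam (tab T u)"
  show "rows.semistd u"
    unfolding rows.semistd_def
  proof (intro conjI ballI impI; elim conjE)
    fix x y assume xy: "x \<in> {1..r}" "y \<in> {1..r}"
    note X = row_col_box[OF xy(1)] and Y = row_col_box[OF xy(2)]
    {
      assume "row x = row y" "col x < col y"
      then have "tab T u (row x, col x) \<le> tab T u (row y, col y) \<and>
          (m < tab T u (row x, col x) \<longrightarrow> tab T u (row x, col x) \<noteq> tab T u (row y, col y))"
        using L X(1) Y(1) unfolding semistandard_def by metis
      then show "u x \<le> u y" "m < u x \<Longrightarrow> u x \<noteq> u y" by (simp_all add: tab_def X(2) Y(2))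
    next
      assume "col x = col y" "row x < row y"
      then have "tab T u (row x, col x) \<le> tab T u (row y, col y) \<and>
          (tab T u (row x, col x) \<le> m \<longrightarrow> tab T u (row x, col x) \<noteq> tab T u (row y, col y))"
        using L X(1) Y(1) unfolding semistandard_def by metis
      then show "u x \<le> u y" "\<not> m < u x \<Longrightarrow> u x \<noteq> u y" by (simp_all add: tab_def X(2) Y(2))
    }
  qed
next
  assume R: "rows.semistd u"
  show "semistandard m lam (tab T u)"
    unfolding semistandard_def tab_def
  proof (intro conjI allI impI; elim conjE)
    fix p q q' assume "(p, q) \<in> diagram lam" "(p, q') \<in> diagram lam" "q < q'"
    then show "u (T (p, q)) \<le> u (T (p, q'))" "m < u (T (p, q)) \<Longrightarrow> u (T (p, q)) \<noteq> u (T (p, q'))"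
      using R T_in row_col_T unfolding rows.semistd_def by metis+
  next
    fix p p' q assume "(p, q) \<in> diagram lam" "(p', q) \<in> diagram lam" "p < p'"
    then show "u (T (p, q)) \<le> u (T (p', q))" "u (T (p, q)) \<le> m \<Longrightarrow> u (T (p, q)) \<noteq> u (T (p', q))"
      using R T_in row_col_T not_less unfolding rows.semistd_def by metis+
  qed
qed

text \<open>Exchanging rows with columns and even with odd symbols at once interchanges the two
  halves of the condition.\<close>

lemma semistd_transpose: "cols.semistd u \<longleftrightarrow> rows.semistd u"
  unfolding cols.semistd_def rows.semistd_def by auto

lemma semistandard_indices_eq:
  "semistandard_indices m n r lam T = rows.semistd_words" "semistandard_indices m n r lam T =
      cols.semistd_words"
  unfolding semistandard_indices_def multiindices_def semistandard_iff semistd_transpose by simp_all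

text \<open>A representative of T{i:j} with the whole action carried by \<open>i\<close>. It depends
  on \<open>i\<close> only through the normalized coefficients, so straightening \<open>i\<close> is
  an identity of functions, with coefficients independent of \<open>j\<close>.\<close>

definition modified_rep :: "(nat \<Rightarrow> nat) \<Rightarrow> (nat \<Rightarrow> nat) \<Rightarrow> (nat \<times> nat) list \<Rightarrow> rat" where
  "modified_rep i j = (\<lambda>w. \<Sum>z\<in>multiindices m n r.
    of_int (rows.young_coeff i z) / of_nat (card (rows.even_row_stab i)) *
      (chi_rep m r z j w / of_nat (card (cols.even_row_stab j))))"

lemma modified_rep_closed:
  assumes "j \<in> multiindices m n r"
  shows "modified_rep i j \<in> salg_reps m n"
proof -
  have "modified_rep i j = (\<lambda>w. \<Sum>z\<in>multiindices m n r.
      (of_int (rows.young_coeff i z) / of_nat (card (rows.even_row_stab i)) / of_nat (card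
          (cols.even_row_stab j)))
        * chi_rep m r z j w)"
    by (simp add: modified_rep_def)
  then show ?thesis
    using assms by (simp only: salg_reps_sum salg_reps_cmult chi_rep_closed)
qed

lemma modified_symmetrizer_rows:
  assumes ij: "i \<in> multiindices m n r" "j \<in> multiindices m n r"
  shows "modified_symmetrizer m n r lam T i j = salg_class m n (modified_rep i j)"
proof -
  have "(\<lambda>w. \<Sum>z\<in>multiindices m n r. of_int (rows.young_coeff i z) * chi_rep m r z j w) \<in> salg_reps m n"
    by (intro salg_reps_sum salg_reps_cmult chi_rep_closed ij)
  then show ?thesis
    unfolding modified_symmetrizer_def row_factor_eq_card[OF ij(1)] col_factor_eq_card[OF ij(2)]
      symmetrizer_class_rows[OF ij] modified_rep_def
    by (simp only: salg_class_smult) (simp add: sum_distrib_left divide_inverse mult_ac)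
qed

lemma modified_symmetrizer_cols:
  assumes ij: "i \<in> multiindices m n r" "j \<in> multiindices m n r"
  shows "modified_symmetrizer m n r lam T i j = salg_class m n (\<lambda>w. \<Sum>z\<in>multiindices m n r.
    of_int (cols.young_coeff j z) / of_nat (card (cols.even_row_stab j)) *
      (chi_rep m r i z w / of_nat (card (rows.even_row_stab i))))"
proof -
  have "(\<lambda>w. \<Sum>z\<in>multiindices m n r. of_int (cols.young_coeff j z) * chi_rep m r i z w) \<in> salg_reps m n"
    by (intro salg_reps_sum salg_reps_cmult chi_rep_closed ij)
  then show ?thesis
    unfolding modified_symmetrizer_def row_factor_eq_card[OF ij(1)] col_factor_eq_card[OF ij(2)]
      symmetrizer_class_cols[OF ij]
    by (simp only: salg_class_smult) (simp add: sum_distrib_left divide_inverse mult_ac)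
qed

section \<open>Straightening one argument at a time\<close>

lemma finite_semistandard_indices: "finite (semistandard_indices m n r lam T)"
  unfolding semistandard_indices_eq(1) using rows.finite_words by simp

lemma semistandard_indices_subset: "semistandard_indices m n r lam T \<subseteq> multiindices m n r"
  unfolding semistandard_indices_def by blast

lemma straighten_rows:
  assumes i: "i \<in> multiindices m n r"
  shows "\<exists>k :: _ \<Rightarrow> int. \<forall>j. modified_rep i j =
    (\<lambda>w. \<Sum>u\<in>semistandard_indices m n r lam T. of_int (k u) * modified_rep u j w)"
proof -
  obtain k :: "(nat \<Rightarrow> nat) \<Rightarrow> int" where
    k: "\<And>z. of_int (rows.young_coeff i z) / of_nat (card (rows.even_row_stab i)) =
      (\<Sum>u\<in>semistandard_indices m n r lam T.
        of_int (k u) * (of_int (rows.young_coeff u z) / of_nat (card (rows.even_row_stab u)) :: rat))"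
    using rows.integral_straightening[of i] i
    unfolding semistandard_indices_eq(1) multiindices_def by blast
  have "modified_rep i j w = (\<Sum>u\<in>semistandard_indices m n r lam T. of_int (k u) *
      modified_rep u j w)" for j w
    unfolding modified_rep_def k sum_distrib_left sum_distrib_right mult.assoc by (rule sum.swap)
  then show ?thesis by blast
qed

text \<open>Straightening \<open>j\<close> yields representatives \<open>N v\<close> with the action
  carried by the second argument. They need not equal \<open>modified_rep i v\<close> as functions;
  only the classes agree, so the change is made term by term in the quotient.\<close>

lemma straighten_cols:
  assumes j: "j \<in> multiindices m n r"
  shows "\<exists>l :: _ \<Rightarrow> int. \<forall>i\<in>multiindices m n r. modified_symmetrizer m n r lam T i j =
    salg_class m n (\<lambda>w. \<Sum>v\<in>semistandard_indices m n r lam T. of_int (l v) * modified_rep i v w)"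
proof -
  obtain l :: "(nat \<Rightarrow> nat) \<Rightarrow> int" where
    l: "\<And>z. of_int (cols.young_coeff j z) / of_nat (card (cols.even_row_stab j)) =
      (\<Sum>v\<in>semistandard_indices m n r lam T.
        of_int (l v) * (of_int (cols.young_coeff v z) / of_nat (card (cols.even_row_stab v)) :: rat))"
    using cols.integral_straightening[of j] j
    unfolding semistandard_indices_eq(2) multiindices_def by blast
  show ?thesis
  proof (intro exI[of _ l] ballI)
    fix i assume i: "i \<in> multiindices m n r"
    interpret salg: ring "salg m n" by (rule ring_salg)
    define N where "N v = (\<lambda>w. \<Sum>z\<in>multiindices m n r. of_int (cols.young_coeff v z) / of_nat (card
        (cols.even_row_stab v)) *
      (chi_rep m r i z w / of_nat (card (rows.even_row_stab i))))" for v
    have N_closed: "N v \<in> salg_reps m n" for v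
    proof -
      have "N v = (\<lambda>w. \<Sum>z\<in>multiindices m n r. (of_int (cols.young_coeff v z) / of_nat (card
          (cols.even_row_stab v)) /
          of_nat (card (rows.even_row_stab i))) * chi_rep m r i z w)"
        by (simp add: N_def)
      then show ?thesis using i by (simp only: salg_reps_sum salg_reps_cmult chi_rep_closed)
    qed
    have "N j w = (\<Sum>v\<in>semistandard_indices m n r lam T. of_int (l v) * N v w)" for w
      unfolding N_def l sum_distrib_left sum_distrib_right mult.assoc by (rule sum.swap)
    then have "modified_symmetrizer m n r lam T i j =
        salg_class m n (\<lambda>w. \<Sum>v\<in>semistandard_indices m n r lam T. of_int (l v) * N v w)"
      using modified_symmetrizer_cols[OF i j] unfolding N_def by simp
    also have "\<dots> = (\<Oplus>\<^bsub>salg m n\<^esub>v\<in>semistandard_indices m n r lam T. [l v] \<cdot>\<^bsub>salg m n\<^esub> salg_class m n (N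
        v))"
      by (intro salg_finsum_eq_class[symmetric] finite_semistandard_indices salg_reps_cmult N_closed
          salg_class_int_mult)
    also have "\<dots> = (\<Oplus>\<^bsub>salg m n\<^esub>v\<in>semistandard_indices m n r lam T. [l v] \<cdot>\<^bsub>salg m n\<^esub> salg_class m n
        (modified_rep i v))"
    proof (intro salg.finsum_cong' refl)
      fix v assume "v \<in> semistandard_indices m n r lam T"
      then have v: "v \<in> multiindices m n r" using semistandard_indices_subset by blast
      then show "[l v] \<cdot>\<^bsub>salg m n\<^esub> salg_class m n (N v) =
          [l v] \<cdot>\<^bsub>salg m n\<^esub> salg_class m n (modified_rep i v)"
        using modified_symmetrizer_rows[OF i v] modified_symmetrizer_cols[OF i v] by (simp only: N_def)
    qed (use semistandard_indices_subset in \<open>auto intro!: salg.add.int_pow_closed salg_class_closed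
        modified_rep_closed
        simp del: free_alg_simps(1)\<close>)
    also have "\<dots> = salg_class m n (\<lambda>w. \<Sum>v\<in>semistandard_indices m n r lam T. of_int (l v) *
        modified_rep i v w)"
      using semistandard_indices_subset
      by (intro salg_finsum_eq_class finite_semistandard_indices salg_reps_cmult modified_rep_closed
          salg_class_int_mult) blast+
    finally show "modified_symmetrizer m n r lam T i j =
        salg_class m n (\<lambda>w. \<Sum>v\<in>semistandard_indices m n r lam T. of_int (l v) * modified_rep i v w)" .
  qed
qed

lemma modified_symmetrizer_deg:
  assumes ij: "i \<in> multiindices m n r" "j \<in> multiindices m n r"
  shows "modified_symmetrizer m n r lam T i j \<in> salg_deg m n r"
proof -
  have "length w = r" if "modified_rep i j w \<noteq> 0" for w
  proof -
    have "\<exists>z. chi_rep m r z j w \<noteq> 0"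
    proof (rule ccontr)
      assume "\<not> ?thesis"
      then have "modified_rep i j w = 0" by (simp add: modified_rep_def)
      then show False using that by contradiction
    qed
    then obtain z where "chi_rep m r z j w \<noteq> 0" ..
    then have "w = index_word r z j" by (auto simp: chi_rep_def wmonom_def split: if_splits)
    then show ?thesis by (simp add: index_word_def)
  qed
  then show ?thesis
    using modified_symmetrizer_rows[OF ij] modified_rep_closed[OF ij(2)]
    unfolding salg_deg_def salg_class_def by blast
qed

text \<open>Since \<open>k\<close> does not depend on the second argument, each
  \<open>modified_rep i v\<close> in the expansion of \<open>j\<close> is expanded with the same
  \<open>k\<close>, which gives the product coefficients \<open>k u * l v\<close>.\<close>

lemma modified_symmetrizer_straightening:
  assumes ij: "i \<in> multiindices m n r" "j \<in> multiindices m n r"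
  shows "\<exists>k :: (nat \<Rightarrow> nat) \<Rightarrow> (nat \<Rightarrow> nat) \<Rightarrow> int.
    modified_symmetrizer m n r lam T i j =
      (\<Oplus>\<^bsub>salg m n\<^esub>u\<in>semistandard_indices m n r lam T.
        \<Oplus>\<^bsub>salg m n\<^esub>v\<in>semistandard_indices m n r lam T.
          [k u v] \<cdot>\<^bsub>salg m n\<^esub> modified_symmetrizer m n r lam T u v)"
proof -
  let ?SS = "semistandard_indices m n r lam T"
  obtain k where k: "\<And>j. modified_rep i j = (\<lambda>w. \<Sum>u\<in>?SS. of_int (k u) * modified_rep u j w)"
    using straighten_rows[OF ij(1)] by blast
  obtain l where l: "\<And>i. i \<in> multiindices m n r \<Longrightarrow> modified_symmetrizer m n r lam T i j =
      salg_class m n (\<lambda>w. \<Sum>v\<in>?SS. of_int (l v) * modified_rep i v w)"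
    using straighten_cols[OF ij(2)] by blast
  have SS: "u \<in> multiindices m n r" if "u \<in> ?SS" for u using that semistandard_indices_subset by blast
  have "(\<Oplus>\<^bsub>salg m n\<^esub>u\<in>?SS. \<Oplus>\<^bsub>salg m n\<^esub>v\<in>?SS. [(k u *
      l v)] \<cdot>\<^bsub>salg m n\<^esub> modified_symmetrizer m n r lam T u v) =
      salg_class m n (\<lambda>w. \<Sum>u\<in>?SS. \<Sum>v\<in>?SS. of_int (k u * l v) * modified_rep u v w)"
    by (intro salg_finsum_eq_class finite_semistandard_indices salg_reps_sum salg_reps_cmult
        modified_rep_closed SS)
      (simp_all only: modified_symmetrizer_rows SS salg_class_int_mult modified_rep_closed)
  also have "(\<lambda>w. \<Sum>u\<in>?SS. \<Sum>v\<in>?SS. of_int (k u * l v) * modified_rep u v w) =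
      (\<lambda>w. \<Sum>v\<in>?SS. of_int (l v) * modified_rep i v w)"
  proof
    fix w
    show "(\<Sum>u\<in>?SS. \<Sum>v\<in>?SS. of_int (k u * l v) * modified_rep u v w) =
        (\<Sum>v\<in>?SS. of_int (l v) * modified_rep i v w)"
      unfolding k[of "_"] sum_distrib_left by (subst sum.swap) (simp add: mult_ac)
  qed
  finally show ?thesis using l[OF ij(1)] by (intro exI[of _ "\<lambda>u v. k u * l v"]) simp
qed

end

theorem theorem5p2:
  fixes m n r :: nat and lam :: "nat list" and T :: "nat \<times> nat \<Rightarrow> nat" and i j :: "nat \<Rightarrow> nat"
  assumes "hook_partition m n r lam"
    and "basic_tableau lam r T"
    and "i \<in> multiindices m n r"
    and "j \<in> multiindices m n r"
  shows "modified_symmetrizer m n r lam T i j \<in> salg_deg m n r \<and>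
    (\<exists>k :: (nat \<Rightarrow> nat) \<Rightarrow> (nat \<Rightarrow> nat) \<Rightarrow> int.
      modified_symmetrizer m n r lam T i j =
        (\<Oplus>\<^bsub>salg m n\<^esub>u\<in>semistandard_indices m n r lam T.
          \<Oplus>\<^bsub>salg m n\<^esub>v\<in>semistandard_indices m n r lam T.
            [k u v] \<cdot>\<^bsub>salg m n\<^esub> modified_symmetrizer m n r lam T u v))"
proof -
  interpret tableau_shape m n r lam T
    using assms(1,2) by unfold_locales (simp_all add: hook_partition_def)
  show ?thesis
    using modified_symmetrizer_deg modified_symmetrizer_straightening assms(3,4) by blast
qed

end
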